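(* Assume $\frac{2n}{n+2}<p<\infty$ and $n+2<q\le\infty$. Let $\varepsilon\in(0,1)$ and let $u_\varepsilon$ be a solution of $\partial_tu_\varepsilon-\operatorname{div}(\nabla E_\varepsilon(\nabla u_\varepsilon))=f_\varepsilon$ in $\Omega_T$. Define $(d,d_1)=(p/2,\,2)$ if $p\ge2$, and $(d,d_1)=\big(\frac{2p}{p(n+2)-2n},\,p'\big)$ if $\frac{2n}{n+2}<p<2$; define $d_2=\frac{d(n+2)}{p}$ if $n\ge3$ and $d_2=\frac{2d\sigma}{p}$ if $n=2$, where $\sigma\in(2,q/2)$ is arbitrarily fixed. Then there exists $C\in(1,\infty)$, depending at most on $n,p,q,\lambda,\Lambda,K,\sigma$, such that $$\sup_{Q_{\theta R}}V_\varepsilon\le\frac{C}{(1-\theta)^{d_2}}\Big(1+\|f_\varepsilon\|_{L^q(Q_R)}^{d_1}+⨍_{Q_R}V_\varepsilon^p\,dX\Big)^{d/p}$$ for every cylinder $Q_R=Q_R(x_*,t_* )\Subset\Omega_T$ with $R\in(0,1)$ and every $\theta\in(0,1)$, where $Q_{\theta R}=Q_{\theta R}(x_*,t_* )$.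
   Context: Standing setting. $n\ge2$; $\Omega\subset\mathbb{R}^n$ bounded Lipschitz domain; $T>0$; $\Omega_T=\Omega\times(0,T)$; $p'=p/(p-1)$. $E_1\in C^0(\mathbb{R}^n)\cap C^2(\mathbb{R}^n\setminus\{0\})$ is positively one-homogeneous; $E_p\in C^1(\mathbb{R}^n)\cap C^2(\mathbb{R}^n\setminus\{0\})$ with $|\nabla E_p(z)|\le\Lambda_0|z|^{p-1}$, $\lambda_0|z|^{p-2}\mathrm{id}_n\le\nabla^2E_p(z)\le\Lambda_0|z|^{p-2}\mathrm{id}_n$ ($z\ne0$); $K_0$ is a constant with $|\nabla E_1(z)|\le K_0$, $0\le\nabla^2E_1(z)\le K_0|z|^{-1}\mathrm{id}_n$ ($z\ne0$). With $j$ a radial non-negative mollifier ($\int j=1$, support $\overline{B_1}$), $j_\varepsilon=\varepsilon^{-n}j(\cdot/\varepsilon)$, $E_{s,\varepsilon}=j_\varepsilon*E_s$, $E_\varepsilon=E_{1,\varepsilon}+E_{p,\varepsilon}$. Constants $\lambda,\Lambda,K$ (depending only on $n,p,\lambda_0,\Lambda_0,K_0$) are such that for all $\varepsilon\in(0,1)$, $z\in\mathbb{R}^n$: $|\nabla E_{1,\varepsilon}(z)|\le K$, $0\le\nabla^2E_{1,\varepsilon}(z)\le K(\varepsilon^2+|z|^2)^{-1/2}\mathrm{id}_n$, $|\nabla E_{p,\varepsilon}(z)|\le\Lambda(\varepsilon^2+|z|^2)^{(p-1)/2}$, $\lambda(\varepsilon^2+|z|^2)^{p/2-1}\mathrm{id}_n\le\nabla^2E_{p,\varepsilon}(z)\le\Lambda(\varepsilon^2+|z|^2)^{p/2-1}\mathrm{id}_n$.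 Approximate solutions: $f_\varepsilon\in C^\infty(\Omega_T)\cap L^q(\Omega_T)$, and $u_\varepsilon$ is a weak solution of $\partial_tu_\varepsilon-\operatorname{div}(\nabla E_\varepsilon(\nabla u_\varepsilon))=f_\varepsilon$ which is smooth in $\Omega_T$. $V_\varepsilon=\sqrt{\varepsilon^2+|\nabla u_\varepsilon|^2}$. Cylinders: $B_r(x_0)$ open ball, $I_r(t_0)=(t_0-r^2,t_0]$, $Q_r(x_0,t_0)=B_r(x_0)\times I_r(t_0)$; $⨍$ denotes an average integral. *)

theory Defs
  imports "HOL-Analysis.Analysis" "HOL-Probability.Essential_Supremum"
begin

fun Ck_on :: "nat \<Rightarrow> 'a::euclidean_space set \<Rightarrow> ('a \<Rightarrow> real) \<Rightarrow> bool" where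
  "Ck_on 0 S g = continuous_on S g"
| "Ck_on (Suc k) S g = (continuous_on S g \<and> (\<forall>x\<in>S. g differentiable (at x)) \<and>
      (\<forall>b\<in>Basis. Ck_on k S (\<lambda>x. frechet_derivative g (at x) b)))"

definition smooth_on :: "'a::euclidean_space set \<Rightarrow> ('a \<Rightarrow> real) \<Rightarrow> bool" where
  "smooth_on S g \<longleftrightarrow> (\<forall>k. Ck_on k S g)"

definition grad :: "(real^'n \<Rightarrow> real) \<Rightarrow> real^'n \<Rightarrow> real^'n" where
  "grad E z = (\<chi> i. frechet_derivative E (at z) (axis i 1))"

definition hess :: "(real^'n \<Rightarrow> real) \<Rightarrow> real^'n \<Rightarrow> real^'n^'n" where
  "hess E z = (\<chi> i j. frechet_derivative (\<lambda>w. grad E w $ j) (at z) (axis i 1))"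

definition hessq :: "(real^'n \<Rightarrow> real) \<Rightarrow> real^'n \<Rightarrow> real^'n \<Rightarrow> real" where
  "hessq E z v = v \<bullet> (hess E z *v v)"

definition grad_x :: "((real^'n) \<times> real \<Rightarrow> real) \<Rightarrow> (real^'n) \<times> real \<Rightarrow> real^'n" where
  "grad_x u X = (\<chi> i. frechet_derivative u (at X) (axis i 1, 0))"

definition dt :: "((real^'n) \<times> real \<Rightarrow> real) \<Rightarrow> (real^'n) \<times> real \<Rightarrow> real" where
  "dt u X = frechet_derivative u (at X) (0, 1)"

text \<open>Bounded Lipschitz domain: open, connected, bounded, boundary locally the graph of a
  Lipschitz function (in a rotated coordinate system given by the unit normal direction e;
  \<gamma> is evaluated on the hyperplane orthogonal to e).\<close>
definition bounded_lipschitz_domain :: "(real^'n) set \<Rightarrow> bool" where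
  "bounded_lipschitz_domain \<Omega> \<longleftrightarrow> open \<Omega> \<and> connected \<Omega> \<and> \<Omega> \<noteq> {} \<and> bounded \<Omega> \<and>
     (\<forall>x0\<in>frontier \<Omega>. \<exists>r>0. \<exists>e::real^'n. norm e = 1 \<and>
        (\<exists>\<gamma> L. L-lipschitz_on UNIV \<gamma> \<and>
           (\<forall>x\<in>ball x0 r. x \<in> \<Omega> \<longleftrightarrow> (x - x0) \<bullet> e < \<gamma> ((x - x0) - ((x - x0) \<bullet> e) *\<^sub>R e))))"

definition cyl :: "real^'n \<Rightarrow> real \<Rightarrow> real \<Rightarrow> ((real^'n) \<times> real) set" where
  "cyl x0 t0 r = ball x0 r \<times> {t0 - r\<^sup>2 <.. t0}"

definition mollifier :: "(real^'n \<Rightarrow> real) \<Rightarrow> bool" where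
  "mollifier j \<longleftrightarrow> smooth_on UNIV j \<and> (\<forall>x. 0 \<le> j x) \<and>
     (\<forall>x y. norm x = norm y \<longrightarrow> j x = j y) \<and>
     (j has_integral 1) UNIV \<and> closure {x. j x \<noteq> 0} = cball 0 1"

definition moll :: "(real^'n \<Rightarrow> real) \<Rightarrow> real \<Rightarrow> (real^'n \<Rightarrow> real) \<Rightarrow> real^'n \<Rightarrow> real" where
  "moll j \<epsilon> E z = integral UNIV (\<lambda>w. (\<epsilon> powr (- real CARD('n)) * j ((1/\<epsilon>) *\<^sub>R (z - w))) * E w)"

definition Eeps :: "(real^'n \<Rightarrow> real) \<Rightarrow> real \<Rightarrow> (real^'n \<Rightarrow> real) \<Rightarrow> (real^'n \<Rightarrow> real) \<Rightarrow> real^'n \<Rightarrow> real" where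
  "Eeps j \<epsilon> E1 Ep z = moll j \<epsilon> E1 z + moll j \<epsilon> Ep z"

definition struct_E1 :: "real \<Rightarrow> (real^'n \<Rightarrow> real) \<Rightarrow> bool" where
  "struct_E1 K0 E1 \<longleftrightarrow> continuous_on UNIV E1 \<and> Ck_on 2 (- {0}) E1 \<and>
     (\<forall>s>0. \<forall>z. E1 (s *\<^sub>R z) = s * E1 z) \<and>
     (\<forall>z. z \<noteq> 0 \<longrightarrow> norm (grad E1 z) \<le> K0 \<and>
        (\<forall>v. 0 \<le> hessq E1 z v \<and> hessq E1 z v \<le> K0 / norm z * (norm v)\<^sup>2))"

definition struct_Ep :: "real \<Rightarrow> real \<Rightarrow> real \<Rightarrow> (real^'n \<Rightarrow> real) \<Rightarrow> bool" where
  "struct_Ep p lam0 Lam0 Ep \<longleftrightarrow> Ck_on 1 UNIV Ep \<and> Ck_on 2 (- {0}) Ep \<and>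
     (\<forall>z. norm (grad Ep z) \<le> Lam0 * norm z powr (p - 1)) \<and>
     (\<forall>z. z \<noteq> 0 \<longrightarrow> (\<forall>v. lam0 * norm z powr (p - 2) * (norm v)\<^sup>2 \<le> hessq Ep z v \<and>
                              hessq Ep z v \<le> Lam0 * norm z powr (p - 2) * (norm v)\<^sup>2))"

definition moll_bounds :: "real \<Rightarrow> real \<Rightarrow> real \<Rightarrow> real \<Rightarrow> (real^'n \<Rightarrow> real) \<Rightarrow>
    (real^'n \<Rightarrow> real) \<Rightarrow> (real^'n \<Rightarrow> real) \<Rightarrow> bool" where
  "moll_bounds p lam Lam K j E1 Ep \<longleftrightarrow> (\<forall>\<epsilon>\<in>{0<..<1}. \<forall>z v.
     norm (grad (moll j \<epsilon> E1) z) \<le> K \<and>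
     0 \<le> hessq (moll j \<epsilon> E1) z v \<and>
     hessq (moll j \<epsilon> E1) z v \<le> K * (\<epsilon>\<^sup>2 + (norm z)\<^sup>2) powr (-1/2) * (norm v)\<^sup>2 \<and>
     norm (grad (moll j \<epsilon> Ep) z) \<le> Lam * (\<epsilon>\<^sup>2 + (norm z)\<^sup>2) powr ((p - 1)/2) \<and>
     lam * (\<epsilon>\<^sup>2 + (norm z)\<^sup>2) powr (p/2 - 1) * (norm v)\<^sup>2 \<le> hessq (moll j \<epsilon> Ep) z v \<and>
     hessq (moll j \<epsilon> Ep) z v \<le> Lam * (\<epsilon>\<^sup>2 + (norm z)\<^sup>2) powr (p/2 - 1) * (norm v)\<^sup>2)"

definition in_Lq :: "ereal \<Rightarrow> 'a::euclidean_space set \<Rightarrow> ('a \<Rightarrow> real) \<Rightarrow> bool" where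
  "in_Lq q S f \<longleftrightarrow> f \<in> borel_measurable (lebesgue_on S) \<and>
     (if q = \<infinity> then (\<exists>M. AE X in lebesgue_on S. \<bar>f X\<bar> \<le> M)
      else integrable (lebesgue_on S) (\<lambda>X. \<bar>f X\<bar> powr real_of_ereal q))"

definition Lq_norm :: "ereal \<Rightarrow> 'a::euclidean_space set \<Rightarrow> ('a \<Rightarrow> real) \<Rightarrow> real" where
  "Lq_norm q S f = (if q = \<infinity> then real_of_ereal (esssup (lebesgue_on S) (\<lambda>X. ereal \<bar>f X\<bar>))
     else (integral\<^sup>L (lebesgue_on S) (\<lambda>X. \<bar>f X\<bar> powr real_of_ereal q)) powr (1 / real_of_ereal q))"

definition weak_solution :: "(real^'n \<Rightarrow> real) \<Rightarrow> ((real^'n) \<times> real) set \<Rightarrow>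
    ((real^'n) \<times> real \<Rightarrow> real) \<Rightarrow> ((real^'n) \<times> real \<Rightarrow> real) \<Rightarrow> bool" where
  "weak_solution E D u f \<longleftrightarrow> (\<forall>\<phi>. smooth_on UNIV \<phi> \<and>
       (\<exists>S. compact S \<and> S \<subseteq> D \<and> (\<forall>X. X \<notin> S \<longrightarrow> \<phi> X = 0)) \<longrightarrow>
     integral\<^sup>L (lebesgue_on D) (\<lambda>X. - u X * dt \<phi> X + grad E (grad_x u X) \<bullet> grad_x \<phi> X)
       = integral\<^sup>L (lebesgue_on D) (\<lambda>X. f X * \<phi> X))"

end

theory Submission
  imports Defs
begin

text \<open>Write \<open>V\<^sup>2 = G = \<epsilon>\<^sup>2 + |\<nabla>u|\<^sup>2\<close>. On a cylinder let \<open>H = \<eta> G\<close>, where \<open>\<eta>\<close> is one fixed polynomial that vanishes on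
  the lateral and the bottom boundary and equals \<open>1\<close> at the centre of the top. Testing the differentiated equation with
  \<open>\<eta> (H - l)\<^sub>+\<^sup>3 \<nabla>u\<close> gives an energy inequality for \<open>(H - l)\<^sub>+\<^sup>2\<close>. Its coefficients are comparable
  to \<open>k powr (p - 2)\<close> provided \<open>l \<ge> k\<^sup>2\<close> and \<open>V\<close> is bounded by a fixed multiple of \<open>k\<close>. With a weak-type Sobolev
  inequality, De Giorgi's iteration over levels between \<open>k\<^sup>2\<close> and \<open>2 k\<^sup>2\<close> yields \<open>V\<^sup>2 \<le> 2 k\<^sup>2\<close> at the centre as soon
  as \<open>k powr (p / d)\<close> dominates the mean of \<open>V powr p\<close> and the appropriate power of the norm of \<open>f\<close>. Since \<open>k\<close> also
  has to dominate \<open>V\<close> on the cylinder, this is applied at a maximum point of \<open>V\<close> weighted with a power of the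
  parabolic distance to the boundary, and the weight produces the power of \<open>1 - \<theta>\<close>.\<close>

section \<open>Functions of class \<open>C\<^sup>k\<close>\<close>

text \<open>Two obstacles shape the proof. The constants must not depend on \<epsilon>, although the
  Hessian of \<open>Eeps\<close> is not of one power type: with g = \<epsilon>^2 + |z|^2 its
  \<open>E1\<close> part is of order g^(-1/2), and p > 1 lets the term g^(p/2 - 1) absorb this where
  g \<ge> 1. All levels are therefore at least k^2 \<ge> 1. Moreover, everything is done with
  classical derivatives: u and f are smooth, so the equation can be differentiated, and powers of a
  truncation are C^1 from the second on. The cube in the test function makes the energy that of w =
  (H - l)_+^2, which is itself C^1, so that no approximation of Lipschitz functions enters. Because
  the cut-off is part of H, a truncation localises by itself, and neither the cylinder nor the
  cut-off changes along the iteration. The weak-type inequality bounds the measure of a superlevel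
  set directly, with the same gain 1 + 2/n in every dimension; dimension two differs only in the
  final comparison of exponents.\<close>

definition pd :: "'a::euclidean_space \<Rightarrow> ('a \<Rightarrow> real) \<Rightarrow> 'a \<Rightarrow> real" where
  "pd b g x = frechet_derivative g (at x) b"

lemma Ck_on_Suc_pd:
  "Ck_on (Suc k) S g \<longleftrightarrow> continuous_on S g \<and> (\<forall>x\<in>S. g differentiable (at x)) \<and>
      (\<forall>b\<in>Basis. Ck_on k S (pd b g))"
  by (simp add: pd_def[abs_def])

lemma pd_eqI: "(g has_derivative g') (at x) \<Longrightarrow> pd b g x = g' b"
  unfolding pd_def using frechet_derivative_at by metis

lemma has_derivative_pd: "g differentiable (at x) \<Longrightarrow> (g has_derivative (\<lambda>h. pd h g x)) (at x)"
  unfolding pd_def using frechet_derivative_works by blast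

lemma linear_pd: "g differentiable (at x) \<Longrightarrow> linear (\<lambda>h. pd h g x)"
  using has_derivative_pd has_derivative_linear by blast

lemma pd_Basis_expansion:
  assumes "g differentiable (at x)"
  shows "pd h g x = (\<Sum>b\<in>Basis. (h \<bullet> b) * pd b g x)"
proof -
  have "pd h g x = pd (\<Sum>b\<in>Basis. (h \<bullet> b) *\<^sub>R b) g x" by (simp add: euclidean_representation)
  then show ?thesis
    using linear_sum[OF linear_pd[OF assms], of "\<lambda>b. (h \<bullet> b) *\<^sub>R b" Basis] linear_scale[OF linear_pd[OF assms]]
    by simp
qed

lemma pd_cong_open:
  assumes "open S" "x \<in> S" "\<And>y. y \<in> S \<Longrightarrow> f y = g y" "f differentiable (at x)"
  shows "pd b f x = pd b g x"
  unfolding pd_def using frechet_derivative_transform_within_open[OF assms(4,1,2,3)] by metis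

lemma Ck_on_continuous: "Ck_on k S g \<Longrightarrow> continuous_on S g"
  by (cases k) auto

text \<open>On an open set a derivative sees only nearby values, so equality of the functions passes
  to all partial derivatives. This is how differentiation rules, valid only pointwise on
  \<open>S\<close>, enter the inductions on \<open>k\<close> below.\<close>

lemma Ck_on_cong:
  assumes "open S" "Ck_on k S f" "\<And>x. x \<in> S \<Longrightarrow> f x = g x"
  shows "Ck_on k S g"
  using assms(2,3)
proof (induction k arbitrary: f g)
  case 0
  then show ?case using continuous_on_cong by (metis Ck_on.simps(1))
next
  case (Suc k)
  have d: "\<forall>x\<in>S. g differentiable (at x)"
  proof
    fix x assume x: "x \<in> S"
    have "f differentiable (at x)" using Suc.prems(1) x by simp
    then show "g differentiable (at x)"
      using x assms(1) Suc.prems(2) unfolding differentiable_def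
      by (metis has_derivative_transform_within_open)
  qed
  have "Ck_on k S (pd b g)" if b: "b \<in> Basis" for b
  proof (rule Suc.IH)
    show "Ck_on k S (pd b f)" using Suc.prems(1) b by (simp add: Ck_on_Suc_pd del: Ck_on.simps)
    show "pd b f x = pd b g x" if "x \<in> S" for x
      by (rule pd_cong_open[OF assms(1) that]) (use Suc.prems that in auto)
  qed
  moreover have "continuous_on S g" using Suc.prems by (metis Ck_on.simps(2) continuous_on_cong)
  ultimately show ?case using d by (simp add: Ck_on_Suc_pd del: Ck_on.simps)
qed

lemma Ck_on_SucD: "Ck_on (Suc k) S g \<Longrightarrow> Ck_on k S g"
proof (induction k arbitrary: g)
  case (Suc k)
  then show ?case unfolding Ck_on_Suc_pd[of "Suc k"] Ck_on_Suc_pd[of k] by blast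
qed simp

lemma Ck_on_subset:
  assumes "Ck_on k S g" "T \<subseteq> S" shows "Ck_on k T g"
  using assms(1)
proof (induction k arbitrary: g)
  case 0
  then show ?case using assms(2) continuous_on_subset by auto
next
  case (Suc k)
  then show ?case unfolding Ck_on_Suc_pd using assms(2) continuous_on_subset by blast
qed

lemma Ck_on_const: "Ck_on k S (\<lambda>x. c)"
proof (induction k arbitrary: c)
  case (Suc k)
  have "pd b (\<lambda>x. c) = (\<lambda>x. 0)" for b :: 'a
    by (auto simp: pd_def fun_eq_iff)
  then show ?case using Suc by (simp add: Ck_on_Suc_pd del: Ck_on.simps)
qed auto

lemma Ck_on_linear:
  assumes "bounded_linear L" shows "Ck_on k S L"
proof (cases k)
  case 0
  then show ?thesis using assms by (simp add: linear_continuous_on)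
next
  case (Suc m)
  have "pd b L = (\<lambda>x. L b)" for b
    using pd_eqI[OF bounded_linear_imp_has_derivative[OF assms]] by (auto simp: fun_eq_iff)
  then show ?thesis using assms Suc
    by (auto simp: Ck_on_Suc_pd linear_continuous_on bounded_linear_imp_differentiable Ck_on_const simp del: Ck_on.simps)
qed

lemma pd_add:
  assumes "f differentiable (at x)" "g differentiable (at x)"
  shows "pd b (\<lambda>x. f x + g x) x = pd b f x + pd b g x"
  by (rule pd_eqI, rule has_derivative_add; rule has_derivative_pd; fact)

lemma pd_diff:
  assumes "f differentiable (at x)" "g differentiable (at x)"
  shows "pd b (\<lambda>x. f x - g x) x = pd b f x - pd b g x"
  by (rule pd_eqI, rule has_derivative_diff; rule has_derivative_pd; fact)

lemma pd_mult:
  assumes "f differentiable (at x)" "g differentiable (at x)"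
  shows "pd b (\<lambda>x. f x * g x) x = f x * pd b g x + pd b f x * g x"
  by (rule pd_eqI[OF has_derivative_mult[OF has_derivative_pd[OF assms(1)] has_derivative_pd[OF assms(2)]]])

lemma pd_sum:
  assumes "\<And>i. i \<in> I \<Longrightarrow> (f i) differentiable (at x)"
  shows "pd b (\<lambda>x. \<Sum>i\<in>I. f i x) x = (\<Sum>i\<in>I. pd b (f i) x)"
  by (rule pd_eqI, rule has_derivative_sum, rule has_derivative_pd, rule assms)

lemma Ck_on_add:
  assumes S: "open S" and "Ck_on k S f" "Ck_on k S g"
  shows "Ck_on k S (\<lambda>x. f x + g x)"
  using assms(2,3)
proof (induction k arbitrary: f g)
  case 0
  then show ?case by (auto intro: continuous_intros)
next
  case (Suc k)
  have "Ck_on k S (pd b (\<lambda>x. f x + g x))" if b: "b \<in> Basis" for b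
    by (rule Ck_on_cong[OF S Suc.IH[of "pd b f" "pd b g"]])
      (use Suc.prems b in \<open>auto simp: Ck_on_Suc_pd pd_add simp del: Ck_on.simps\<close>)
  then show ?case using Suc.prems
    by (auto simp: Ck_on_Suc_pd intro!: continuous_intros simp del: Ck_on.simps)
qed

lemma Ck_on_mult:
  assumes S: "open S" and "Ck_on k S f" "Ck_on k S g"
  shows "Ck_on k S (\<lambda>x. f x * g x)"
  using assms(2,3)
proof (induction k arbitrary: f g)
  case 0
  then show ?case by (auto intro: continuous_intros)
next
  case (Suc k)
  have "Ck_on k S (pd b (\<lambda>x. f x * g x))" if b: "b \<in> Basis" for b
  proof (rule Ck_on_cong[OF S])
    have "Ck_on k S (pd b f)" "Ck_on k S (pd b g)" using Suc.prems b unfolding Ck_on_Suc_pd by auto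
    then show "Ck_on k S (\<lambda>x. f x * pd b g x + pd b f x * g x)"
      using Suc.prems[THEN Ck_on_SucD] by (intro Ck_on_add[OF S] Suc.IH)
    show "f x * pd b g x + pd b f x * g x = pd b (\<lambda>x. f x * g x) x" if "x \<in> S" for x
      by (rule pd_mult[symmetric]) (use Suc.prems that in auto)
  qed
  then show ?case using Suc.prems
    by (auto simp: Ck_on_Suc_pd intro!: continuous_intros simp del: Ck_on.simps)
qed

lemma Ck_on_sum:
  assumes S: "open S" and "\<And>i. i \<in> I \<Longrightarrow> Ck_on k S (f i)"
  shows "Ck_on k S (\<lambda>x. \<Sum>i\<in>I. f i x)"
  using assms(2)
proof (induction I rule: infinite_finite_induct)
  case (insert i I)
  then show ?case using Ck_on_add[OF S, of k "f i"] by auto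
qed (auto simp: Ck_on_const)

lemma has_derivative_compose_vec:
  fixes U :: "'a::euclidean_space \<Rightarrow> real^'n" and E :: "real^'n \<Rightarrow> real"
  assumes U: "\<And>i. (\<lambda>x. U x $ i) differentiable (at x)" and E: "E differentiable (at (U x))"
  shows "((\<lambda>x. E (U x)) has_derivative (\<lambda>h. \<Sum>i\<in>UNIV. pd (axis i 1) E (U x) * pd h (\<lambda>x. U x $ i) x)) (at x)"
proof -
  define U' where "U' = (\<lambda>h. \<chi> i. pd h (\<lambda>x. U x $ i) x)"
  have 1: "(U has_derivative U') (at x)"
    apply (subst has_derivative_componentwise_within)
    using U by (auto simp: Basis_vec_def inner_axis U'_def intro!: has_derivative_pd)
  have 2: "(E has_derivative (\<lambda>h. pd h E (U x))) (at (U x))" by (rule has_derivative_pd[OF E])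
  have lin: "linear (\<lambda>h. pd h E (U x))" using 2 has_derivative_linear by blast
  have "pd (U' h) E (U x) = (\<Sum>i\<in>UNIV. pd (axis i 1) E (U x) * pd h (\<lambda>x. U x $ i) x)" for h
  proof -
    have "U' h = (\<Sum>i\<in>UNIV. (U' h $ i) *\<^sub>R axis i 1)"
      by (simp add: vec_eq_iff axis_def if_distrib cong: if_cong)
    then have "pd (U' h) E (U x) = pd (\<Sum>i\<in>UNIV. (U' h $ i) *\<^sub>R axis i 1) E (U x)" by simp
    also have "\<dots> = (\<Sum>i\<in>UNIV. (U' h $ i) *\<^sub>R pd (axis i 1) E (U x))"
      using linear_sum[OF lin, of "\<lambda>i. (U' h $ i) *\<^sub>R axis i 1" UNIV] linear_scale[OF lin] by simp
    finally show ?thesis by (simp add: U'_def mult.commute)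
  qed
  then show ?thesis using has_derivative_compose[OF 1 2] by simp
qed

text \<open>The chain rule replaces \<open>E\<close> by its partial derivatives and keeps
  \<open>U\<close> as the inner function, so the induction generalises over \<open>E\<close>
  alone.\<close>

lemma Ck_on_compose:
  fixes U :: "'a::euclidean_space \<Rightarrow> real^'n" and E :: "real^'n \<Rightarrow> real"
  assumes S: "open S" and "\<And>i. Ck_on k S (\<lambda>x. U x $ i)" and "Ck_on k UNIV E"
  shows "Ck_on k S (\<lambda>x. E (U x))"
  using assms(2,3)
proof (induction k arbitrary: E)
  case 0
  have "continuous_on S U" using continuous_on_vec_lambda[of S "\<lambda>i x. U x $ i"] 0(1) by simp
  then show ?case using 0 by (auto intro: continuous_on_compose2[of UNIV E])
next
  case (Suc k)
  have U: "\<And>i. Ck_on k S (\<lambda>x. U x $ i)" using Suc.prems(1) Ck_on_SucD by blast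
  have dU: "\<And>x i. x \<in> S \<Longrightarrow> (\<lambda>x. U x $ i) differentiable (at x)" using Suc.prems(1) by simp
  have dE: "\<And>x. E differentiable (at x)" using Suc.prems(2) by simp
  have pdE: "Ck_on k UNIV (pd (axis i 1) E)" for i
    using Suc.prems(2) unfolding Ck_on_Suc_pd by (simp add: axis_in_Basis_iff)
  have "Ck_on k S (pd b (\<lambda>x. E (U x)))" if b: "b \<in> Basis" for b
  proof (rule Ck_on_cong[OF S])
    show "Ck_on k S (\<lambda>x. \<Sum>i\<in>UNIV. pd (axis i 1) E (U x) * pd b (\<lambda>x. U x $ i) x)"
    proof (rule Ck_on_sum[OF S], rule Ck_on_mult[OF S])
      show "Ck_on k S (\<lambda>x. pd (axis i 1) E (U x))" for i by (rule Suc.IH[OF U pdE])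
      show "Ck_on k S (pd b (\<lambda>x. U x $ i))" for i
        using Suc.prems(1)[of i] b unfolding Ck_on_Suc_pd by simp
    qed
    show "(\<Sum>i\<in>UNIV. pd (axis i 1) E (U x) * pd b (\<lambda>x. U x $ i) x) = pd b (\<lambda>x. E (U x)) x" if "x \<in> S" for x
      by (rule pd_eqI[OF has_derivative_compose_vec[OF dU[OF that] dE], symmetric])
  qed
  moreover have "(\<lambda>x. E (U x)) differentiable (at x)" if "x \<in> S" for x
    using has_derivative_compose_vec[OF dU[OF that] dE] by (auto simp: differentiable_def)
  moreover have "continuous_on S (\<lambda>x. E (U x))" using calculation(2)
    by (meson differentiable_at_imp_differentiable_on differentiable_imp_continuous_on)
  ultimately show ?case by (simp add: Ck_on_Suc_pd del: Ck_on.simps)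
qed

lemma smooth_on_continuous: "smooth_on S g \<Longrightarrow> continuous_on S g"
  unfolding smooth_on_def using Ck_on.simps(1) by blast

lemma smooth_on_differentiable: "smooth_on S g \<Longrightarrow> x \<in> S \<Longrightarrow> g differentiable (at x)"
  unfolding smooth_on_def using Ck_on.simps(2) by blast

lemma smooth_on_pd: "smooth_on S g \<Longrightarrow> b \<in> Basis \<Longrightarrow> smooth_on S (pd b g)"
  unfolding smooth_on_def using Ck_on_Suc_pd by blast

lemma smooth_on_subset: "smooth_on S f \<Longrightarrow> T \<subseteq> S \<Longrightarrow> smooth_on T f"
  unfolding smooth_on_def using Ck_on_subset by blast

lemma smooth_on_const: "smooth_on S (\<lambda>x. c)"
  unfolding smooth_on_def using Ck_on_const by blast

lemma smooth_on_linear: "bounded_linear L \<Longrightarrow> smooth_on S L"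
  unfolding smooth_on_def using Ck_on_linear by blast

lemma smooth_on_add: "open S \<Longrightarrow> smooth_on S f \<Longrightarrow> smooth_on S g \<Longrightarrow> smooth_on S (\<lambda>x. f x + g x)"
  unfolding smooth_on_def using Ck_on_add by blast

lemma smooth_on_mult: "open S \<Longrightarrow> smooth_on S f \<Longrightarrow> smooth_on S g \<Longrightarrow> smooth_on S (\<lambda>x. f x * g x)"
  unfolding smooth_on_def using Ck_on_mult by blast

lemma smooth_on_diff:
  assumes "open S" "smooth_on S f" "smooth_on S g"
  shows "smooth_on S (\<lambda>x. f x - g x)"
  using smooth_on_add[OF assms(1,2) smooth_on_mult[OF assms(1) smooth_on_const[of S "-1"] assms(3)]] by simp

lemma smooth_on_sum: "open S \<Longrightarrow> (\<And>i. i \<in> I \<Longrightarrow> smooth_on S (f i)) \<Longrightarrow> smooth_on S (\<lambda>x. \<Sum>i\<in>I. f i x)"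
  unfolding smooth_on_def using Ck_on_sum[of S I] by blast

lemma smooth_on_power: "open S \<Longrightarrow> smooth_on S f \<Longrightarrow> smooth_on S (\<lambda>x. f x ^ m)"
  by (induction m) (auto intro: smooth_on_const smooth_on_mult)

lemma smooth_on_compose:
  fixes U :: "'a::euclidean_space \<Rightarrow> real^'n" and E :: "real^'n \<Rightarrow> real"
  shows "open S \<Longrightarrow> (\<And>i. smooth_on S (\<lambda>x. U x $ i)) \<Longrightarrow> smooth_on UNIV E \<Longrightarrow> smooth_on S (\<lambda>x. E (U x))"
  unfolding smooth_on_def using Ck_on_compose[of S _ U] by blast

lemma has_derivative_along:
  assumes "g differentiable (at (x + s *\<^sub>R b))"
  shows "((\<lambda>s. g (x + s *\<^sub>R b)) has_real_derivative pd b g (x + s *\<^sub>R b)) (at s)"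
proof -
  have 1: "((\<lambda>s. x + s *\<^sub>R b) has_derivative (\<lambda>h. h *\<^sub>R b)) (at s)"
    by (auto intro!: derivative_eq_intros)
  have d: "(g has_derivative (\<lambda>h. pd h g (x + s *\<^sub>R b))) (at (x + s *\<^sub>R b))" by (rule has_derivative_pd[OF assms])
  have "pd (h *\<^sub>R b) g (x + s *\<^sub>R b) = h * pd b g (x + s *\<^sub>R b)" for h
    using linear_scale[OF has_derivative_linear[OF d]] by simp
  then show ?thesis using has_derivative_compose[OF 1 d] 
    by (simp add: has_field_derivative_def mult.commute[of _ "pd b g (x + s *\<^sub>R b)"])
qed

section \<open>Symmetry of mixed second derivatives\<close>

lemma double_difference:
  fixes g :: "'a::euclidean_space \<Rightarrow> real"
  assumes e: "ball x e \<subseteq> S" and h: "0 < h" "2 * h < e" and ab: "a \<in> Basis" "b \<in> Basis"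
    and g: "\<And>y. y \<in> S \<Longrightarrow> g differentiable (at y)" "\<And>y. y \<in> S \<Longrightarrow> pd a g differentiable (at y)"
  obtains \<xi> \<zeta> where "0 < \<xi>" "\<xi> < h" "0 < \<zeta>" "\<zeta> < h"
    "g (x + h *\<^sub>R a + h *\<^sub>R b) - g (x + h *\<^sub>R a) - g (x + h *\<^sub>R b) + g x
      = h\<^sup>2 * pd b (pd a g) (x + \<xi> *\<^sub>R a + \<zeta> *\<^sub>R b)"
proof -
  have inS: "x + s *\<^sub>R a + t *\<^sub>R b \<in> S" if "0 \<le> s" "s \<le> h" "0 \<le> t" "t \<le> h" for s t
  proof -
    have "norm (s *\<^sub>R a + t *\<^sub>R b) \<le> s + t"
      using norm_triangle_ineq[of "s *\<^sub>R a" "t *\<^sub>R b"] ab that by simp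
    moreover have "dist x (x + (s *\<^sub>R a + t *\<^sub>R b)) = norm (s *\<^sub>R a + t *\<^sub>R b)"
      using dist_add_cancel[of x 0] by simp
    ultimately have "x + s *\<^sub>R a + t *\<^sub>R b \<in> ball x e" using that h
      unfolding mem_ball add.assoc by linarith
    then show ?thesis using e by blast
  qed
  have 1: "((\<lambda>s. g (x + h *\<^sub>R b + s *\<^sub>R a) - g (x + s *\<^sub>R a)) has_real_derivative
      pd a g (x + h *\<^sub>R b + s *\<^sub>R a) - pd a g (x + s *\<^sub>R a)) (at s)" if "0 \<le> s" "s \<le> h" for s
    by (intro derivative_intros has_derivative_along g) 
      (use inS[of s h] inS[of s 0] that h in \<open>auto simp: algebra_simps\<close>)
  obtain \<xi> where \<xi>: "0 < \<xi>" "\<xi> < h"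
    "(g (x + h *\<^sub>R b + h *\<^sub>R a) - g (x + h *\<^sub>R a)) - (g (x + h *\<^sub>R b + 0 *\<^sub>R a) - g (x + 0 *\<^sub>R a))
      = (h - 0) * (pd a g (x + h *\<^sub>R b + \<xi> *\<^sub>R a) - pd a g (x + \<xi> *\<^sub>R a))"
    using MVT2[OF h(1) 1] by blast
  have 2: "((\<lambda>t. pd a g (x + \<xi> *\<^sub>R a + t *\<^sub>R b)) has_real_derivative
      pd b (pd a g) (x + \<xi> *\<^sub>R a + t *\<^sub>R b)) (at t)" if "0 \<le> t" "t \<le> h" for t
    by (intro has_derivative_along g inS) (use that \<xi> in auto)
  obtain \<zeta> where \<zeta>: "0 < \<zeta>" "\<zeta> < h"
    "pd a g (x + \<xi> *\<^sub>R a + h *\<^sub>R b) - pd a g (x + \<xi> *\<^sub>R a + 0 *\<^sub>R b)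
      = (h - 0) * pd b (pd a g) (x + \<xi> *\<^sub>R a + \<zeta> *\<^sub>R b)"
    using MVT2[OF h(1) 2] by blast
  show ?thesis
    by (rule that[OF \<xi>(1,2) \<zeta>(1,2)]) (use \<xi>(3) \<zeta>(3) in \<open>simp add: algebra_simps power2_eq_square\<close>)
qed

text \<open>The second difference is symmetric in \<open>a\<close> and \<open>b\<close>. By
  \<open>double_difference\<close> it equals h^2 times either mixed derivative, each at a point
  close to x; continuity then excludes different values at x.\<close>

lemma pd_commute:
  fixes g :: "'a::euclidean_space \<Rightarrow> real"
  assumes S: "open S" "x \<in> S" and g: "smooth_on S g" and ab: "a \<in> Basis" "b \<in> Basis"
  shows "pd a (pd b g) x = pd b (pd a g) x"
proof (rule ccontr)
  define F where "F = pd a (pd b g)"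
  define G where "G = pd b (pd a g)"
  assume "pd a (pd b g) x \<noteq> pd b (pd a g) x"
  then have e: "\<bar>F x - G x\<bar> / 2 > 0" (is "?e > 0") by (simp add: F_def G_def)
  have cF: "continuous_on S F" and cG: "continuous_on S G" unfolding F_def G_def
    by (auto intro!: smooth_on_continuous smooth_on_pd g ab)
  obtain d1 where d1: "d1 > 0" "\<And>y. dist y x < d1 \<Longrightarrow> y \<in> S \<Longrightarrow> dist (F y) (F x) < ?e"
    using cF S(2) e unfolding continuous_on_iff by metis
  obtain d2 where d2: "d2 > 0" "\<And>y. dist y x < d2 \<Longrightarrow> y \<in> S \<Longrightarrow> dist (G y) (G x) < ?e"
    using cG S(2) e unfolding continuous_on_iff by metis
  obtain d3 where d3: "d3 > 0" "ball x d3 \<subseteq> S" using S open_contains_ball by metis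
  define d where "d = Min {d1, d2, d3}"
  have d: "d > 0" "d \<le> d1" "d \<le> d2" "d \<le> d3" using d1 d2 d3 by (auto simp: d_def)
  define h where "h = d / 3"
  have h: "0 < h" "2 * h < d" using d by (auto simp: h_def)
  have sub: "ball x d \<subseteq> S" using d3 d(4) by (meson subset_ball subset_trans)
  have inb: "x + s *\<^sub>R a' + t *\<^sub>R b' \<in> ball x d" if "0 < s" "s < h" "0 < t" "t < h" "a' \<in> Basis" "b' \<in> Basis" for s t a' b'
  proof -
    have "norm (s *\<^sub>R a' + t *\<^sub>R b') \<le> s + t"
      using norm_triangle_ineq[of "s *\<^sub>R a'" "t *\<^sub>R b'"] that by simp
    moreover have "dist x (x + (s *\<^sub>R a' + t *\<^sub>R b')) = norm (s *\<^sub>R a' + t *\<^sub>R b')"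
      using dist_add_cancel[of x 0] by simp
    ultimately show ?thesis using that h
      unfolding mem_ball add.assoc by linarith
  qed
  note df = smooth_on_differentiable[OF g] smooth_on_differentiable[OF smooth_on_pd[OF g ab(1)]]
     smooth_on_differentiable[OF smooth_on_pd[OF g ab(2)]]
  obtain \<xi> \<zeta> where 1: "0 < \<xi>" "\<xi> < h" "0 < \<zeta>" "\<zeta> < h"
    "g (x + h *\<^sub>R a + h *\<^sub>R b) - g (x + h *\<^sub>R a) - g (x + h *\<^sub>R b) + g x
      = h\<^sup>2 * G (x + \<xi> *\<^sub>R a + \<zeta> *\<^sub>R b)"
    using double_difference[OF sub h ab, of g] df(1,2) unfolding G_def by metis
  obtain \<xi>' \<zeta>' where 2: "0 < \<xi>'" "\<xi>' < h" "0 < \<zeta>'" "\<zeta>' < h"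
    "g (x + h *\<^sub>R b + h *\<^sub>R a) - g (x + h *\<^sub>R b) - g (x + h *\<^sub>R a) + g x
      = h\<^sup>2 * F (x + \<xi>' *\<^sub>R b + \<zeta>' *\<^sub>R a)"
    using double_difference[OF sub h ab(2,1), of g] df(1,3) unfolding F_def by metis
  have "h\<^sup>2 * G (x + \<xi> *\<^sub>R a + \<zeta> *\<^sub>R b) = h\<^sup>2 * F (x + \<xi>' *\<^sub>R b + \<zeta>' *\<^sub>R a)"
    using 1(5) 2(5) by (simp add: algebra_simps)
  then have eq: "G (x + \<xi> *\<^sub>R a + \<zeta> *\<^sub>R b) = F (x + \<xi>' *\<^sub>R b + \<zeta>' *\<^sub>R a)" using h by simp
  have "dist (G (x + \<xi> *\<^sub>R a + \<zeta> *\<^sub>R b)) (G x) < ?e"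
    by (rule d2(2)) (use inb[OF 1(1-4) ab] sub d in \<open>auto simp: dist_commute\<close>)
  moreover have "dist (F (x + \<xi>' *\<^sub>R b + \<zeta>' *\<^sub>R a)) (F x) < ?e"
    by (rule d1(2)) (use inb[OF 2(1-4) ab(2,1)] sub d in \<open>auto simp: dist_commute\<close>)
  ultimately show False unfolding eq dist_real_def by (auto simp: abs_if field_simps split: if_splits)
qed

section \<open>Integration by parts and convolution\<close>

lemma lborel_integral_translation:
  fixes f :: "'a::euclidean_space \<Rightarrow> real"
  assumes "f \<in> borel_measurable borel"
  shows "(LBINT x. f (x + c)) = (LBINT x. f x)"
proof -
  have "(LBINT x. f x) = integral\<^sup>L (distr lborel borel ((+) c)) f"
    unfolding lborel_distr_plus ..
  also have "\<dots> = (LBINT x. f (c + x))"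
    by (rule integral_distr) (use assms in measurable)
  finally show ?thesis by (simp add: add.commute)
qed

lemma integrable_lborel_compact_support:
  fixes f :: "'a::euclidean_space \<Rightarrow> real"
  assumes "compact K" "continuous_on K f" "\<And>x. x \<notin> K \<Longrightarrow> f x = 0"
  shows "integrable lborel f"
proof -
  have "(\<lambda>x. indicator K x *\<^sub>R f x) = f" using assms(3) by (auto simp: indicator_def fun_eq_iff)
  then show ?thesis using borel_integrable_compact[OF assms(1,2)] by simp
qed

lemma integrable_lborel_pair_compact_support:
  fixes f :: "'a::euclidean_space \<Rightarrow> 'b::euclidean_space \<Rightarrow> real"
  assumes "compact K" "continuous_on K (\<lambda>(x,y). f x y)" "\<And>x y. (x, y) \<notin> K \<Longrightarrow> f x y = 0"
  shows "integrable (lborel \<Otimes>\<^sub>M lborel) (\<lambda>(x,y). f x y)"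
  unfolding lborel_prod by (rule integrable_lborel_compact_support[OF assms(1,2)]) (use assms(3) in auto)

lemma pd_eq_0_outside:
  assumes "closed K" "\<And>x. x \<notin> K \<Longrightarrow> g x = 0" "x \<notin> K"
  shows "pd b g x = 0"
proof -
  have "pd b (\<lambda>x. 0) x = pd b g x"
    by (rule pd_cong_open[of "- K"]) (use assms in auto)
  then show ?thesis by (simp add: pd_def)
qed

text \<open>This image is the set of all x for which some x + s b with s in [0, 1] lies in
  \<open>K\<close>. It bounds the support in x of the integrands to which Fubini is applied.\<close>

lemma compact_translates:
  fixes K :: "'a::euclidean_space set"
  assumes "compact K"
  shows "compact ((\<lambda>(y, s). y - s *\<^sub>R b) ` (K \<times> {0..1::real}))"
  by (rule compact_continuous_image)
    (auto intro!: continuous_intros compact_Times assms simp: case_prod_unfold)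

text \<open>Integrate \<open>\<partial>\<^sub>b g (x + s b)\<close> over \<open>x\<close> and \<open>s \<in> [0, 1]\<close> in both orders: one order gives the integral
  of a difference of translates, the other gives the integral in question, which does not depend on \<open>s\<close>.\<close>

lemma integral_pd_eq_0:
  fixes g :: "'a::euclidean_space \<Rightarrow> real"
  assumes K: "compact K" "\<And>x. x \<notin> K \<Longrightarrow> g x = 0"
    and g: "\<And>x. g differentiable (at x)" and cont: "continuous_on UNIV (pd b g)"
  shows "(LBINT x. pd b g x) = 0"
proof -
  define L where "L = (\<lambda>(y, s). y - s *\<^sub>R b) ` (K \<times> {0..1::real})"
  have L: "compact L" unfolding L_def by (rule compact_translates[OF K(1)])
  have inL: "x \<in> L" if "x + s *\<^sub>R b \<in> K" "s \<in> {0..1}" for x s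
    unfolding L_def using that by (force intro!: image_eqI[of _ _ "(x + s *\<^sub>R b, s)"])
  have z: "pd b g x = 0" if "x \<notin> K" for x
    by (rule pd_eq_0_outside[OF compact_imp_closed[OF K(1)] K(2) that])
  define f where "f = (\<lambda>x s. indicator {0..1} s *\<^sub>R pd b g (x + s *\<^sub>R b))"
  have int: "integrable (lborel \<Otimes>\<^sub>M lborel) (\<lambda>(x,s). f x s)"
  proof (rule integrable_lborel_pair_compact_support[of "L \<times> {0..1}"])
    have "continuous_on (L \<times> {0..1}) (\<lambda>(x,s). pd b g (x + s *\<^sub>R b))"
      unfolding case_prod_unfold
      by (rule continuous_on_compose2[OF cont]) (auto intro!: continuous_intros)
    then show "continuous_on (L \<times> {0..1}) (\<lambda>(x,s). f x s)"
      by (subst continuous_on_cong[OF refl, of _ _ "\<lambda>(x,s). pd b g (x + s *\<^sub>R b)"]) (auto simp: f_def)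
    show "f x s = 0" if "(x, s) \<notin> L \<times> {0..1}" for x s
      using that inL[of x s] z by (cases "s \<in> {0..1}") (auto simp: f_def)
  qed (use L in \<open>auto intro: compact_Times\<close>)
  have gc: "continuous_on UNIV g"
    using g by (simp add: continuous_at_imp_continuous_on differentiable_imp_continuous_within)
  have gm: "g \<in> borel_measurable borel" "pd b g \<in> borel_measurable borel"
    using gc cont by (auto intro: borel_measurable_continuous_onI)
  have gi: "integrable lborel g"
    by (rule integrable_lborel_compact_support[OF K(1) continuous_on_subset[OF gc] K(2)]) auto
  have gib: "integrable lborel (\<lambda>x. g (x + b))"
  proof (rule integrable_lborel_compact_support[of L])
    show "continuous_on L (\<lambda>x. g (x + b))" by (rule continuous_on_compose2[OF gc]) (auto intro!: continuous_intros)
    show "g (x + b) = 0" if "x \<notin> L" for x using inL[of x 1] that K(2) by auto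
  qed fact
  have E1: "(LBINT s. f x s) = g (x + b) - g x" for x
  proof -
    have "(LBINT s. f x s) = g (x + 1 *\<^sub>R b) - g (x + 0 *\<^sub>R b)" unfolding f_def
    proof (rule integral_FTC_atLeastAtMost)
      show "((\<lambda>s. g (x + s *\<^sub>R b)) has_vector_derivative pd b g (x + s *\<^sub>R b)) (at s within {0..1})" for s
        using has_derivative_along[OF g] has_field_derivative_at_within
          has_real_derivative_iff_has_vector_derivative by blast
      show "continuous_on {0..1} (\<lambda>s. pd b g (x + s *\<^sub>R b))"
        by (rule continuous_on_compose2[OF cont]) (auto intro!: continuous_intros)
    qed auto
    then show ?thesis by simp
  qed
  have E2: "(LBINT x. f x s) = indicator {0..1} s *\<^sub>R (LBINT x. pd b g x)" for s
    using lborel_integral_translation[OF gm(2)] by (simp add: f_def)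
  have "(LBINT s. LBINT x. f x s) = (LBINT x. LBINT s. f x s)"
    by (rule lborel_pair.Fubini_integral[OF int])
  also have "\<dots> = 0"
    unfolding E1 using gi gib lborel_integral_translation[OF gm(1)] by simp
  finally show ?thesis unfolding E2 by simp
qed

section \<open>Smoothness of convolutions with a compactly supported kernel\<close>

abbreviation conv :: "('a::euclidean_space \<Rightarrow> real) \<Rightarrow> ('a \<Rightarrow> real) \<Rightarrow> real \<Rightarrow> 'a \<Rightarrow> real" where
  "conv g E \<epsilon> \<equiv> \<lambda>z. integral UNIV (\<lambda>w. g ((1/\<epsilon>) *\<^sub>R (z - w)) * E w)"

lemma pd_conv_support:
  fixes g :: "'a::euclidean_space \<Rightarrow> real"
  assumes "\<And>x. x \<notin> cball 0 1 \<Longrightarrow> g x = 0"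
  shows "x \<notin> cball 0 1 \<Longrightarrow> pd b g x = 0"
  by (rule pd_eq_0_outside[of "cball 0 1"]) (use assms in auto)

text \<open>\<open>E\<close> is merely continuous, so the derivative has to fall on the kernel. For
  y within distance 1 of z the integrand vanishes unless w is within 1 + \<epsilon> of z; the
  integral may thus be taken over a fixed box, where differentiation under the integral sign
  applies.\<close>

lemma convolution_has_derivative:
  fixes g E :: "'a::euclidean_space \<Rightarrow> real"
  assumes g: "smooth_on UNIV g" "\<And>x. x \<notin> cball 0 1 \<Longrightarrow> g x = 0" and E: "continuous_on UNIV E" and e: "\<epsilon> > 0"
  shows "((conv g E \<epsilon>) has_derivative
     (\<lambda>h. \<Sum>b\<in>Basis. (h \<bullet> b) * conv (\<lambda>x. 1/\<epsilon> * pd b g x) E \<epsilon> z)) (at z)"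
proof -
  obtain a c where ac: "cball z (1 + \<epsilon>) \<subseteq> cbox a c"
    using bounded_subset_cbox_symmetric[OF bounded_cball] by metis
  have far: "(1/\<epsilon>) *\<^sub>R (y - w) \<notin> cball 0 1" if "y \<in> ball z 1" "w \<notin> cbox a c" for y w
  proof -
    have "dist z w > 1 + \<epsilon>" using that(2) ac by (metis mem_cball not_le subset_iff)
    moreover have "dist z w \<le> dist z y + dist y w" by (rule dist_triangle)
    ultimately have "norm (y - w) > \<epsilon>" using that(1) by (simp add: dist_norm)
    then have "norm (y - w) / \<epsilon> > 1" using e by (simp add: field_simps)
    moreover have "norm ((1/\<epsilon>) *\<^sub>R (y - w)) = norm (y - w) / \<epsilon>" unfolding norm_scaleR using e by simp
    ultimately show ?thesis unfolding mem_cball_0 by linarith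
  qed
  have restr: "integral UNIV (\<lambda>w. G ((1/\<epsilon>) *\<^sub>R (y - w)) * E w) = integral (cbox a c) (\<lambda>w. G ((1/\<epsilon>) *\<^sub>R (y - w)) * E w)"
    if "\<And>x. x \<notin> cball 0 1 \<Longrightarrow> G x = 0" "y \<in> ball z 1" for G y
  proof -
    have "integral UNIV (\<lambda>w. G ((1/\<epsilon>) *\<^sub>R (y - w)) * E w)
      = integral UNIV (\<lambda>w. if w \<in> cbox a c then G ((1/\<epsilon>) *\<^sub>R (y - w)) * E w else 0)"
      by (rule arg_cong[where f="integral UNIV"]) (use that far in \<open>auto simp: fun_eq_iff\<close>)
    then show ?thesis by (simp only: integral_restrict_UNIV)
  qed
  have cp: "continuous_on UNIV (pd b g)" if "b \<in> Basis" for b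
    using smooth_on_continuous smooth_on_pd g(1) that by blast
  have cg: "continuous_on UNIV g" using smooth_on_continuous g(1) by blast
  have cfs: "continuous_on S (\<lambda>(y,w). G ((1/\<epsilon>) *\<^sub>R (y - w)) * E w)" if "continuous_on UNIV G" for G S
    unfolding case_prod_unfold
    by (intro continuous_intros continuous_on_compose2[OF that] continuous_on_compose2[OF E]) auto
  have cw: "continuous_on S (\<lambda>w. G ((1/\<epsilon>) *\<^sub>R (y - w)) * E w)" if "continuous_on UNIV G" for G S y
    by (intro continuous_intros continuous_on_compose2[OF that] continuous_on_compose2[OF E]) auto
  \<comment> \<open>The Leibniz rule wants the derivative continuous as a bounded linear map. As a
    finite combination of coordinate functionals it inherits this from the partial
    derivatives.\<close>
  define fx where "fx = (\<lambda>y w. \<Sum>b\<in>Basis. (1/\<epsilon> * pd b g ((1/\<epsilon>) *\<^sub>R (y - w)) * E w) *\<^sub>R blinfun_inner_left b)"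
  have fx: "blinfun_apply (fx y w) h = (\<Sum>b\<in>Basis. (h \<bullet> b) * (1/\<epsilon> * pd b g ((1/\<epsilon>) *\<^sub>R (y - w)) * E w))" for y w h
    by (simp add: fx_def blinfun.sum_left blinfun.scaleR_left mult.commute)
  have cfx: "continuous_on (ball z 1 \<times> cbox a c) (\<lambda>(y,w). fx y w)"
  proof -
    have "continuous_on (ball z 1 \<times> cbox a c) (\<lambda>p. (pd b g ((1/\<epsilon>) *\<^sub>R (fst p - snd p)) * E (snd p)))" if "b \<in> Basis" for b
      using cfs[OF cp[OF that]] by (simp add: case_prod_unfold)
    then have "continuous_on (ball z 1 \<times> cbox a c) (\<lambda>p. \<Sum>b\<in>Basis. (1/\<epsilon> * (pd b g ((1/\<epsilon>) *\<^sub>R (fst p - snd p)) * E (snd p))) *\<^sub>R blinfun_inner_left b)"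
      by (intro continuous_on_sum continuous_on_scaleR continuous_on_mult_left continuous_on_const) auto
    then show ?thesis unfolding fx_def case_prod_unfold by (simp only: mult.assoc)
  qed
  have der: "((\<lambda>y. g ((1/\<epsilon>) *\<^sub>R (y - w)) * E w) has_derivative blinfun_apply (fx y w)) (at y within ball z 1)" for y w
  proof -
    have 1: "((\<lambda>y. (1/\<epsilon>) *\<^sub>R (y - w)) has_derivative (\<lambda>h. (1/\<epsilon>) *\<^sub>R h)) (at y)"
      by (auto intro!: derivative_eq_intros)
    have 2: "(g has_derivative (\<lambda>h. pd h g ((1/\<epsilon>) *\<^sub>R (y - w)))) (at ((1/\<epsilon>) *\<^sub>R (y - w)))"
      by (rule has_derivative_pd) (use smooth_on_differentiable[OF g(1)] in auto)
    have "pd ((1/\<epsilon>) *\<^sub>R h) g ((1/\<epsilon>) *\<^sub>R (y - w)) * E w = blinfun_apply (fx y w) h" for h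
    proof -
      have "g differentiable (at ((1/\<epsilon>) *\<^sub>R (y - w)))" using smooth_on_differentiable[OF g(1)] by simp
      from pd_Basis_expansion[OF this, of "(1/\<epsilon>) *\<^sub>R h"] show ?thesis unfolding fx
        by (simp add: sum_distrib_left sum_distrib_right mult.commute mult.left_commute)
    qed
    then have eq: "(\<lambda>h. pd ((1/\<epsilon>) *\<^sub>R h) g ((1/\<epsilon>) *\<^sub>R (y - w)) * E w) = blinfun_apply (fx y w)" by (simp add: fun_eq_iff)
    show ?thesis
      using has_derivative_mult_left[OF has_derivative_compose[OF 1 2], of "E w"] unfolding eq
      by (simp add: has_derivative_at_withinI)
  qed
  have "((\<lambda>y. integral (cbox a c) (\<lambda>w. g ((1/\<epsilon>) *\<^sub>R (y - w)) * E w)) has_derivative integral (cbox a c) (fx z)) (at z within ball z 1)"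
    by (rule leibniz_rule[OF der _ cfx]) (auto intro!: integrable_continuous cw cg)
  then have D: "((\<lambda>y. integral (cbox a c) (\<lambda>w. g ((1/\<epsilon>) *\<^sub>R (y - w)) * E w)) has_derivative integral (cbox a c) (fx z)) (at z)"
    by (simp add: at_within_open[of z "ball z 1"])
  have cfz: "continuous_on (cbox a c) (fx z)"
  proof -
    have "continuous_on (cbox a c) (\<lambda>w. case (z, w) of (y, w) \<Rightarrow> fx y w)"
      by (rule continuous_on_compose2[OF cfx]) (auto intro!: continuous_intros simp: image_subset_iff)
    then show ?thesis by simp
  qed
  have "blinfun_apply (integral (cbox a c) (fx z)) h = (\<Sum>b\<in>Basis. (h \<bullet> b) * conv (\<lambda>x. 1/\<epsilon> * pd b g x) E \<epsilon> z)" for h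
  proof -
    have "blinfun_apply (integral (cbox a c) (fx z)) h = integral (cbox a c) (\<lambda>w. blinfun_apply (fx z w) h)"
      by (rule blinfun_apply_integral) (auto intro!: integrable_continuous cfz)
    also have "\<dots> = (\<Sum>b\<in>Basis. integral (cbox a c) (\<lambda>w. (h \<bullet> b) * (1/\<epsilon> * pd b g ((1/\<epsilon>) *\<^sub>R (z - w)) * E w)))"
      unfolding fx
    proof (rule integral_sum)
      show "(\<lambda>w. (h \<bullet> b) * (1/\<epsilon> * pd b g ((1/\<epsilon>) *\<^sub>R (z - w)) * E w)) integrable_on cbox a c" if "b \<in> Basis" for b
        unfolding mult.assoc
        by (intro integrable_continuous continuous_on_mult_left cw cp that)
    qed auto
    also have "\<dots> = (\<Sum>b\<in>Basis. (h \<bullet> b) * integral (cbox a c) (\<lambda>w. (1/\<epsilon> * pd b g ((1/\<epsilon>) *\<^sub>R (z - w)) * E w)))"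
      by (simp only: integral_mult_right)
    also have "\<dots> = (\<Sum>b\<in>Basis. (h \<bullet> b) * conv (\<lambda>x. 1/\<epsilon> * pd b g x) E \<epsilon> z)"
    proof (rule sum.cong[OF refl])
      fix b :: 'a assume "b \<in> Basis"
      have "1/\<epsilon> * pd b g x = 0" if "x \<notin> cball 0 1" for x
        using pd_conv_support[OF g(2) that] by simp
      then show "(h \<bullet> b) * integral (cbox a c) (\<lambda>w. (1/\<epsilon> * pd b g ((1/\<epsilon>) *\<^sub>R (z - w)) * E w))
          = (h \<bullet> b) * conv (\<lambda>x. 1/\<epsilon> * pd b g x) E \<epsilon> z"
        using restr[of "\<lambda>x. 1/\<epsilon> * pd b g x" z] by auto
    qed
    finally show ?thesis .
  qed
  then have eq: "blinfun_apply (integral (cbox a c) (fx z)) = (\<lambda>h. \<Sum>b\<in>Basis. (h \<bullet> b) * conv (\<lambda>x. 1/\<epsilon> * pd b g x) E \<epsilon> z)"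
    by (simp add: fun_eq_iff)
  show ?thesis
  proof (rule has_derivative_transform_within_open[OF D[unfolded eq], of "ball z 1"])
    show "integral (cbox a c) (\<lambda>w. g ((1/\<epsilon>) *\<^sub>R (y - w)) * E w) = integral UNIV (\<lambda>w. g ((1/\<epsilon>) *\<^sub>R (y - w)) * E w)"
      if "y \<in> ball z 1" for y
      by (rule restr[symmetric, OF g(2) that])
  qed auto
qed

lemma sum_Basis_single:
  fixes b :: "'a::euclidean_space"
  assumes "b \<in> Basis" shows "(\<Sum>c\<in>Basis. (b \<bullet> c) * F c) = (F b :: real)"
proof -
  have "(\<Sum>c\<in>Basis. (b \<bullet> c) * F c) = (\<Sum>c\<in>Basis. if c = b then F c else 0)"
    by (rule sum.cong) (use assms in \<open>auto simp: inner_Basis\<close>)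
  then show ?thesis using assms by simp
qed

text \<open>A partial derivative of a convolution is again one, with kernel
  \<open>1/\<epsilon> * pd b g\<close>. The induction therefore runs over all kernels; this is also
  why \<open>conv\<close> carries no normalising factor.\<close>

lemma smooth_on_convolution:
  fixes g E :: "'a::euclidean_space \<Rightarrow> real"
  assumes "smooth_on UNIV g" "\<And>x. x \<notin> cball 0 1 \<Longrightarrow> g x = 0" and E: "continuous_on UNIV E" and e: "\<epsilon> > 0"
  shows "smooth_on UNIV (conv g E \<epsilon>)"
proof -
  have "Ck_on k UNIV (conv g E \<epsilon>)" for k
    using assms(1,2)
  proof (induction k arbitrary: g)
    case 0
    have "(conv g E \<epsilon>) differentiable (at z)" for z
      using convolution_has_derivative[OF 0 E e] by (auto simp: differentiable_def)
    then show ?case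
      by (simp add: continuous_at_imp_continuous_on differentiable_imp_continuous_within)
  next
    case (Suc k)
    have D: "((conv g E \<epsilon>) has_derivative
     (\<lambda>h. \<Sum>b\<in>Basis. (h \<bullet> b) * conv (\<lambda>x. 1/\<epsilon> * pd b g x) E \<epsilon> z)) (at z)" for z
      by (rule convolution_has_derivative[OF Suc.prems(1) _ E e]) (rule Suc.prems(2))
    have d: "(conv g E \<epsilon>) differentiable (at z)" for z
      using D by (auto simp: differentiable_def)
    have "Ck_on k UNIV (pd b (conv g E \<epsilon>))" if b: "b \<in> Basis" for b
    proof -
      have "pd b (conv g E \<epsilon>)
        = (\<lambda>z. conv (\<lambda>x. 1/\<epsilon> * pd b g x) E \<epsilon> z)"
      proof
        fix z
        show "pd b (conv g E \<epsilon>) z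
            = conv (\<lambda>x. 1/\<epsilon> * pd b g x) E \<epsilon> z"
          unfolding pd_eqI[OF D[of z]]
          by (rule sum_Basis_single[OF b, of "\<lambda>c. conv (\<lambda>x. 1/\<epsilon> * pd c g x) E \<epsilon> z"])
      qed
      moreover have "Ck_on k UNIV (\<lambda>z. integral UNIV (\<lambda>w. (\<lambda>x. 1/\<epsilon> * pd b g x) ((1/\<epsilon>) *\<^sub>R (z - w)) * E w))"
      proof (rule Suc.IH)
        show "smooth_on UNIV (\<lambda>x. 1/\<epsilon> * pd b g x)"
          by (rule smooth_on_mult[OF open_UNIV smooth_on_const smooth_on_pd[OF Suc.prems(1) b]])
        show "1/\<epsilon> * pd b g x = 0" if "x \<notin> cball 0 1" for x
          using pd_conv_support[OF Suc.prems(2) that] by simp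
      qed
      ultimately show ?thesis by simp
    qed
    moreover have "continuous_on UNIV (conv g E \<epsilon>)"
      using d by (simp add: continuous_at_imp_continuous_on differentiable_imp_continuous_within)
    ultimately show ?case using d unfolding Ck_on_Suc_pd by blast
  qed
  then show ?thesis unfolding smooth_on_def by blast
qed

lemma mollifier_support:
  assumes "mollifier j" "x \<notin> cball 0 1" shows "j x = 0"
proof -
  have "closure {x. j x \<noteq> 0} = cball 0 1" using assms(1) unfolding mollifier_def by blast
  then have "{x. j x \<noteq> 0} \<subseteq> cball 0 1" using closure_subset[of "{x. j x \<noteq> 0}"] by simp
  then show ?thesis using assms(2) by blast
qed

lemma smooth_on_moll:
  assumes "mollifier j" "continuous_on UNIV E" "\<epsilon> > 0"
  shows "smooth_on UNIV (moll j \<epsilon> E)"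
proof -
  have "smooth_on UNIV (\<lambda>z. integral UNIV (\<lambda>w. (\<lambda>x. \<epsilon> powr (- real CARD('a)) * j x) ((1/\<epsilon>) *\<^sub>R (z - w)) * E w))"
  proof (rule smooth_on_convolution[OF _ _ assms(2,3)])
    show "smooth_on UNIV (\<lambda>x. \<epsilon> powr (- real CARD('a)) * j x)"
      using assms(1) unfolding mollifier_def by (intro smooth_on_mult smooth_on_const open_UNIV) blast
    show "\<epsilon> powr (- real CARD('a)) * j x = 0" if "x \<notin> cball 0 1" for x
      using mollifier_support[OF assms(1) that] by simp
  qed
  then show ?thesis by (simp add: moll_def[abs_def])
qed

section \<open>A weak-type Sobolev inequality\<close>

text \<open>The integral of (f - c)^2 is non-negative, where c is the mean of f on the unit
  interval.\<close>

lemma integral_0_1_square_le: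
  fixes f :: "real \<Rightarrow> real"
  assumes "continuous_on {0..1} f"
  shows "(LBINT s. indicator {0..1} s *\<^sub>R f s)\<^sup>2 \<le> (LBINT s. indicator {0..1} s *\<^sub>R (f s)\<^sup>2)"
proof -
  define c where "c = (LBINT s. indicator {0..1} s *\<^sub>R f s)"
  have i: "integrable lborel (\<lambda>s. indicator {0..1} s *\<^sub>R f s)"
    "integrable lborel (\<lambda>s. indicator {0..1} s *\<^sub>R (f s)\<^sup>2)"
    "integrable lborel (\<lambda>s. indicator {0..1::real} s *\<^sub>R c\<^sup>2)"
    by (intro borel_integrable_compact continuous_intros assms compact_Icc)+
  have "0 \<le> (LBINT s. indicator {0..1} s *\<^sub>R (f s - c)\<^sup>2)"
    by (rule integral_nonneg_AE) (auto simp: indicator_def)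
  also have "(\<lambda>s. indicator {0..1} s *\<^sub>R (f s - c)\<^sup>2) =
    (\<lambda>s. indicator {0..1} s *\<^sub>R (f s)\<^sup>2 - (2 * c) * (indicator {0..1} s *\<^sub>R f s) + indicator {0..1} s *\<^sub>R c\<^sup>2)"
    by (auto simp: fun_eq_iff indicator_def power2_eq_square algebra_simps)
  also have "(LBINT s. \<dots> s) = (LBINT s. indicator {0..1} s *\<^sub>R (f s)\<^sup>2) - 2 * c * c + c\<^sup>2"
    using i by (simp add: c_def)
  finally show ?thesis by (simp add: c_def power2_eq_square)
qed

lemma pd_square_le:
  fixes w :: "'a::euclidean_space \<Rightarrow> real"
  assumes "w differentiable (at x)"
  shows "(pd h w x)\<^sup>2 \<le> (norm h)\<^sup>2 * (\<Sum>b\<in>Basis. (pd b w x)\<^sup>2)"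
proof -
  have "(pd h w x)\<^sup>2 \<le> (\<Sum>b\<in>Basis. (h \<bullet> b)\<^sup>2) * (\<Sum>b\<in>Basis. (pd b w x)\<^sup>2)"
    unfolding pd_Basis_expansion[OF assms, of h] using Cauchy_Schwarz_ineq_sum[of "\<lambda>b. h \<bullet> b" "\<lambda>b. pd b w x" Basis] by simp
  moreover have "(norm h)\<^sup>2 = (\<Sum>b\<in>Basis. (h \<bullet> b)\<^sup>2)"
    unfolding power2_norm_eq_inner using euclidean_inner[of h h] by (simp add: power2_eq_square)
  ultimately show ?thesis by simp
qed

text \<open>The increment is the integral of the derivative along the segment from x to x + h.
  Square it by Jensen and integrate over x: by translation invariance every point of the segment
  contributes the same integral.\<close>

lemma integral_translate_diff_le:
  fixes w :: "'a::euclidean_space \<Rightarrow> real"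
  assumes K: "compact K" "\<And>x. x \<notin> K \<Longrightarrow> w x = 0"
    and w: "\<And>x. w differentiable (at x)" and cont: "\<And>b. b \<in> Basis \<Longrightarrow> continuous_on UNIV (pd b w)"
  shows "(LBINT x. (w (x + h) - w x)\<^sup>2) \<le> (norm h)\<^sup>2 * (LBINT x. \<Sum>b\<in>Basis. (pd b w x)\<^sup>2)"
proof -
  define D where "D = (\<lambda>x. \<Sum>b\<in>Basis. (pd b w x)\<^sup>2)"
  have cD: "continuous_on UNIV D" unfolding D_def using cont by (intro continuous_intros) auto
  have D0: "D x = 0" if "x \<notin> K" for x
    unfolding D_def using pd_eq_0_outside[OF compact_imp_closed[OF K(1)] K(2) that] by simp
  define L where "L = (\<lambda>(y, s). y - s *\<^sub>R h) ` (K \<times> {0..1::real})"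
  have L: "compact L" unfolding L_def by (rule compact_translates[OF K(1)])
  have inL: "x \<in> L" if "x + s *\<^sub>R h \<in> K" "s \<in> {0..1}" for x s
    unfolding L_def using that by (force intro!: image_eqI[of _ _ "(x + s *\<^sub>R h, s)"])
  have cw: "continuous_on UNIV w"
    using w by (simp add: continuous_at_imp_continuous_on differentiable_imp_continuous_within)
  define f where "f = (\<lambda>x s. indicator {0..1} s *\<^sub>R D (x + s *\<^sub>R h))"
  have int: "integrable (lborel \<Otimes>\<^sub>M lborel) (\<lambda>(x,s). f x s)"
  proof (rule integrable_lborel_pair_compact_support[of "L \<times> {0..1}"])
    have "continuous_on (L \<times> {0..1}) (\<lambda>(x,s). D (x + s *\<^sub>R h))"
      unfolding case_prod_unfold
      by (rule continuous_on_compose2[OF cD]) (auto intro!: continuous_intros)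
    then show "continuous_on (L \<times> {0..1}) (\<lambda>(x,s). f x s)"
      by (subst continuous_on_cong[OF refl, of _ _ "\<lambda>(x,s). D (x + s *\<^sub>R h)"]) (auto simp: f_def)
    show "f x s = 0" if "(x, s) \<notin> L \<times> {0..1}" for x s
      using that inL[of x s] D0 by (cases "s \<in> {0..1}") (auto simp: f_def)
  qed (use L in \<open>auto intro: compact_Times\<close>)
  have pdc: "continuous_on UNIV (pd h w)"
  proof -
    have "pd h w = (\<lambda>x. \<Sum>b\<in>Basis. (h \<bullet> b) * pd b w x)" using pd_Basis_expansion[OF w] by blast
    then show ?thesis using cont by (auto intro!: continuous_intros)
  qed
  have E1: "(w (x + h) - w x)\<^sup>2 \<le> (norm h)\<^sup>2 * (LBINT s. f x s)" for x
  proof -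
    have c1: "continuous_on {0..1} (\<lambda>s. pd h w (x + s *\<^sub>R h))"
      by (rule continuous_on_compose2[OF pdc]) (auto intro!: continuous_intros)
    have c2: "continuous_on {0..1} (\<lambda>s. D (x + s *\<^sub>R h))"
      by (rule continuous_on_compose2[OF cD]) (auto intro!: continuous_intros)
    have "(LBINT s. indicator {0..1} s *\<^sub>R pd h w (x + s *\<^sub>R h)) = w (x + 1 *\<^sub>R h) - w (x + 0 *\<^sub>R h)"
    proof (rule integral_FTC_atLeastAtMost)
      show "((\<lambda>s. w (x + s *\<^sub>R h)) has_vector_derivative pd h w (x + s *\<^sub>R h)) (at s within {0..1})" for s
        using has_derivative_along[OF w] has_field_derivative_at_within
          has_real_derivative_iff_has_vector_derivative by blast
    qed (use c1 in auto)
    then have "(w (x + h) - w x)\<^sup>2 = (LBINT s. indicator {0..1} s *\<^sub>R pd h w (x + s *\<^sub>R h))\<^sup>2" by simp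
    also have "\<dots> \<le> (LBINT s. indicator {0..1} s *\<^sub>R (pd h w (x + s *\<^sub>R h))\<^sup>2)"
      by (rule integral_0_1_square_le[OF c1])
    also have "\<dots> \<le> (LBINT s. (norm h)\<^sup>2 * f x s)"
    proof (rule integral_mono)
      show "integrable lborel (\<lambda>s. indicator {0..1} s *\<^sub>R (pd h w (x + s *\<^sub>R h))\<^sup>2)"
        by (intro borel_integrable_compact continuous_intros c1 compact_Icc)
      show "integrable lborel (\<lambda>s. (norm h)\<^sup>2 * f x s)" unfolding f_def
        by (intro integrable_mult_right borel_integrable_compact c2 compact_Icc)
      show "indicator {0..1} s *\<^sub>R (pd h w (x + s *\<^sub>R h))\<^sup>2 \<le> (norm h)\<^sup>2 * f x s" for s
        using pd_square_le[OF w, of h "x + s *\<^sub>R h"] by (auto simp: f_def D_def indicator_def)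
    qed
    finally show ?thesis by simp
  qed
  have E2: "(LBINT x. f x s) = indicator {0..1} s *\<^sub>R (LBINT x. D x)" for s
    using lborel_integral_translation[OF borel_measurable_continuous_onI[OF cD]] by (simp add: f_def)
  have "(LBINT x. (w (x + h) - w x)\<^sup>2) \<le> (LBINT x. (norm h)\<^sup>2 * (LBINT s. f x s))"
  proof (rule integral_mono)
    show "integrable lborel (\<lambda>x. (w (x + h) - w x)\<^sup>2)"
    proof (rule integrable_lborel_compact_support[of "L \<union> K"])
      show "continuous_on (L \<union> K) (\<lambda>x. (w (x + h) - w x)\<^sup>2)"
        by (intro continuous_intros continuous_on_compose2[OF cw]) auto
      show "(w (x + h) - w x)\<^sup>2 = 0" if "x \<notin> L \<union> K" for x
        using inL[of x 1] that K(2) by auto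
    qed (use L K in auto)
    show "integrable lborel (\<lambda>x. (norm h)\<^sup>2 * (LBINT s. f x s))"
      by (intro integrable_mult_right lborel_pair.integrable_fst int)
  qed (rule E1)
  also have "\<dots> = (norm h)\<^sup>2 * (LBINT x. LBINT s. f x s)" by simp
  also have "(LBINT x. LBINT s. f x s) = (LBINT s. LBINT x. f x s)"
    by (rule lborel_pair.Fubini_integral[OF int, symmetric])
  also have "\<dots> = (LBINT x. D x)" unfolding E2 by simp
  finally show ?thesis unfolding D_def .
qed

text \<open>Average \<open>w(x)\<^sup>2 \<le> 2 w(x + h)\<^sup>2 + 2 (w(x + h) - w(x))\<^sup>2\<close> over a ball of increments \<open>h\<close> whose radius is
  chosen so that the first term contributes at most \<open>\<mu>\<^sup>2 / 2\<close>.\<close>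

lemma weak_sobolev:
  fixes w :: "'a::euclidean_space \<Rightarrow> real"
  assumes K: "compact K" "\<And>x. x \<notin> K \<Longrightarrow> w x = 0"
    and w: "\<And>x. w differentiable (at x)" and cont: "\<And>b. b \<in> Basis \<Longrightarrow> continuous_on UNIV (pd b w)"
    and mu: "\<mu> > 0"
  shows "\<mu> powr (2 + 4 / DIM('a)) * measure lborel {x. \<mu> < \<bar>w x\<bar>}
    \<le> 4 * (4 / unit_ball_vol (DIM('a))) powr (2 / DIM('a)) * (LBINT x. (w x)\<^sup>2) powr (2 / DIM('a))
        * (LBINT x. \<Sum>b\<in>Basis. (pd b w x)\<^sup>2)"
proof -
  define n where "n = DIM('a)"
  define v where "v = unit_ball_vol (real n)"
  define I where "I = (LBINT x. (w x)\<^sup>2)"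
  define D where "D = (LBINT x. \<Sum>b\<in>Basis. (pd b w x)\<^sup>2)"
  have n: "n > 0" by (simp add: n_def)
  have v: "v > 0" by (simp add: v_def)
  have D0: "D \<ge> 0" unfolding D_def by (intro integral_nonneg_AE AE_I2 sum_nonneg) auto
  have I0: "I \<ge> 0" unfolding I_def by (intro integral_nonneg_AE AE_I2) auto
  have cw: "continuous_on UNIV w"
    using w by (simp add: continuous_at_imp_continuous_on differentiable_imp_continuous_within)
  define S where "S = {x. \<mu> < \<bar>w x\<bar>}"
  have oS: "open S" unfolding S_def by (intro open_Collect_less continuous_intros cw)
  have SK: "S \<subseteq> K" using K(2) mu by (force simp: S_def)
  have mS: "S \<in> sets borel" using oS by simp
  have fS: "emeasure lborel S < \<infinity>"
    using emeasure_mono[OF SK, of lborel] emeasure_compact_finite[OF K(1)] K(1)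
    by (simp add: compact_imp_closed borel_closed)
  have iw2: "integrable lborel (\<lambda>x. (w x)\<^sup>2)"
    by (rule integrable_lborel_compact_support[OF K(1)])
      (auto intro!: continuous_intros continuous_on_subset[OF cw] simp: K(2))
  show ?thesis
  proof (cases "I = 0")
    case True
    have "AE x in lborel. (w x)\<^sup>2 = 0"
      using integral_nonneg_eq_0_iff_AE[OF iw2] True by (simp add: I_def)
    then have "AE x in lborel. x \<notin> S" by (rule AE_mp) (use mu in \<open>auto simp: S_def\<close>)
    then have "emeasure lborel S = 0" using AE_iff_measurable[of S lborel "\<lambda>x. x \<notin> S"] mS by simp
    then have "measure lborel S = 0" by (simp add: measure_def)
    then show ?thesis using True unfolding S_def I_def n_def by simp
  next
    case False
    then have I: "I > 0" using I0 by simp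
    define r where "r = (4 * I / (v * \<mu>\<^sup>2)) powr (1 / n)"
    have r: "r > 0" unfolding r_def using I v mu by simp
    have "r ^ n = r powr n" using r by (simp add: powr_realpow)
    also have "\<dots> = 4 * I / (v * \<mu>\<^sup>2)" unfolding r_def powr_powr using n I v mu by simp
    finally have rn: "v * r ^ n * \<mu>\<^sup>2 = 4 * I" using v mu by simp
    define B where "B = cball (0::'a) r"
    have mB: "measure lborel B = v * r ^ n" unfolding B_def v_def n_def
      using content_cball[of r "0::'a"] r by simp
    define f where "f = (\<lambda>x h. indicator B h *\<^sub>R (w (x + h) - w x)\<^sup>2)"
    define L where "L = K \<union> (\<lambda>(y, h). y - h) ` (K \<times> B)"
    have L: "compact L" unfolding L_def B_def
      by (intro compact_Un compact_continuous_image compact_Times K compact_cball)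
        (auto intro!: continuous_intros simp: case_prod_unfold)
    have inL: "x \<in> L" if "x + h \<in> K" "h \<in> B" for x h
      unfolding L_def using that by (force intro!: image_eqI[of _ _ "(x + h, h)"])
    have int: "integrable (lborel \<Otimes>\<^sub>M lborel) (\<lambda>(x,h). f x h)"
    proof (rule integrable_lborel_pair_compact_support[of "L \<times> B"])
      have "continuous_on (L \<times> B) (\<lambda>(x,h). (w (x + h) - w x)\<^sup>2)"
        unfolding case_prod_unfold
        by (intro continuous_intros continuous_on_compose2[OF cw]) auto
      then show "continuous_on (L \<times> B) (\<lambda>(x,h). f x h)"
        by (subst continuous_on_cong[OF refl, of _ _ "\<lambda>(x,h). (w (x + h) - w x)\<^sup>2"]) (auto simp: f_def)
      show "f x h = 0" if "(x, h) \<notin> L \<times> B" for x h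
      proof (cases "h \<in> B")
        case True
        then have "x \<notin> L" using that by simp
        then have "x \<notin> K" "x + h \<notin> K" using inL[of x h] True by (auto simp: L_def)
        then show ?thesis using K(2) by (simp add: f_def)
      qed (simp add: f_def)
    qed (use L in \<open>auto intro: compact_Times simp: B_def\<close>)
    \<comment> \<open>On \<open>S\<close> the number 4 I = |B| \<mu>^2 is at most 2 I plus twice the
      integral of \<open>f x\<close>; absorbing 2 I leaves the claim.\<close>
    have lower: "indicator S x * (I / 1) \<le> (LBINT h. f x h)" for x
    proof (cases "x \<in> S")
      case True
      have ib: "integrable lborel (\<lambda>h. indicator B h *\<^sub>R (w (x + h))\<^sup>2)" "integrable lborel (f x)"
         "integrable lborel (\<lambda>h. indicator B h *\<^sub>R \<mu>\<^sup>2)" unfolding f_def B_def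
        by (intro borel_integrable_compact continuous_intros continuous_on_compose2[OF cw] compact_cball; auto)+
      have iwx: "integrable lborel (\<lambda>h. (w (x + h))\<^sup>2)"
      proof -
        have "integrable (distr lborel borel ((+) x)) (\<lambda>x. (w x)\<^sup>2)" unfolding lborel_distr_plus by (rule iw2)
        then show ?thesis by (subst (asm) integrable_distr_eq) (auto intro!: borel_measurable_continuous_onI continuous_intros cw)
      qed
      have wm: "(\<lambda>x. (w x)\<^sup>2) \<in> borel_measurable borel"
        by (intro borel_measurable_continuous_onI continuous_intros cw)
      have "v * r ^ n * \<mu>\<^sup>2 = (LBINT h. indicator B h *\<^sub>R \<mu>\<^sup>2)" using mB by (simp add: B_def)
      also have "\<dots> \<le> (LBINT h. 2 * (indicator B h *\<^sub>R (w (x + h))\<^sup>2) + 2 * f x h)"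
      proof (rule integral_mono)
        show "indicator B h *\<^sub>R \<mu>\<^sup>2 \<le> 2 * (indicator B h *\<^sub>R (w (x + h))\<^sup>2) + 2 * f x h" for h
        proof -
          have "\<mu>\<^sup>2 \<le> (w x)\<^sup>2" using True mu by (simp add: S_def abs_le_square_iff[symmetric])
          also have "(w x)\<^sup>2 \<le> 2 * (w (x + h))\<^sup>2 + 2 * (w (x + h) - w x)\<^sup>2"
            using zero_le_power2[of "2 * w (x + h) - w x"] by (simp add: power2_eq_square algebra_simps)
          finally show ?thesis by (auto simp: f_def indicator_def)
        qed
      qed (use ib in auto)
      also have "\<dots> = 2 * (LBINT h. indicator B h *\<^sub>R (w (x + h))\<^sup>2) + 2 * (LBINT h. f x h)"
        using ib by simp
      also have "(LBINT h. indicator B h *\<^sub>R (w (x + h))\<^sup>2) \<le> (LBINT h. (w (x + h))\<^sup>2)"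
        by (rule integral_mono[OF ib(1) iwx]) (auto simp: indicator_def)
      also have "(LBINT h. (w (x + h))\<^sup>2) = I"
        using lborel_integral_translation[OF wm, of x] by (simp add: I_def add.commute)
      finally show ?thesis using rn True by simp
    next
      case False
      have "0 \<le> (LBINT h. f x h)" by (rule integral_nonneg_AE) (auto simp: f_def indicator_def)
      then show ?thesis using False by simp
    qed
    have "measure lborel S * I = (LBINT x. indicator S x * (I / 1))" using mS by simp
    also have "\<dots> \<le> (LBINT x. LBINT h. f x h)"
    proof (rule integral_mono[OF _ lborel_pair.integrable_fst[OF int] lower])
      show "integrable lborel (\<lambda>x. indicator S x * (I / 1))"
        using fS mS by (intro integrable_mult_left integrable_real_indicator) auto
    qed
    also have "\<dots> = (LBINT h. LBINT x. f x h)" by (rule lborel_pair.Fubini_integral[OF int, symmetric])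
    also have "\<dots> \<le> (LBINT h. indicator B h *\<^sub>R (r\<^sup>2 * D))"
    proof (rule integral_mono[OF lborel_pair.integrable_snd[OF int]])
      show "integrable lborel (\<lambda>h. indicator B h *\<^sub>R (r\<^sup>2 * D))" unfolding B_def
        by (intro borel_integrable_compact continuous_intros compact_cball)
      show "(LBINT x. f x h) \<le> indicator B h *\<^sub>R (r\<^sup>2 * D)" for h
      proof (cases "h \<in> B")
        case True
        have "(LBINT x. f x h) = (LBINT x. (w (x + h) - w x)\<^sup>2)" using True by (simp add: f_def)
        also have "\<dots> \<le> (norm h)\<^sup>2 * D" unfolding D_def by (rule integral_translate_diff_le[OF K w cont])
        also have "\<dots> \<le> r\<^sup>2 * D" using True D0 by (intro mult_right_mono power_mono) (auto simp: B_def)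
        finally show ?thesis using True by simp
      qed (simp add: f_def)
    qed
    also have "\<dots> = v * r ^ n * (r\<^sup>2 * D)" using mB by (simp add: B_def)
    also have "v * r ^ n = 4 * I / \<mu>\<^sup>2" using rn mu by (simp add: field_simps)
    finally have "measure lborel S * I \<le> (4 / \<mu>\<^sup>2 * r\<^sup>2 * D) * I" by (simp add: mult_ac)
    then have main: "\<mu>\<^sup>2 * measure lborel S \<le> 4 * r\<^sup>2 * D" using I mu by (simp add: field_simps)
    \<comment> \<open>The radius is a multiple of (I / \<mu>^2)^(1/n). Moving its power of \<mu> to
      the left turns \<mu>^2 into \<mu>^(2 + 4/n).\<close>
    have "r\<^sup>2 = r powr 2" using r by simp
    also have "\<dots> = (4 / v * I * \<mu> powr (-2)) powr (2 / n)"
      unfolding r_def powr_powr using mu by (simp add: powr_minus_divide)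
    also have "\<dots> = (4 / v) powr (2 / n) * I powr (2 / n) * \<mu> powr (- 4 / n)"
      using v I mu by (simp add: powr_mult powr_powr powr_divide)
    finally have r2: "r\<^sup>2 * \<mu> powr (4 / n) = (4 / v) powr (2 / n) * I powr (2 / n)"
      using mu by (simp add: powr_minus field_simps)
    have "\<mu> powr (2 + 4 / n) * measure lborel S = \<mu> powr (4 / n) * (\<mu>\<^sup>2 * measure lborel S)"
      using mu by (simp add: powr_add)
    also have "\<dots> \<le> \<mu> powr (4 / n) * (4 * r\<^sup>2 * D)" by (intro mult_left_mono main) auto
    also have "\<dots> = 4 * (r\<^sup>2 * \<mu> powr (4 / n)) * D" by simp
    finally show ?thesis unfolding r2 by (simp add: S_def n_def v_def I_def D_def mult.assoc)
  qed
qed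

section \<open>Weak solutions are classical solutions\<close>

text \<open>The coordinate directions of space and of time in which \<open>grad_x\<close> and
  \<open>dt\<close> differentiate. As basis vectors of the product space they fit the calculus of
  \<open>pd\<close>.\<close>

definition ex :: "'n \<Rightarrow> (real^'n) \<times> real" where "ex i = (axis i 1, 0)"
definition et :: "(real^'n) \<times> real" where "et = (0, 1)"

lemma ex_Basis [simp]: "ex i \<in> Basis"
  by (auto simp: ex_def Basis_prod_def axis_in_Basis_iff)

lemma et_Basis [simp]: "et \<in> Basis"
  by (auto simp: et_def Basis_prod_def)

lemma grad_x_nth: "grad_x u X $ i = pd (ex i) u X"
  by (simp add: grad_x_def pd_def ex_def)

lemma dt_eq: "dt u = pd et u"
  by (simp add: fun_eq_iff dt_def pd_def et_def)

lemma grad_nth: "grad E z $ i = pd (axis i 1) E z"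
  by (simp add: grad_def pd_def)

lemma hess_nth: "hess E z $ i $ k = pd (axis i 1) (pd (axis k 1) E) z"
  by (simp add: hess_def grad_nth pd_def[abs_def])

lemma continuous_on_cutoff:
  fixes h \<phi> :: "'a::euclidean_space \<Rightarrow> real"
  assumes D: "open D" and S: "closed S" "S \<subseteq> D" and h: "continuous_on D h"
    and \<phi>: "continuous_on D \<phi>" "\<And>x. x \<notin> S \<Longrightarrow> \<phi> x = 0"
  shows "continuous_on UNIV (\<lambda>x. h x * \<phi> x)"
proof -
  have "continuous_on (D \<union> - S) (\<lambda>x. h x * \<phi> x)"
  proof (rule continuous_on_open_Un)
    show "continuous_on D (\<lambda>x. h x * \<phi> x)" by (intro continuous_intros h \<phi>)
    show "continuous_on (- S) (\<lambda>x. h x * \<phi> x)"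
      by (subst continuous_on_cong[OF refl, of _ _ "\<lambda>_. 0"]) (auto simp: \<phi>)
  qed (use D S in auto)
  moreover have "D \<union> - S = UNIV" using S by auto
  ultimately show ?thesis by simp
qed

text \<open>Off \<open>D\<close> the value \<open>pd b h x\<close> is arbitrary, but it is
  multiplied by \<phi> x = 0, so the product rule holds at every point of the space.\<close>

lemma cutoff_mult:
  fixes h \<phi> :: "'a::euclidean_space \<Rightarrow> real"
  assumes D: "open D" and S: "closed S" "S \<subseteq> D" and h: "smooth_on D h"
    and \<phi>: "smooth_on UNIV \<phi>" "\<And>x. x \<notin> S \<Longrightarrow> \<phi> x = 0"
  shows "(\<lambda>x. h x * \<phi> x) differentiable (at x)"
    and "pd b (\<lambda>x. h x * \<phi> x) x = h x * pd b \<phi> x + pd b h x * \<phi> x"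
proof -
  have "((\<lambda>x. h x * \<phi> x) has_derivative (\<lambda>b. h x * pd b \<phi> x + pd b h x * \<phi> x)) (at x)"
  proof (cases "x \<in> D")
    case True
    show ?thesis
      by (rule has_derivative_mult) (auto intro!: has_derivative_pd smooth_on_differentiable[OF h True] smooth_on_differentiable[OF \<phi>(1)])
  next
    case False
    then have x: "x \<in> - S" using S by auto
    have z: "(\<lambda>b. h x * pd b \<phi> x + pd b h x * \<phi> x) = (\<lambda>_. 0)"
      using pd_eq_0_outside[OF S(1) \<phi>(2)] \<phi>(2) x by (auto simp: fun_eq_iff)
    show ?thesis unfolding z
      by (rule has_derivative_transform_within_open[OF has_derivative_const[of 0], of "- S"]) (use S x \<phi> in auto)
  qed
  then show "(\<lambda>x. h x * \<phi> x) differentiable (at x)" "pd b (\<lambda>x. h x * \<phi> x) x = h x * pd b \<phi> x + pd b h x * \<phi> x"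
    by (auto simp: differentiable_def pd_eqI)
qed

lemma integral_lebesgue_on_cutoff:
  fixes F :: "'a::euclidean_space \<Rightarrow> real"
  assumes D: "open D" and F: "continuous_on UNIV F" "\<And>x. x \<notin> D \<Longrightarrow> F x = 0"
  shows "integral\<^sup>L (lebesgue_on D) F = integral\<^sup>L lborel F"
proof -
  have "integral\<^sup>L (lebesgue_on D) F = integral\<^sup>L lebesgue (\<lambda>x. indicator D x *\<^sub>R F x)"
    using D by (subst integral_restrict_space) auto
  also have "(\<lambda>x. indicator D x *\<^sub>R F x) = F" using F(2) by (auto simp: fun_eq_iff indicator_def)
  also have "integral\<^sup>L lebesgue F = integral\<^sup>L lborel F"
    by (rule integral_completion) (use F in \<open>auto intro: borel_measurable_continuous_onI\<close>)
  finally show ?thesis .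
qed

lemma continuous_nonneg_integral_0:
  fixes F :: "'a::euclidean_space \<Rightarrow> real"
  assumes F: "continuous_on UNIV F" "\<And>x. F x \<ge> 0" "integrable lborel F" "integral\<^sup>L lborel F = 0"
  shows "F x = 0"
proof (rule ccontr)
  assume "F x \<noteq> 0"
  define U where "U = {x. F x > 0}"
  have U: "open U" unfolding U_def by (intro open_Collect_less continuous_intros F(1))
  have "x \<in> U" using F(2)[of x] \<open>F x \<noteq> 0\<close> by (simp add: U_def)
  then have "\<not> negligible U" using open_not_negligible[OF U] by auto
  have "AE x in lborel. F x = 0" using integral_nonneg_eq_0_iff_AE[OF F(3)] F(2,4) by simp
  then have "AE x in lborel. x \<notin> U" by (rule AE_mp) (auto simp: U_def)
  then have "emeasure lborel U = 0" using AE_iff_measurable[of U lborel "\<lambda>x. x \<notin> U"] U by simp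
  then have "U \<in> null_sets lborel" using U by (auto simp: null_sets_def)
  then have "negligible U" using negligible_iff_null_sets null_sets_completionI by blast
  then show False using \<open>\<not> negligible U\<close> by simp
qed

text \<open>Placing the time variable on a coordinate axis lets the given mollifier serve as a bump
  in time as well as in space.\<close>

lemma smooth_on_bump:
  fixes j :: "real^'n \<Rightarrow> real"
  assumes "smooth_on UNIV j"
  shows "smooth_on UNIV (\<lambda>X::(real^'n) \<times> real. j (c *\<^sub>R (fst X - x1)) * j ((c * (snd X - t1)) *\<^sub>R axis i 1))"
proof (rule smooth_on_mult[OF open_UNIV]; rule smooth_on_compose[OF open_UNIV _ assms])
  have 1: "bounded_linear (\<lambda>X::(real^'n) \<times> real. c * (fst X $ i))" for i
    by (intro bounded_linear_mult_right[THEN bounded_linear_compose]  bounded_linear_compose[OF bounded_linear_vec_nth bounded_linear_fst])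
  show "smooth_on UNIV (\<lambda>X::(real^'n) \<times> real. (c *\<^sub>R (fst X - x1)) $ i)" for i
    using smooth_on_diff[OF open_UNIV smooth_on_linear[OF 1] smooth_on_const[of UNIV "c * x1 $ i"]]
    by (simp add: right_diff_distrib)
  have 2: "bounded_linear (\<lambda>X::(real^'n) \<times> real. (c * k) * snd X)" for k
    by (intro bounded_linear_mult_right[THEN bounded_linear_compose] bounded_linear_snd)
  show "smooth_on UNIV (\<lambda>X::(real^'n) \<times> real. ((c * (snd X - t1)) *\<^sub>R axis i 1) $ k)" for k
    using smooth_on_diff[OF open_UNIV smooth_on_linear[OF 2[of "axis i 1 $ k"]] smooth_on_const[of UNIV "c * t1 * axis i 1 $ k"]]
    by (simp add: algebra_simps)
qed

text \<open>If the residual g of the equation were non-zero at a point, it would keep its sign s on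
  a small closed cylinder. Testing with a bump supported there and integrating by parts gives a
  vanishing integral of g \<phi>, whose integrand has one sign and is not identically zero.\<close>

lemma classical_solution_aux:
  fixes u f :: "(real^'n) \<times> real \<Rightarrow> real" and j E :: "real^'n \<Rightarrow> real"
  assumes D: "open D" and E: "smooth_on UNIV E" and u: "smooth_on D u" and f: "smooth_on D f"
    and j: "mollifier j" and weak: "weak_solution E D u f"
    and g: "\<And>X. g X = pd et u X - (\<Sum>i\<in>UNIV. pd (ex i) (\<lambda>X. pd (axis i 1) E (grad_x u X)) X) - f X"
    and X1: "X1 \<in> D" "s = 1 \<or> s = -1" "s * g X1 > 0"
  shows False
proof -
  define b where "b = (\<lambda>i X. pd (axis i 1) E (grad_x u X))"
  have b: "smooth_on D (b i)" for i unfolding b_def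
  proof (rule smooth_on_compose[OF D])
    show "smooth_on D (\<lambda>x. grad_x u x $ k)" for k
      unfolding grad_x_nth by (rule smooth_on_pd[OF u]) simp
    show "smooth_on UNIV (pd (axis i 1) E)" by (rule smooth_on_pd[OF E]) (simp add: axis_in_Basis_iff)
  qed
  have "smooth_on D (\<lambda>X. pd et u X - (\<Sum>i\<in>UNIV. pd (ex i) (b i) X) - f X)"
    by (intro smooth_on_diff smooth_on_sum smooth_on_pd D u f b) auto
  moreover have "g = (\<lambda>X. pd et u X - (\<Sum>i\<in>UNIV. pd (ex i) (b i) X) - f X)"
    using g by (auto simp: b_def)
  ultimately have gs: "smooth_on D g" by simp
  have cg: "continuous_on D (\<lambda>X. s * g X)" by (intro continuous_intros smooth_on_continuous gs)
  obtain x1 t1 where X1_eq: "X1 = (x1, t1)" by (cases X1)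
  have "open (D \<inter> (\<lambda>X. s * g X) -` {0<..})" by (rule continuous_open_preimage[OF cg D]) auto
  moreover have "D \<inter> (\<lambda>X. s * g X) -` {0<..} = {X\<in>D. s * g X > 0}" by auto
  ultimately have "open {X\<in>D. s * g X > 0}" by simp
  moreover have "(x1, t1) \<in> {X\<in>D. s * g X > 0}" using X1 X1_eq by simp
  ultimately obtain A B where AB0: "open A" "open B" "(x1, t1) \<in> A \<times> B" "A \<times> B \<subseteq> {X\<in>D. s * g X > 0}"
    by (rule open_prod_elim)
  have AB: "open A" "open B" "x1 \<in> A" "t1 \<in> B" "A \<times> B \<subseteq> {X\<in>D. s * g X > 0}" using AB0 by auto
  obtain r1 where r1: "r1 > 0" "cball x1 r1 \<subseteq> A" using AB open_contains_cball by blast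
  obtain r2 where r2: "r2 > 0" "cball t1 r2 \<subseteq> B" using AB open_contains_cball by blast
  define r where "r = min r1 r2"
  have r: "r > 0" "cball x1 r \<subseteq> A" "cball t1 r \<subseteq> B" using r1 r2 by (auto simp: r_def)
  define S where "S = cball x1 r \<times> cball t1 r"
  have S: "compact S" "closed S" "S \<subseteq> D" "\<And>X. X \<in> S \<Longrightarrow> s * g X > 0"
    using r AB by (auto simp: S_def compact_Times closed_Times subset_iff)
  \<comment> \<open>Any coordinate will do: it only names the axis that carries the time
    variable.\<close>
  define i0 :: 'n where "i0 = undefined"
  define \<phi> where "\<phi> = (\<lambda>X::(real^'n) \<times> real. j ((1/r) *\<^sub>R (fst X - x1)) * j ((1/r * (snd X - t1)) *\<^sub>R axis i0 1))"
  have js: "smooth_on UNIV j" using j unfolding mollifier_def by blast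
  have \<phi>s: "smooth_on UNIV \<phi>" unfolding \<phi>_def by (rule smooth_on_bump[OF js])
  have \<phi>0: "\<phi> X = 0" if "X \<notin> S" for X
  proof -
    obtain x t where X: "X = (x, t)" by (cases X)
    show ?thesis
    proof (cases "dist x1 x \<le> r")
      case False
      then have "norm ((1/r) *\<^sub>R (x - x1)) > 1"
        unfolding norm_scaleR using r by (simp add: dist_norm norm_minus_commute field_simps)
      then show ?thesis using mollifier_support[OF j, of "(1/r) *\<^sub>R (x - x1)"] by (simp add: \<phi>_def X)
    next
      case True
      then have "dist t1 t > r" using that by (auto simp: S_def X)
      then have "norm ((1/r * (t - t1)) *\<^sub>R axis i0 (1::real)) > 1"
        unfolding norm_scaleR using r by (simp add: dist_real_def norm_axis_1 abs_mult field_simps)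
      then have "j ((1/r * (t - t1)) *\<^sub>R axis i0 1) = 0"
        by (intro mollifier_support[OF j]) simp
      then show ?thesis by (simp add: \<phi>_def X)
    qed
  qed
  have jn: "j x \<ge> 0" for x using j unfolding mollifier_def by blast
  then have \<phi>n: "\<phi> X \<ge> 0" for X by (simp add: \<phi>_def)
  have "\<exists>y. j y \<noteq> 0"
  proof (rule ccontr)
    assume "\<not> ?thesis"
    then have "{x. j x \<noteq> 0} = {}" by auto
    moreover have "closure {x. j x \<noteq> 0} = cball 0 1" using j unfolding mollifier_def by blast
    ultimately have "cball (0::real^'n) 1 = {}" by (metis closure_empty)
    moreover have "(0::real^'n) \<in> cball 0 1" by simp
    ultimately show False by blast
  qed
  then obtain y where y: "j y \<noteq> 0" by blast
  have "norm (norm y *\<^sub>R axis i0 (1::real)) = norm y" by (simp add: norm_axis_1)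
  then have y2: "j (norm y *\<^sub>R axis i0 1) = j y" using j unfolding mollifier_def by blast
  \<comment> \<open>The mollifier may vanish at the origin, so the centre of the cylinder need not
    be a point where \<phi> is positive. At \<open>X2\<close> both factors equal j y, the second one
    because j is radial.\<close>
  define X2 where "X2 = (x1 + r *\<^sub>R y, t1 + r * norm y)"
  have \<phi>X2: "\<phi> X2 \<noteq> 0" using r y y2 by (simp add: \<phi>_def X2_def)
  have X2: "X2 \<in> S" using \<phi>0 \<phi>X2 by blast
  note cm = cutoff_mult[OF D S(2,3) _ \<phi>s \<phi>0]
  have \<phi>c: "continuous_on D \<phi>" "continuous_on D (pd e \<phi>)" if "e \<in> Basis" for e
    using smooth_on_continuous[OF \<phi>s] smooth_on_continuous[OF smooth_on_pd[OF \<phi>s that]] continuous_on_subset by blast+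
  have \<phi>c': "continuous_on D \<phi>" by (rule \<phi>c(1)[OF et_Basis])
  have p\<phi>0: "pd e \<phi> X = 0" if "X \<notin> S" for X e by (rule pd_eq_0_outside[OF S(2) \<phi>0 that])
  have ci: "integrable lborel (\<lambda>X. h X * \<psi> X)" "continuous_on UNIV (\<lambda>X. h X * \<psi> X)"
    if "continuous_on D h" "continuous_on D \<psi>" "\<And>X. X \<notin> S \<Longrightarrow> \<psi> X = 0" for h \<psi> :: "(real^'n) \<times> real \<Rightarrow> real"
  proof -
    show c: "continuous_on UNIV (\<lambda>X. h X * \<psi> X)"
      by (rule continuous_on_cutoff[OF D S(2,3) that])
    show "integrable lborel (\<lambda>X. h X * \<psi> X)"
      by (rule integrable_lborel_compact_support[OF S(1) continuous_on_subset[OF c]]) (use that in auto)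
  qed
  have pdint: "(LBINT X. h X * pd e \<phi> X) = - (LBINT X. pd e h X * \<phi> X)" if h: "smooth_on D h" and e: "e \<in> Basis" for h e
  proof -
    note i = ci[OF smooth_on_continuous[OF h] \<phi>c(2)[OF e] p\<phi>0]
      ci[OF smooth_on_continuous[OF smooth_on_pd[OF h e]] \<phi>c' \<phi>0]
    have eq: "pd e (\<lambda>X. h X * \<phi> X) = (\<lambda>X. h X * pd e \<phi> X + pd e h X * \<phi> X)"
      using cm(2)[OF h] by (auto simp: fun_eq_iff)
    have "(LBINT X. pd e (\<lambda>X. h X * \<phi> X) X) = 0"
    proof (rule integral_pd_eq_0[OF S(1)])
      show "(\<lambda>X. h X * \<phi> X) differentiable at X" for X using cm(1)[OF h] by blast
      show "continuous_on UNIV (pd e (\<lambda>X. h X * \<phi> X))" unfolding eq by (intro continuous_intros i)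
    qed (simp add: \<phi>0)
    then show ?thesis unfolding eq using i by simp
  qed
  have ux: "continuous_on D (b i)" for i by (rule smooth_on_continuous[OF b])
  have i1: "integrable lborel (\<lambda>X. u X * pd et \<phi> X)" "continuous_on UNIV (\<lambda>X. u X * pd et \<phi> X)"
    by (intro ci \<phi>c smooth_on_continuous u p\<phi>0 et_Basis; assumption)+
  have i2: "integrable lborel (\<lambda>X. b i X * pd (ex i) \<phi> X)" "continuous_on UNIV (\<lambda>X. b i X * pd (ex i) \<phi> X)" for i
    by (intro ci \<phi>c smooth_on_continuous b p\<phi>0 ex_Basis; assumption)+
  have i3: "integrable lborel (\<lambda>X. f X * \<phi> X)" "continuous_on UNIV (\<lambda>X. f X * \<phi> X)"
    by (intro ci \<phi>c' smooth_on_continuous f \<phi>0; assumption)+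
  have i4: "integrable lborel (\<lambda>X. pd et u X * \<phi> X)"
    by (intro ci \<phi>c' smooth_on_continuous smooth_on_pd u et_Basis \<phi>0; assumption)
  have i5: "integrable lborel (\<lambda>X. pd (ex i) (b i) X * \<phi> X)" for i
    by (intro ci \<phi>c' smooth_on_continuous smooth_on_pd b ex_Basis \<phi>0; assumption)
  have w1: "(\<lambda>X. - u X * dt \<phi> X + grad E (grad_x u X) \<bullet> grad_x \<phi> X)
      = (\<lambda>X. - (u X * pd et \<phi> X) + (\<Sum>i\<in>UNIV. b i X * pd (ex i) \<phi> X))"
    by (simp add: fun_eq_iff dt_eq inner_vec_def grad_nth grad_x_nth b_def)
  have "integral\<^sup>L (lebesgue_on D) (\<lambda>X. - u X * dt \<phi> X + grad E (grad_x u X) \<bullet> grad_x \<phi> X)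
       = integral\<^sup>L (lebesgue_on D) (\<lambda>X. f X * \<phi> X)"
    using weak \<phi>s S(1,3) \<phi>0 unfolding weak_solution_def by blast
  moreover have "integral\<^sup>L (lebesgue_on D) (\<lambda>X. - u X * dt \<phi> X + grad E (grad_x u X) \<bullet> grad_x \<phi> X)
     = (LBINT X. - (u X * pd et \<phi> X) + (\<Sum>i\<in>UNIV. b i X * pd (ex i) \<phi> X))"
    unfolding w1
  proof (rule integral_lebesgue_on_cutoff[OF D])
    show "continuous_on UNIV (\<lambda>X. - (u X * pd et \<phi> X) + (\<Sum>i\<in>UNIV. b i X * pd (ex i) \<phi> X))"
      by (intro continuous_intros i1 i2)
    show "- (u X * pd et \<phi> X) + (\<Sum>i\<in>UNIV. b i X * pd (ex i) \<phi> X) = 0" if "X \<notin> D" for X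
    proof -
      have "X \<notin> S" using that S(3) by blast
      then show ?thesis by (simp add: p\<phi>0)
    qed
  qed
  moreover have "integral\<^sup>L (lebesgue_on D) (\<lambda>X. f X * \<phi> X) = (LBINT X. f X * \<phi> X)"
    by (rule integral_lebesgue_on_cutoff[OF D i3(2)]) (use \<phi>0 S(3) in auto)
  ultimately have "(LBINT X. - (u X * pd et \<phi> X) + (\<Sum>i\<in>UNIV. b i X * pd (ex i) \<phi> X)) = (LBINT X. f X * \<phi> X)"
    by simp
  then have "- (LBINT X. u X * pd et \<phi> X) + (\<Sum>i\<in>UNIV. LBINT X. b i X * pd (ex i) \<phi> X) - (LBINT X. f X * \<phi> X) = 0"
    using i1(1) i2(1) by simp
  then have "(LBINT X. pd et u X * \<phi> X) - (\<Sum>i\<in>UNIV. LBINT X. pd (ex i) (b i) X * \<phi> X) - (LBINT X. f X * \<phi> X) = 0"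
    using pdint[OF u et_Basis] pdint[OF b ex_Basis] by (simp add: sum_negf)
  then have "(LBINT X. pd et u X * \<phi> X - (\<Sum>i\<in>UNIV. pd (ex i) (b i) X * \<phi> X) - f X * \<phi> X) = 0"
    using i3(1) i4 i5 by simp
  moreover have "(\<lambda>X. pd et u X * \<phi> X - (\<Sum>i\<in>UNIV. pd (ex i) (b i) X * \<phi> X) - f X * \<phi> X) = (\<lambda>X. g X * \<phi> X)"
    by (simp add: fun_eq_iff g b_def left_diff_distrib sum_distrib_right)
  ultimately have int0: "(LBINT X. g X * \<phi> X) = 0" by simp
  have igs: "integrable lborel (\<lambda>X. (s * g X) * \<phi> X)" "continuous_on UNIV (\<lambda>X. (s * g X) * \<phi> X)"
    by (intro ci \<phi>c' cg \<phi>0; assumption)+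
  have "(s * g X2) * \<phi> X2 = 0"
  proof (rule continuous_nonneg_integral_0[OF igs(2)])
    show "0 \<le> s * g X * \<phi> X" for X using S(4)[of X] \<phi>0[of X] \<phi>n[of X] by (cases "X \<in> S") auto
    show "(LBINT X. s * g X * \<phi> X) = 0" using int0 by (simp add: mult.assoc)
  qed (rule igs(1))
  then show False using \<phi>X2 S(4)[OF X2] by auto
qed

lemma classical_solution:
  fixes u f :: "(real^'n) \<times> real \<Rightarrow> real" and j E :: "real^'n \<Rightarrow> real"
  assumes "open D" "smooth_on UNIV E" "smooth_on D u" "smooth_on D f"
    and "mollifier j" "weak_solution E D u f" and X: "X \<in> D"
  shows "pd et u X - (\<Sum>i\<in>UNIV. pd (ex i) (\<lambda>X. pd (axis i 1) E (grad_x u X)) X) = f X"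
proof (rule ccontr)
  assume "\<not> ?thesis"
  then have "pd et u X - (\<Sum>i\<in>UNIV. pd (ex i) (\<lambda>X. pd (axis i 1) E (grad_x u X)) X) - f X > 0 \<or>
    pd et u X - (\<Sum>i\<in>UNIV. pd (ex i) (\<lambda>X. pd (axis i 1) E (grad_x u X)) X) - f X < 0" by linarith
  then show False
    using classical_solution_aux[OF assms(1-6) refl X, of 1] classical_solution_aux[OF assms(1-6) refl X, of "-1"]
    by auto
qed

section \<open>The differentiated equation\<close>

lemma young_abs:
  fixes x y c :: real
  assumes "c > 0" shows "- (c * x\<^sup>2 + y\<^sup>2 / (4 * c)) \<le> x * y"
proof -
  have "0 \<le> (2 * c * x + y)\<^sup>2 / (4 * c)" using assms by simp
  also have "\<dots> = c * x\<^sup>2 + x * y + y\<^sup>2 / (4 * c)"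
    using assms by (simp add: power2_eq_square field_simps)
  finally show ?thesis by linarith
qed

text \<open>In the application \<open>s\<close> is H - l, \<open>A\<close> the Hessian of E at
  \<nabla>u, \<open>M j\<close> the gradient of the j-th derivative of u, and the right-hand side
  the divergence of s^3 \<eta> \<open>flux\<close>. The good terms are the forms in
  \<open>gH\<close> and in the \<open>M j\<close>. The trace of second derivatives is at most sqrt n
  times their norm, so f times the trace is absorbed by the form in the \<open>M j\<close>; f times
  \<open>gU \<bullet> gH\<close> uses up half of the form in \<open>gH\<close>. Both leave multiples
  of f^2 G / a, while the cut-off terms carry G^2.\<close>

lemma caccioppoli_pointwise:
  fixes A :: "real^'n^'n" and gH g\<eta> gU gG :: "real^'n" and M :: "'n \<Rightarrow> real^'n"
    and f s \<eta> G Gt Ht \<eta>t a lam L :: real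
  defines "B \<equiv> \<lambda>v w. v \<bullet> (A *v w)"
  assumes sym: "\<And>v w. B v w = B w v"
    and ell: "\<And>v. lam * a * (norm v)\<^sup>2 \<le> B v v" "\<And>v. B v v \<le> L * a * (norm v)\<^sup>2"
    and pos: "0 < lam" "0 < a" "0 < \<eta>" "\<eta> \<le> 1" "0 < s" "s \<le> \<eta> * G"
    and gH: "gH = \<eta> *\<^sub>R gG + G *\<^sub>R g\<eta>" and Ht: "Ht = \<eta> * Gt + \<eta>t * G"
    and gU: "(norm gU)\<^sup>2 \<le> G"
  shows "s^3 * Ht / 2 + s\<^sup>2 * (lam * a * (norm gH)\<^sup>2 / 2 - G\<^sup>2 * (\<bar>\<eta>t\<bar> / 2 + (5/2 * L + 1) * a * (norm g\<eta>)\<^sup>2)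
        - (CARD('n) / (4 * lam) + 9 / (2 * lam) + 1/4) * (f\<^sup>2 * G / a))
    \<le> s^3 * (f * (g\<eta> \<bullet> gU) + B g\<eta> gG / 2 + \<eta> * (f * (\<Sum>j\<in>UNIV. M j $ j) + (\<Sum>j\<in>UNIV. B (M j) (M j)) + Gt / 2))
      + 3 * s\<^sup>2 * (\<eta> * (f * (gU \<bullet> gH) + B gG gH / 2))"
proof -
  define n where "n = real CARD('n)"
  have n: "n > 0" by (simp add: n_def)
  have la: "lam * a > 0" using pos by simp
  have Badd: "B (v + w) z = B v z + B w z" "B z (v + w) = B z v + B z w" for v w z
    by (simp_all add: B_def inner_add_left inner_add_right matrix_vector_right_distrib)
  have Bsc: "B (c *\<^sub>R v) z = c * B v z" "B z (c *\<^sub>R v) = c * B z v" for c v z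
    by (simp_all add: B_def matrix_vector_mult_scaleR)
  have Bnn: "0 \<le> B v v" for v using ell(1)[of v] la by (smt (verit) mult_nonneg_nonneg zero_le_power2)
  have G: "G > 0" using pos by (smt (verit) zero_less_mult_pos)
  have "\<eta> * G \<le> 1 * G" by (rule mult_right_mono) (use pos G in auto)
  then have sG: "s \<le> G" using pos(6) by linarith
  define N where "N = B gH gH"
  define Ee where "Ee = B g\<eta> g\<eta>"
  define Cc where "Cc = B g\<eta> gH"
  have c1: "G * Cc \<le> N / 4 + G\<^sup>2 * Ee" "- (G * Cc) \<le> N / 4 + G\<^sup>2 * Ee"
  proof -
    have "B ((1/2) *\<^sub>R gH + c *\<^sub>R g\<eta>) ((1/2) *\<^sub>R gH + c *\<^sub>R g\<eta>) = N / 4 + c * Cc + c\<^sup>2 * Ee" for c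
      using sym[of gH g\<eta>] by (simp only: Badd Bsc N_def Ee_def Cc_def) (simp add: power2_eq_square algebra_simps)
    then have *: "0 \<le> N / 4 + c * Cc + c\<^sup>2 * Ee" for c using Bnn by metis
    show "G * Cc \<le> N / 4 + G\<^sup>2 * Ee" "- (G * Cc) \<le> N / 4 + G\<^sup>2 * Ee" using *[of G] *[of "- G"] by simp_all
  qed
  \<comment> \<open>\<open>gG\<close> is not controlled by the energy. Multiplied by \<eta> it
    equals \<open>gH\<close> minus G times \<open>g\<eta>\<close>, which eliminates it.\<close>
  have b1: "\<eta> * B gG gH = N - G * Cc"
  proof -
    have "N = \<eta> * B gG gH + G * Cc" unfolding N_def Cc_def by (subst (1) gH) (simp add: Badd Bsc)
    then show ?thesis by simp
  qed
  have b2: "\<eta> * B g\<eta> gG = Cc - G * Ee"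
    unfolding Cc_def Ee_def by (subst gH) (simp add: Badd Bsc)
  have Ee0: "Ee \<ge> 0" "N \<ge> 0" using Bnn by (auto simp: Ee_def N_def)
  have t2: "s^3 * (B g\<eta> gG / 2) \<ge> - (s\<^sup>2 * (N / 8 + G\<^sup>2 * Ee))"
  proof -
    \<comment> \<open>The identity \<open>b2\<close> costs a division by \<eta>, which degenerates
      at the boundary. It is harmless because s \<le> \<eta> G bounds \<open>\<sigma>\<close> by
      G.\<close>
    define \<sigma> where "\<sigma> = s / \<eta>"
    have \<sigma>: "0 < \<sigma>" "\<sigma> \<le> G" using pos by (auto simp: \<sigma>_def field_simps)
    have "- (N / 4 + 2 * G\<^sup>2 * Ee) \<le> \<sigma> * (Cc - G * Ee)"
    proof (cases "Cc - G * Ee \<ge> 0")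
      case True
      then have "0 \<le> \<sigma> * (Cc - G * Ee)" using \<sigma> by simp
      moreover have "0 \<le> N / 4 + 2 * G\<^sup>2 * Ee" using Ee0 by simp
      ultimately show ?thesis by linarith
    next
      case False
      then have "G * (Cc - G * Ee) \<le> \<sigma> * (Cc - G * Ee)" using \<sigma> by (intro mult_right_mono_neg) auto
      moreover have "G * (Cc - G * Ee) = G * Cc - G\<^sup>2 * Ee" by (simp add: power2_eq_square algebra_simps)
      ultimately show ?thesis using c1(2) by linarith
    qed
    then have "- (N / 4 + 2 * G\<^sup>2 * Ee) \<le> s * B g\<eta> gG"
      using pos by (simp add: \<sigma>_def b2[symmetric])
    then have "(s\<^sup>2 / 2) * (- (N / 4 + 2 * G\<^sup>2 * Ee)) \<le> (s\<^sup>2 / 2) * (s * B g\<eta> gG)"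
      by (rule mult_left_mono) simp
    then show ?thesis by (simp add: power2_eq_square power3_eq_cube algebra_simps)
  qed
  have t5: "3 * s\<^sup>2 * (\<eta> * (B gG gH / 2)) \<ge> s\<^sup>2 * (9/8 * N - 3/2 * (G\<^sup>2 * Ee))"
  proof -
    have "s\<^sup>2 * (9/8 * N - 3/2 * (G\<^sup>2 * Ee)) \<le> s\<^sup>2 * (3/2 * (N - G * Cc))"
    proof (rule mult_left_mono)
      show "9/8 * N - 3/2 * (G\<^sup>2 * Ee) \<le> 3/2 * (N - G * Cc)"
      proof -
        have "9/8 * N - 3/2 * y \<le> 3/2 * (N - x)" if "x \<le> N / 4 + y" for x y using that by simp
        then show ?thesis using c1(1) by blast
      qed
    qed simp
    also have "\<dots> = 3 * s\<^sup>2 * (\<eta> * (B gG gH / 2))" unfolding b1[symmetric] by simp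
    finally show ?thesis .
  qed
  have t3: "s^3 * (\<eta> * (f * (\<Sum>j\<in>UNIV. M j $ j) + (\<Sum>j\<in>UNIV. B (M j) (M j)))) \<ge> - (s\<^sup>2 * (n / (4 * lam) * (f\<^sup>2 * G / a)))"
  proof -
    define m2 where "m2 = (\<Sum>j\<in>UNIV. (norm (M j))\<^sup>2)"
    define tr where "tr = (\<Sum>j\<in>UNIV. M j $ j)"
    have "tr\<^sup>2 \<le> n * (\<Sum>j\<in>UNIV. (M j $ j)\<^sup>2)"
      using Cauchy_Schwarz_ineq_sum[of "\<lambda>_. 1" "\<lambda>j. M j $ j" UNIV] by (simp add: tr_def n_def)
    also have "\<dots> \<le> n * m2" unfolding m2_def
      using n component_le_norm_cart[of "M _"] by (intro mult_left_mono sum_mono) (auto simp: abs_le_square_iff[symmetric])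
    finally have tr: "tr\<^sup>2 / n \<le> m2" using n by (simp add: field_simps)
    have gen: "- h \<le> t + bb" if "x \<le> bb" "c \<le> x" "- (e + g) \<le> t" "g = h" "e = c" for h t bb x c e g :: real
      using that by linarith
    have "lam * a * m2 \<le> (\<Sum>j\<in>UNIV. B (M j) (M j))"
      unfolding m2_def sum_distrib_left by (intro sum_mono ell)
    moreover have "lam * a * (tr\<^sup>2 / n) \<le> lam * a * m2" using tr la by (intro mult_left_mono) auto
    moreover have "- ((lam * a / n) * tr\<^sup>2 + f\<^sup>2 / (4 * (lam * a / n))) \<le> tr * f"
      by (rule young_abs) (use la n in simp)
    moreover have "f\<^sup>2 / (4 * (lam * a / n)) = n * f\<^sup>2 / (4 * lam * a)" "(lam * a / n) * tr\<^sup>2 = lam * a * (tr\<^sup>2 / n)"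
      by (simp_all add: mult_ac)
    ultimately have "- (n * f\<^sup>2 / (4 * lam * a)) \<le> f * tr + (\<Sum>j\<in>UNIV. B (M j) (M j))"
      unfolding mult.commute[of f tr] by (rule gen)
    moreover have "s^3 * \<eta> > 0" using pos by simp
    ultimately have 1: "s^3 * \<eta> * (- (n * f\<^sup>2 / (4 * lam * a))) \<le> s^3 * \<eta> * (f * tr + (\<Sum>j\<in>UNIV. B (M j) (M j)))"
      by (intro mult_left_mono) auto
    have "s^3 * \<eta> = s\<^sup>2 * (s * \<eta>)" by (simp add: power2_eq_square power3_eq_cube)
    also have "\<dots> \<le> s\<^sup>2 * G"
    proof (rule mult_left_mono)
      have "s * \<eta> \<le> s * 1" by (rule mult_left_mono) (use pos in auto)
      then show "s * \<eta> \<le> G" using sG by linarith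
    qed simp
    finally have "s^3 * \<eta> * (n * f\<^sup>2 / (4 * lam * a)) \<le> s\<^sup>2 * G * (n * f\<^sup>2 / (4 * lam * a))"
      using n pos by (intro mult_right_mono) auto
    then have "- (s\<^sup>2 * (n / (4 * lam) * (f\<^sup>2 * G / a))) \<le> s^3 * \<eta> * (- (n * f\<^sup>2 / (4 * lam * a)))"
      by (simp add: mult_ac)
    then show ?thesis using 1 unfolding tr_def by (simp add: mult.assoc)
  qed
  have t4: "3 * s\<^sup>2 * (\<eta> * (f * (gU \<bullet> gH))) \<ge> - (s\<^sup>2 * (lam * a * (norm gH)\<^sup>2 / 2 + 9 / (2 * lam) * (f\<^sup>2 * G / a)))"
  proof -
    have "\<bar>\<eta> * (f * (gU \<bullet> gH))\<bar> \<le> 1 * (\<bar>f\<bar> * (norm gU * norm gH))"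
      unfolding abs_mult using pos Cauchy_Schwarz_ineq2[of gU gH] by (intro mult_mono) auto
    then have 1: "- (norm gH * (\<bar>f\<bar> * norm gU)) \<le> \<eta> * (f * (gU \<bullet> gH))" by (simp add: mult_ac)
    have "- ((lam * a / 6) * (norm gH)\<^sup>2 + (- (\<bar>f\<bar> * norm gU))\<^sup>2 / (4 * (lam * a / 6))) \<le> norm gH * (- (\<bar>f\<bar> * norm gU))"
      by (rule young_abs) (use la in simp)
    moreover have "(- (\<bar>f\<bar> * norm gU))\<^sup>2 / (4 * (lam * a / 6)) \<le> f\<^sup>2 * G / (4 * (lam * a / 6))"
      using gU pos by (intro divide_right_mono) (auto simp: power_mult_distrib intro!: mult_left_mono)
    ultimately have "- (lam * a * (norm gH)\<^sup>2 / 6 + f\<^sup>2 * G / (4 * (lam * a / 6))) \<le> \<eta> * (f * (gU \<bullet> gH))"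
      using 1 by simp
    then have "3 * s\<^sup>2 * (- (lam * a * (norm gH)\<^sup>2 / 6 + f\<^sup>2 * G / (4 * (lam * a / 6)))) \<le> 3 * s\<^sup>2 * (\<eta> * (f * (gU \<bullet> gH)))"
      by (intro mult_left_mono) auto
    moreover have "3 * s\<^sup>2 * (- (lam * a * (norm gH)\<^sup>2 / 6 + f\<^sup>2 * G / (4 * (lam * a / 6))))
      = - (s\<^sup>2 * (lam * a * (norm gH)\<^sup>2 / 2 + 9 / (2 * lam) * (f\<^sup>2 * G / a)))"
      using pos by (simp add: field_simps)
    ultimately show ?thesis by linarith
  qed
  have t1: "s^3 * (f * (g\<eta> \<bullet> gU)) \<ge> - (s\<^sup>2 * (a * (G\<^sup>2 * (norm g\<eta>)\<^sup>2) + 1/4 * (f\<^sup>2 * G / a)))"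
  proof -
    have "\<bar>s * (f * (g\<eta> \<bullet> gU))\<bar> \<le> G * (\<bar>f\<bar> * (norm g\<eta> * norm gU))"
      unfolding abs_mult using pos sG Cauchy_Schwarz_ineq2[of g\<eta> gU] by (intro mult_mono) auto
    then have 1: "- ((G * norm g\<eta>) * (\<bar>f\<bar> * norm gU)) \<le> s * (f * (g\<eta> \<bullet> gU))" by (simp add: mult_ac)
    have "- (a * (G * norm g\<eta>)\<^sup>2 + (- (\<bar>f\<bar> * norm gU))\<^sup>2 / (4 * a)) \<le> (G * norm g\<eta>) * (- (\<bar>f\<bar> * norm gU))"
      by (rule young_abs) (use pos in simp)
    moreover have "(- (\<bar>f\<bar> * norm gU))\<^sup>2 / (4 * a) \<le> f\<^sup>2 * G / (4 * a)"
      using gU pos by (intro divide_right_mono) (auto simp: power_mult_distrib intro!: mult_left_mono)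
    ultimately have "- (a * (G * norm g\<eta>)\<^sup>2 + f\<^sup>2 * G / (4 * a)) \<le> s * (f * (g\<eta> \<bullet> gU))"
      using 1 by simp
    then have "s\<^sup>2 * (- (a * (G * norm g\<eta>)\<^sup>2 + f\<^sup>2 * G / (4 * a))) \<le> s\<^sup>2 * (s * (f * (g\<eta> \<bullet> gU)))"
      by (intro mult_left_mono) auto
    then show ?thesis by (simp add: power2_eq_square power3_eq_cube algebra_simps)
  qed
  have t6: "s^3 * (\<eta> * (Gt / 2)) \<ge> s^3 * Ht / 2 - s\<^sup>2 * (G\<^sup>2 * (\<bar>\<eta>t\<bar> / 2))"
  proof -
    have "s^3 * (\<eta>t * G) \<le> s^3 * (\<bar>\<eta>t\<bar> * G)" using pos G by (intro mult_left_mono mult_right_mono) auto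
    also have "\<dots> = s\<^sup>2 * (s * (\<bar>\<eta>t\<bar> * G))" by (simp add: power2_eq_square power3_eq_cube)
    also have "\<dots> \<le> s\<^sup>2 * (G * (\<bar>\<eta>t\<bar> * G))" using sG G by (intro mult_left_mono mult_right_mono) auto
    finally have "s^3 * (\<eta>t * G) \<le> s\<^sup>2 * (G\<^sup>2 * \<bar>\<eta>t\<bar>)" by (simp add: power2_eq_square mult_ac)
    moreover have "s^3 * (\<eta> * (Gt / 2)) = s^3 * Ht / 2 - s^3 * (\<eta>t * G) / 2" unfolding Ht by (simp add: algebra_simps)
    ultimately show ?thesis by simp
  qed
  \<comment> \<open>The budget: \<open>t5\<close> yields 9/8 of N and \<open>t2\<close> takes 1/8.
    Of the remaining N \<ge> lam a |gH|^2 one half pays for \<open>t4\<close> and the other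
    survives. The terms with \<open>Ee\<close> add up to 3/2 + 1, whence 5/2 L; the extra 1 next to
    it comes from \<open>t1\<close>. The three parts of the coefficient of f^2 G / a come from
    \<open>t3\<close>, \<open>t4\<close> and \<open>t1\<close>.\<close>
  have N: "s\<^sup>2 * N \<ge> s\<^sup>2 * (lam * a * (norm gH)\<^sup>2)" unfolding N_def by (intro mult_left_mono ell) auto
  have E2: "s\<^sup>2 * (G\<^sup>2 * Ee) \<le> s\<^sup>2 * (G\<^sup>2 * (L * a * (norm g\<eta>)\<^sup>2))" unfolding Ee_def by (intro mult_left_mono ell) auto
  define X1 where "X1 = s\<^sup>2 * (lam * a * (norm gH)\<^sup>2)"
  define X2 where "X2 = s\<^sup>2 * (G\<^sup>2 * (L * a * (norm g\<eta>)\<^sup>2))"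
  define X3 where "X3 = s\<^sup>2 * (a * (G\<^sup>2 * (norm g\<eta>)\<^sup>2))"
  define X4 where "X4 = s\<^sup>2 * (f\<^sup>2 * G / a)"
  define X5 where "X5 = s\<^sup>2 * (G\<^sup>2 * \<bar>\<eta>t\<bar>)"
  define X6 where "X6 = s\<^sup>2 * N"
  define X7 where "X7 = s\<^sup>2 * (G\<^sup>2 * Ee)"
  have rhs: "s^3 * (f * (g\<eta> \<bullet> gU) + B g\<eta> gG / 2 + \<eta> * (f * (\<Sum>j\<in>UNIV. M j $ j) + (\<Sum>j\<in>UNIV. B (M j) (M j)) + Gt / 2))
      + 3 * s\<^sup>2 * (\<eta> * (f * (gU \<bullet> gH) + B gG gH / 2))
    = s^3 * (f * (g\<eta> \<bullet> gU)) + s^3 * (B g\<eta> gG / 2)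
      + s^3 * (\<eta> * (f * (\<Sum>j\<in>UNIV. M j $ j) + (\<Sum>j\<in>UNIV. B (M j) (M j)))) + s^3 * (\<eta> * (Gt / 2))
      + 3 * s\<^sup>2 * (\<eta> * (f * (gU \<bullet> gH))) + 3 * s\<^sup>2 * (\<eta> * (B gG gH / 2))"
    by (simp add: algebra_simps)
  have lhs: "s^3 * Ht / 2 + s\<^sup>2 * (lam * a * (norm gH)\<^sup>2 / 2 - G\<^sup>2 * (\<bar>\<eta>t\<bar> / 2 + (5/2 * L + 1) * a * (norm g\<eta>)\<^sup>2)
        - (n / (4 * lam) + 9 / (2 * lam) + 1/4) * (f\<^sup>2 * G / a))
     = s^3 * Ht / 2 + X1 / 2 - X5 / 2 - 5/2 * X2 - X3 - n / (4 * lam) * X4 - 9 / (2 * lam) * X4 - X4 / 4"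
    by (simp add: X1_def X2_def X3_def X4_def X5_def algebra_simps)
  have T: "s^3 * (B g\<eta> gG / 2) \<ge> - (X6 / 8 + X7)"
    "3 * s\<^sup>2 * (\<eta> * (B gG gH / 2)) \<ge> 9/8 * X6 - 3/2 * X7"
    "s^3 * (\<eta> * (f * (\<Sum>j\<in>UNIV. M j $ j) + (\<Sum>j\<in>UNIV. B (M j) (M j)))) \<ge> - (n / (4 * lam) * X4)"
    "3 * s\<^sup>2 * (\<eta> * (f * (gU \<bullet> gH))) \<ge> - (X1 / 2 + 9 / (2 * lam) * X4)"
    "s^3 * (f * (g\<eta> \<bullet> gU)) \<ge> - (X3 + X4 / 4)"
    "s^3 * (\<eta> * (Gt / 2)) \<ge> s^3 * Ht / 2 - X5 / 2"
    using t1 t2 t3 t4 t5 t6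
    by (simp_all add: X1_def X2_def X3_def X4_def X5_def X6_def X7_def algebra_simps)
  show ?thesis unfolding rhs unfolding n_def[symmetric] lhs
    using T N[folded X1_def X6_def] E2[folded X2_def X7_def] by linarith
qed

text \<open>At zero the difference quotient is at most |h|^(m - 1), which tends to 0 as soon as m
  \<ge> 2. Hence the powers 2, 3 and 4 of truncations can be differentiated classically.\<close>

lemma max_0_power_has_derivative:
  assumes "2 \<le> m"
  shows "((\<lambda>x::real. max 0 x ^ m) has_real_derivative real m * max 0 x ^ (m - 1)) (at x)"
proof -
  consider "x > 0" | "x < 0" | "x = 0" by linarith
  then show ?thesis
  proof cases
    case 1
    have "((\<lambda>x::real. x ^ m) has_real_derivative real m * max 0 x ^ (m - 1)) (at x)"
      using DERIV_pow[of m x] 1 by simp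
    then show ?thesis
      by (rule has_field_derivative_transform_within_open[of _ _ _ "{0<..}"]) (use 1 in auto)
  next
    case 2
    have "((\<lambda>x::real. 0) has_real_derivative real m * max 0 x ^ (m - 1)) (at x)"
      using 2 assms by (simp add: max_absorb1 zero_power)
    then show ?thesis
      by (rule has_field_derivative_transform_within_open[of _ _ _ "{..<0}"]) (use 2 assms in \<open>auto simp: max_absorb1\<close>)
  next
    case 3
    have "((\<lambda>h. (max 0 h ^ m - 0) / h) \<longlongrightarrow> 0) (at (0::real))"
    proof (rule Lim_null_comparison[of _ "\<lambda>h. \<bar>h\<bar> ^ (m - 1)"])
      have "\<bar>max 0 h ^ m / h\<bar> \<le> \<bar>h\<bar> ^ (m - 1)" for h :: real
        using assms by (cases m) (auto simp: max_def abs_mult)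
      then show "\<forall>\<^sub>F h in at 0. norm ((max 0 h ^ m - 0) / h) \<le> \<bar>h::real\<bar> ^ (m - 1)"
        by (intro always_eventually) simp
      show "((\<lambda>h::real. \<bar>h\<bar> ^ (m - 1)) \<longlongrightarrow> 0) (at 0)"
        using assms by (auto intro!: tendsto_eq_intros)
    qed
    then show ?thesis using 3 assms by (simp add: has_field_derivative_iff zero_power)
  qed
qed

section \<open>The equation for \<open>G\<close>, the square of V\<close>

locale parabolic_eq =
  fixes D :: "((real^'n) \<times> real) set" and E :: "real^'n \<Rightarrow> real" and u f :: "(real^'n) \<times> real \<Rightarrow> real"
    and p lam L eps :: real
  assumes D: "open D" and E: "smooth_on UNIV E" and u: "smooth_on D u" and f: "smooth_on D f"
    and pde: "\<And>X. X \<in> D \<Longrightarrow> pd et u X - (\<Sum>i\<in>UNIV. pd (ex i) (\<lambda>X. pd (axis i 1) E (grad_x u X)) X) = f X"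
    and lam: "0 < lam" and eps: "0 < eps"
    and ell: "\<And>z v. 1 \<le> eps\<^sup>2 + (norm z)\<^sup>2 \<Longrightarrow>
       lam * (eps\<^sup>2 + (norm z)\<^sup>2) powr (p/2 - 1) * (norm v)\<^sup>2 \<le> hessq E z v \<and>
       hessq E z v \<le> L * (eps\<^sup>2 + (norm z)\<^sup>2) powr (p/2 - 1) * (norm v)\<^sup>2"
begin

definition b :: "'n \<Rightarrow> (real^'n) \<times> real \<Rightarrow> real" where "b i X = pd (axis i 1) E (grad_x u X)"
definition G :: "(real^'n) \<times> real \<Rightarrow> real" where "G X = eps\<^sup>2 + (\<Sum>i\<in>UNIV. (pd (ex i) u X)\<^sup>2)"
text \<open>This is f \<nabla>u plus half of A \<nabla>G, with A the Hessian of E at \<nabla>u; see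
  \<open>flux_eq\<close>. Written with derivatives of \<open>b\<close>, its divergence contains the
  equation differentiated in x_j and multiplied by the j-th derivative of u.\<close>

definition flux :: "'n \<Rightarrow> (real^'n) \<times> real \<Rightarrow> real" where
  "flux i X = f X * pd (ex i) u X + (\<Sum>j\<in>UNIV. pd (ex j) u X * pd (ex j) (b i) X)"

lemma G_eq: "G X = eps\<^sup>2 + (norm (grad_x u X))\<^sup>2"
  unfolding power2_norm_eq_inner inner_vec_def by (simp add: G_def grad_x_nth power2_eq_square)

lemma G_pos: "G X > 0" using eps by (simp add: G_eq add_pos_nonneg)

lemma b_smooth: "smooth_on D (b i)"
  unfolding b_def[abs_def]
proof (rule smooth_on_compose[OF D])
  show "smooth_on D (\<lambda>x. grad_x u x $ k)" for k
    unfolding grad_x_nth by (rule smooth_on_pd[OF u]) simp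
  show "smooth_on UNIV (pd (axis i 1) E)" by (rule smooth_on_pd[OF E]) (simp add: axis_in_Basis_iff)
qed

lemma G_smooth: "smooth_on D G"
  unfolding G_def[abs_def] by (intro smooth_on_add smooth_on_const smooth_on_sum smooth_on_power smooth_on_pd D u) simp

lemma flux_smooth: "smooth_on D (flux i)"
  unfolding flux_def[abs_def] by (intro smooth_on_add smooth_on_mult smooth_on_sum smooth_on_pd D u f b_smooth) simp_all

lemma pd_G: "X \<in> D \<Longrightarrow> pd e G X = 2 * (\<Sum>j\<in>UNIV. pd (ex j) u X * pd e (pd (ex j) u) X)"
proof -
  assume X: "X \<in> D"
  have d: "pd (ex j) u differentiable at X" for j by (rule smooth_on_differentiable[OF smooth_on_pd[OF u] X]) simp
  have "(G has_derivative (\<lambda>e. 0 + (\<Sum>j\<in>UNIV. of_nat 2 * (pd e (pd (ex j) u) X) * (pd (ex j) u X) ^ (2 - 1)))) (at X)"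
    unfolding G_def[abs_def]
    by (intro has_derivative_add has_derivative_sum has_derivative_const has_derivative_power has_derivative_pd d)
  then show ?thesis by (simp add: pd_eqI sum_distrib_left mult_ac)
qed

lemma pd_b: "X \<in> D \<Longrightarrow> pd e (b i) X = (\<Sum>m\<in>UNIV. hess E (grad_x u X) $ m $ i * pd e (pd (ex m) u) X)"
proof -
  assume X: "X \<in> D"
  have 1: "(\<lambda>X. grad_x u X $ m) = pd (ex m) u" for m by (simp add: fun_eq_iff grad_x_nth)
  have "(b i has_derivative (\<lambda>h. \<Sum>m\<in>UNIV. pd (axis m 1) (pd (axis i 1) E) (grad_x u X) * pd h (\<lambda>X. grad_x u X $ m) X)) (at X)"
    unfolding b_def[abs_def]
  proof (rule has_derivative_compose_vec)
    show "(\<lambda>X. grad_x u X $ m) differentiable at X" for m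
      unfolding 1 by (rule smooth_on_differentiable[OF smooth_on_pd[OF u] X]) simp
    show "pd (axis i 1) E differentiable at (grad_x u X)"
      by (rule smooth_on_differentiable[OF smooth_on_pd[OF E]]) (auto simp: axis_in_Basis_iff)
  qed
  then show ?thesis by (simp add: pd_eqI hess_nth 1)
qed

lemma hess_sym: "hess E z $ i $ k = hess E z $ k $ i"
  unfolding hess_nth by (rule pd_commute[OF open_UNIV _ E]) (auto simp: axis_in_Basis_iff)

lemma hess_bilinear_sym: "v \<bullet> (hess E z *v w) = w \<bullet> (hess E z *v v)"
proof -
  have "v \<bullet> (hess E z *v w) = (\<Sum>i\<in>UNIV. \<Sum>k\<in>UNIV. v $ i * hess E z $ i $ k * w $ k)"
    by (simp add: inner_vec_def matrix_vector_mult_def sum_distrib_left mult.assoc)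
  also have "\<dots> = (\<Sum>k\<in>UNIV. \<Sum>i\<in>UNIV. v $ i * hess E z $ i $ k * w $ k)" by (rule sum.swap)
  also have "\<dots> = (\<Sum>k\<in>UNIV. \<Sum>i\<in>UNIV. w $ k * hess E z $ k $ i * v $ i)"
    by (intro sum.cong refl) (simp add: hess_sym[of z] mult_ac)
  also have "\<dots> = w \<bullet> (hess E z *v v)"
    by (simp add: inner_vec_def matrix_vector_mult_def sum_distrib_left mult.assoc)
  finally show ?thesis .
qed

lemma uxx_sym: "X \<in> D \<Longrightarrow> pd (ex i) (pd (ex j) u) X = pd (ex j) (pd (ex i) u) X"
  by (rule pd_commute[OF D _ u]) simp_all

text \<open>Symmetry of the Hessian of E and of the second derivatives of u turns the derivative of
  the j-th component along x_m into that along x_j; the sum over j is then half of \<nabla>G by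
  \<open>pd_G\<close>.\<close>

lemma drift_eq:
  assumes X: "X \<in> D"
  shows "(\<Sum>j\<in>UNIV. pd (ex j) u X * pd (ex j) (b i) X) = (hess E (grad_x u X) *v grad_x G X) $ i / 2"
proof -
  let ?A = "hess E (grad_x u X)"
  have "(\<Sum>j\<in>UNIV. pd (ex j) u X * pd (ex j) (b i) X)
    = (\<Sum>j\<in>UNIV. \<Sum>m\<in>UNIV. ?A $ i $ m * (pd (ex j) u X * pd (ex m) (pd (ex j) u) X))"
    unfolding pd_b[OF X] sum_distrib_left
    by (intro sum.cong refl) (simp add: hess_sym[of _ _ i] uxx_sym[OF X, of _ _] mult_ac)
  also have "\<dots> = (\<Sum>m\<in>UNIV. \<Sum>j\<in>UNIV. ?A $ i $ m * (pd (ex j) u X * pd (ex m) (pd (ex j) u) X))"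
    by (rule sum.swap)
  also have "\<dots> = (\<Sum>m\<in>UNIV. ?A $ i $ m * (grad_x G X $ m / 2))"
    by (simp add: grad_x_nth pd_G[OF X] sum_distrib_left[symmetric])
  finally show ?thesis by (simp add: matrix_vector_mult_def sum_divide_distrib)
qed

lemma flux_eq:
  assumes "X \<in> D"
  shows "flux i X = f X * pd (ex i) u X + (hess E (grad_x u X) *v grad_x G X) $ i / 2"
  using drift_eq[OF assms] by (simp add: flux_def)

text \<open>The derivatives of \<^term>\<open>f\<close> cancel: they come once from the product rule for the flux and once,
  with the opposite sign, from the differentiated equation.\<close>

lemma div_flux:
  assumes X: "X \<in> D"
  shows "(\<Sum>i\<in>UNIV. pd (ex i) (flux i) X) = f X * (\<Sum>j\<in>UNIV. pd (ex j) (pd (ex j) u) X)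
    + (\<Sum>j\<in>UNIV. grad_x (pd (ex j) u) X \<bullet> (hess E (grad_x u X) *v grad_x (pd (ex j) u) X)) + pd et G X / 2"
proof -
  let ?A = "hess E (grad_x u X)"
  have du: "pd (ex j) u differentiable at X" "f differentiable at X" "pd (ex j) (b i) differentiable at X" for j i
    by (intro smooth_on_differentiable[OF _ X] smooth_on_pd u f b_smooth; simp)+
  have 1: "pd (ex i) (flux i) X = f X * pd (ex i) (pd (ex i) u) X + pd (ex i) f X * pd (ex i) u X
     + (\<Sum>j\<in>UNIV. pd (ex j) u X * pd (ex i) (pd (ex j) (b i)) X + pd (ex i) (pd (ex j) u) X * pd (ex j) (b i) X)" for i
    unfolding flux_def[abs_def]
    by (subst pd_add, (intro differentiable_mult differentiable_sum du finite ballI)+)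
      (simp add: pd_mult du pd_sum differentiable_mult)
  have 2: "(\<Sum>i\<in>UNIV. pd (ex j) (pd (ex i) (b i)) X) = pd et (pd (ex j) u) X - pd (ex j) f X" for j
  proof -
    have db: "pd (ex i) (b i) differentiable at Y" "pd et u differentiable at Y" "f differentiable at Y" if "Y \<in> D" for Y i
      by (intro smooth_on_differentiable[OF _ that] smooth_on_pd u b_smooth f; simp)+
    have "(\<Sum>i\<in>UNIV. pd (ex j) (pd (ex i) (b i)) X) = pd (ex j) (\<lambda>X. \<Sum>i\<in>UNIV. pd (ex i) (b i) X) X"
      by (rule pd_sum[symmetric]) (rule db[OF X])
    also have "\<dots> = pd (ex j) (\<lambda>X. pd et u X - f X) X"
    proof (rule pd_cong_open[OF D X])
      show "(\<Sum>i\<in>UNIV. pd (ex i) (b i) Y) = pd et u Y - f Y" if "Y \<in> D" for Y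
        using pde[OF that] unfolding b_def[abs_def] by simp
      show "(\<lambda>X. \<Sum>i\<in>UNIV. pd (ex i) (b i) X) differentiable at X"
        by (intro differentiable_sum finite ballI db[OF X])
    qed
    also have "\<dots> = pd (ex j) (pd et u) X - pd (ex j) f X"
      by (rule pd_diff[OF db(2)[OF X] db(3)[OF X]])
    also have "pd (ex j) (pd et u) X = pd et (pd (ex j) u) X"
      by (rule pd_commute[OF D X u]) simp_all
    finally show ?thesis .
  qed
  have "(\<Sum>i\<in>UNIV. \<Sum>j\<in>UNIV. pd (ex j) u X * pd (ex i) (pd (ex j) (b i)) X)
     = (\<Sum>j\<in>UNIV. pd (ex j) u X * (\<Sum>i\<in>UNIV. pd (ex j) (pd (ex i) (b i)) X))"
    unfolding sum_distrib_left
    by (subst sum.swap) (intro sum.cong refl arg_cong2[where f="(*)"] pd_commute[OF D X b_smooth]; simp)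
  also have "\<dots> = pd et G X / 2 - (\<Sum>j\<in>UNIV. pd (ex j) u X * pd (ex j) f X)"
    unfolding 2 pd_G[OF X] by (simp add: right_diff_distrib sum_subtractf)
  finally have 3: "(\<Sum>i\<in>UNIV. \<Sum>j\<in>UNIV. pd (ex j) u X * pd (ex i) (pd (ex j) (b i)) X)
     = pd et G X / 2 - (\<Sum>j\<in>UNIV. pd (ex j) u X * pd (ex j) f X)" .
  have "(\<Sum>i\<in>UNIV. \<Sum>j\<in>UNIV. pd (ex i) (pd (ex j) u) X * pd (ex j) (b i) X)
     = (\<Sum>j\<in>UNIV. \<Sum>i\<in>UNIV. pd (ex i) (pd (ex j) u) X * pd (ex j) (b i) X)" by (rule sum.swap)
  also have "\<dots> = (\<Sum>j\<in>UNIV. grad_x (pd (ex j) u) X \<bullet> (?A *v grad_x (pd (ex j) u) X))"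
    unfolding pd_b[OF X] inner_vec_def matrix_vector_mult_def grad_x_nth
    by (intro sum.cong refl) (simp add: grad_x_nth hess_sym[of _ _] uxx_sym[OF X, of _ _])
  finally have 4: "(\<Sum>i\<in>UNIV. \<Sum>j\<in>UNIV. pd (ex i) (pd (ex j) u) X * pd (ex j) (b i) X)
     = (\<Sum>j\<in>UNIV. grad_x (pd (ex j) u) X \<bullet> (?A *v grad_x (pd (ex j) u) X))" .
  show ?thesis unfolding 1
    by (simp add: sum.distrib 3 4 sum_distrib_left mult.commute)
qed

end

section \<open>Truncation on a cylinder\<close>

lemma sum_Basis_vec: "(\<Sum>b\<in>(Basis :: (real^'n) set). F b) = (\<Sum>i\<in>UNIV. F (axis i 1))"
proof -
  have B: "(Basis :: (real^'n) set) = (\<lambda>i. axis i 1) ` UNIV" by (auto simp: Basis_vec_def)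
  show ?thesis unfolding B by (subst sum.reindex) (auto simp: inj_on_def axis_eq_axis)
qed

text \<open>The divergence theorem and the Sobolev inequality are used at fixed time, so space-time
  derivatives have to be read as derivatives on slices.\<close>

lemma slice_has_derivative:
  fixes g :: "(real^'n) \<times> real \<Rightarrow> real"
  assumes "g differentiable (at (x, t))"
  shows "((\<lambda>x. g (x, t)) has_derivative (\<lambda>h. pd (h, 0) g (x, t))) (at x)"
proof -
  have "((\<lambda>x. (x, t)) has_derivative (\<lambda>h. (h, 0))) (at x)"
    by (auto intro!: derivative_eq_intros)
  from has_derivative_compose[OF this has_derivative_pd[OF assms]] show ?thesis by simp
qed

lemma pd_slice:
  fixes g :: "(real^'n) \<times> real \<Rightarrow> real"
  assumes "g differentiable (at (x, t))"
  shows "pd (axis i 1) (\<lambda>x. g (x, t)) x = pd (ex i) g (x, t)"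
  using pd_eqI[OF slice_has_derivative[OF assms]] by (simp add: ex_def)

text \<open>The margin \<open>io\<close> beyond the top time \<open>t1\<close> lies inside
  \<open>D\<close>, so that at \<open>t1\<close> itself all derivatives are ordinary two-sided
  ones.\<close>

locale parabolic_cyl = parabolic_eq D E u f p lam L eps
  for D :: "((real^'n) \<times> real) set" and E u f p lam L eps +
  fixes x1 :: "real^'n" and t1 r io :: real
  assumes r: "0 < r" and io: "0 < io" and cyl_sub: "cball x1 r \<times> {t1 - r\<^sup>2..t1 + io} \<subseteq> D" and L: "0 \<le> L"
begin

text \<open>As \<open>eta\<close> vanishes on the lateral and the bottom boundary, the set \<open>{H \<ge> l}\<close> stays away from them, and
  truncations of \<open>H\<close> at height \<open>l\<close> can be extended by zero. Its contact with the top face is harmless: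
  that face lies at time \<open>t1 + io\<close>, outside \<open>Uo\<close>.\<close>

definition eta :: "(real^'n) \<times> real \<Rightarrow> real" where
  "eta X = (1 - (\<Sum>i\<in>UNIV. (fst X $ i - x1 $ i)\<^sup>2) / r\<^sup>2) * (1 - (t1 - snd X) / r\<^sup>2)"
definition H :: "(real^'n) \<times> real \<Rightarrow> real" where "H X = eta X * G X"
definition C :: "((real^'n) \<times> real) set" where "C = ball x1 r \<times> {t1 - r\<^sup>2<..<t1 + io}"
definition Uo :: "((real^'n) \<times> real) set" where "Uo = {X. snd X < t1 + io}"
definition Z :: "real \<Rightarrow> ((real^'n) \<times> real) set" where
  "Z l = {X \<in> cball x1 r \<times> {t1 - r\<^sup>2..t1 + io}. l \<le> H X}"
definition lev :: "real \<Rightarrow> ((real^'n) \<times> real) set" where "lev l = {X\<in>C. snd X \<le> t1 \<and> l < H X}"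
text \<open>One shape for all truncated quantities: a derivative of such a function is a sum of two
  of the same shape, with powers m and m - 1.\<close>

definition ext :: "real \<Rightarrow> nat \<Rightarrow> ((real^'n) \<times> real \<Rightarrow> real) \<Rightarrow> (real^'n) \<times> real \<Rightarrow> real" where
  "ext l m g X = (if X \<in> C then g X * max 0 (H X - l) ^ m else 0)"

lemma r2: "r\<^sup>2 > 0" using r by simp

lemma norm_sum: "(\<Sum>i\<in>UNIV. (x $ i - x1 $ i)\<^sup>2) = (dist x1 x)\<^sup>2"
  unfolding dist_norm power2_norm_eq_inner inner_vec_def
  by (simp add: power2_eq_square) (rule sum.cong; simp add: algebra_simps)

lemma eta_has_derivative:
  "(eta has_derivative (\<lambda>h. (1 - (\<Sum>i\<in>UNIV. (fst X $ i - x1 $ i)\<^sup>2) / r\<^sup>2) * (snd h / r\<^sup>2)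
     + (- (\<Sum>i\<in>UNIV. 2 * fst h $ i * (fst X $ i - x1 $ i)) / r\<^sup>2) * (1 - (t1 - snd X) / r\<^sup>2))) (at X)"
proof -
  have 1: "((\<lambda>X::(real^'n) \<times> real. fst X $ i) has_derivative (\<lambda>h. fst h $ i)) (at X)" for i
    by (intro bounded_linear_imp_has_derivative bounded_linear_compose[OF bounded_linear_vec_nth bounded_linear_fst])
  have 2: "((\<lambda>X::(real^'n) \<times> real. (fst X $ i - x1 $ i)\<^sup>2) has_derivative (\<lambda>h. 2 * fst h $ i * (fst X $ i - x1 $ i))) (at X)" for i
    using has_derivative_power[OF has_derivative_diff[OF 1[of i] has_derivative_const[of "x1 $ i"]], of 2] by simp
  show ?thesis unfolding eta_def[abs_def]
    by (rule has_derivative_eq_rhs[OF has_derivative_mult[OF has_derivative_diff[OF has_derivative_const bounded_linear.has_derivative[OF bounded_linear_divide, OF has_derivative_sum[OF 2]]]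
        has_derivative_diff[OF has_derivative_const bounded_linear.has_derivative[OF bounded_linear_divide, OF has_derivative_diff[OF has_derivative_const has_derivative_snd[OF has_derivative_ident]]]]]])
      (simp add: fun_eq_iff)
qed

lemma eta_smooth: "smooth_on UNIV eta"
proof -
  have 1: "bounded_linear (\<lambda>X::(real^'n) \<times> real. fst X $ i)" for i
    by (rule bounded_linear_compose[OF bounded_linear_vec_nth bounded_linear_fst])
  have "smooth_on UNIV (\<lambda>X. (1 - (\<Sum>i\<in>UNIV. (fst X $ i - x1 $ i)\<^sup>2) * (1 / r\<^sup>2)) * (1 - (t1 - snd X) * (1 / r\<^sup>2)))"
    by (intro smooth_on_mult smooth_on_diff smooth_on_const smooth_on_sum smooth_on_power open_UNIV
        smooth_on_linear 1 bounded_linear_snd)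
  then show ?thesis by (simp add: eta_def[abs_def])
qed

lemma pd_eta: "pd (ex i) eta X = - (2 * (fst X $ i - x1 $ i)) / r\<^sup>2 * (1 - (t1 - snd X) / r\<^sup>2)"
  "pd et eta X = (1 - (dist x1 (fst X))\<^sup>2 / r\<^sup>2) / r\<^sup>2"
proof -
  have "(\<Sum>k\<in>UNIV. 2 * (axis i 1 :: real^'n) $ k * (fst X $ k - x1 $ k)) = (\<Sum>k\<in>UNIV. if k = i then 2 * (fst X $ i - x1 $ i) else 0)"
    by (rule sum.cong) (auto simp: axis_def)
  then show "pd (ex i) eta X = - (2 * (fst X $ i - x1 $ i)) / r\<^sup>2 * (1 - (t1 - snd X) / r\<^sup>2)"
    unfolding pd_eqI[OF eta_has_derivative] by (simp add: ex_def)
  show "pd et eta X = (1 - (dist x1 (fst X))\<^sup>2 / r\<^sup>2) / r\<^sup>2"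
    unfolding pd_eqI[OF eta_has_derivative] by (simp add: et_def norm_sum)
qed

lemma eta_bounds:
  assumes "X \<in> C" "snd X \<le> t1"
  shows "0 < eta X" "eta X \<le> 1" "(norm (grad_x eta X))\<^sup>2 \<le> 4 / r\<^sup>2" "\<bar>pd et eta X\<bar> \<le> 1 / r\<^sup>2"
proof -
  define d where "d = (dist x1 (fst X))\<^sup>2 / r\<^sup>2"
  define \<tau> where "\<tau> = (t1 - snd X) / r\<^sup>2"
  have "dist x1 (fst X) < r" using assms by (auto simp: C_def)
  then have "(dist x1 (fst X))\<^sup>2 < r\<^sup>2" using r by (intro power_strict_mono) auto
  then have d: "0 \<le> d" "d < 1" using r2 by (auto simp: d_def)
  have \<tau>: "0 \<le> \<tau>" "\<tau> < 1" using assms r2 by (auto simp: \<tau>_def C_def)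
  have eta: "eta X = (1 - d) * (1 - \<tau>)" by (simp add: eta_def norm_sum d_def \<tau>_def)
  show "0 < eta X" unfolding eta using d \<tau> by simp
  show "eta X \<le> 1" unfolding eta using d \<tau> by (intro mult_le_one) auto
  have "\<bar>1 - d\<bar> \<le> 1" using d by auto
  then show "\<bar>pd et eta X\<bar> \<le> 1 / r\<^sup>2" unfolding pd_eta d_def[symmetric] using r2 by (simp add: divide_right_mono)
  have "(norm (grad_x eta X))\<^sup>2 = (\<Sum>i\<in>UNIV. (pd (ex i) eta X)\<^sup>2)"
    unfolding power2_norm_eq_inner inner_vec_def grad_x_nth by (simp add: power2_eq_square)
  also have "\<dots> = (\<Sum>i\<in>UNIV. (4 / r\<^sup>2 * (1 - \<tau>)\<^sup>2 / r\<^sup>2) * (fst X $ i - x1 $ i)\<^sup>2)"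
    unfolding pd_eta \<tau>_def[symmetric] by (rule sum.cong) (auto simp: power2_eq_square field_simps)
  also have "\<dots> = 4 / r\<^sup>2 * ((1 - \<tau>)\<^sup>2 * d)"
    unfolding sum_distrib_left[symmetric] norm_sum d_def by simp
  also have "\<dots> \<le> 4 / r\<^sup>2 * (1 * 1)"
    using d \<tau> by (intro mult_left_mono mult_mono) (auto simp: power_le_one)
  finally show "(norm (grad_x eta X))\<^sup>2 \<le> 4 / r\<^sup>2" by simp
qed

lemma C_sub: "C \<subseteq> D"
  using cyl_sub by (auto simp: C_def subset_iff)

lemma open_C: "open C" by (simp add: C_def open_Times)

lemma H_smooth: "smooth_on D H"
  unfolding H_def[abs_def] by (intro smooth_on_mult D G_smooth smooth_on_subset[OF eta_smooth]) simp

lemma closed_Z: "closed (Z l)"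
proof -
  have "continuous_on (cball x1 r \<times> {t1 - r\<^sup>2..t1 + io}) H"
    using smooth_on_continuous[OF H_smooth] cyl_sub continuous_on_subset by blast
  moreover have "closed (cball x1 r \<times> {t1 - r\<^sup>2..t1 + io})" by (intro closed_Times closed_cball closed_atLeastAtMost)
  ultimately have "closed ((cball x1 r \<times> {t1 - r\<^sup>2..t1 + io}) \<inter> H -` {l..})"
    by (rule continuous_closed_preimage) simp
  moreover have "(cball x1 r \<times> {t1 - r\<^sup>2..t1 + io}) \<inter> H -` {l..} = Z l" by (auto simp: Z_def)
  ultimately show ?thesis by simp
qed

lemma Z_C:
  assumes "1 \<le> l" "X \<in> Z l" "X \<in> Uo" shows "X \<in> C"
proof (rule ccontr)
  assume n: "X \<notin> C"
  have X: "dist x1 (fst X) \<le> r" "t1 - r\<^sup>2 \<le> snd X" "snd X < t1 + io" using assms by (auto simp: Z_def Uo_def)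
  have "dist x1 (fst X) = r \<or> snd X = t1 - r\<^sup>2"
    using n X by (cases X) (auto simp: C_def)
  then have "eta X = 0" using r2 by (auto simp: eta_def norm_sum)
  then show False using assms by (auto simp: Z_def H_def)
qed

lemma ext_0:
  assumes "1 \<le> m" "X \<notin> Z l" shows "ext l m g X = 0"
proof (cases "X \<in> C")
  case True
  then have "X \<in> cball x1 r \<times> {t1 - r\<^sup>2..t1 + io}" by (auto simp: C_def)
  then have "H X < l" using assms by (auto simp: Z_def)
  then show ?thesis using assms by (simp add: ext_def zero_power)
qed (simp add: ext_def)

lemma Uo_cover: "1 \<le> l \<Longrightarrow> X \<in> Uo \<Longrightarrow> X \<in> C \<or> X \<in> - Z l"
  using Z_C by blast

lemma ext_continuous:
  assumes l: "1 \<le> l" and m: "1 \<le> m" and g: "continuous_on D g"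
  shows "continuous_on Uo (ext l m g)"
proof -
  have "continuous_on (C \<union> - Z l) (ext l m g)"
  proof (rule continuous_on_open_Un)
    have "continuous_on C (\<lambda>X. g X * max 0 (H X - l) ^ m)"
      by (intro continuous_intros continuous_on_subset[OF g] continuous_on_subset[OF smooth_on_continuous[OF H_smooth]] C_sub)
    then show "continuous_on C (ext l m g)"
      by (subst continuous_on_cong[OF refl, of _ _ "\<lambda>X. g X * max 0 (H X - l) ^ m"]) (auto simp: ext_def)
    show "continuous_on (- Z l) (ext l m g)"
      by (subst continuous_on_cong[OF refl, of _ _ "\<lambda>_. 0"]) (auto simp: ext_0[OF m])
  qed (use open_C closed_Z in auto)
  then show ?thesis by (rule continuous_on_subset) (use Uo_cover[OF l] in auto)
qed

text \<open>On \<open>C\<close> this is the product rule. A point of \<open>Uo\<close> outside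
  \<open>C\<close> lies in the open complement of \<open>Z l\<close>, where the extension vanishes
  identically.\<close>

lemma ext_has_derivative:
  assumes l: "1 \<le> l" and m: "2 \<le> m" and g: "smooth_on D g" and X: "X \<in> Uo"
  shows "(ext l m g has_derivative (\<lambda>e. ext l m (pd e g) X + ext l (m - 1) (\<lambda>X. real m * g X * pd e H X) X)) (at X)"
proof (cases "X \<in> C")
  case True
  then have XD: "X \<in> D" using C_sub by blast
  have dH: "((\<lambda>X. H X - l) has_derivative (\<lambda>e. pd e H X)) (at X)"
    using has_derivative_diff[OF has_derivative_pd[OF smooth_on_differentiable[OF H_smooth XD]] has_derivative_const[of l]] by simp
  have "((\<lambda>X. max 0 (H X - l) ^ m) has_derivative (\<lambda>e. real m * max 0 (H X - l) ^ (m - 1) * pd e H X)) (at X)"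
    using has_derivative_compose[OF dH max_0_power_has_derivative[OF m, unfolded has_field_derivative_def]] by simp
  from has_derivative_mult[OF has_derivative_pd[OF smooth_on_differentiable[OF g XD]] this]
  have "((\<lambda>X. g X * max 0 (H X - l) ^ m) has_derivative (\<lambda>e. ext l m (pd e g) X + ext l (m - 1) (\<lambda>X. real m * g X * pd e H X) X)) (at X)"
    using True by (simp add: ext_def mult_ac add.commute)
  then show ?thesis
    by (rule has_derivative_transform_within_open[OF _ open_C True]) (simp add: ext_def)
next
  case False
  then have XZ: "X \<in> - Z l" using Uo_cover[OF l X] by blast
  have "(ext l m g has_derivative (\<lambda>e. 0)) (at X)"
    by (rule has_derivative_transform_within_open[OF has_derivative_const[of 0], of "- Z l"])
      (use closed_Z XZ ext_0 m in auto)
  then show ?thesis using False by (simp add: ext_def)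
qed

lemma ext_differentiable: "1 \<le> l \<Longrightarrow> 2 \<le> m \<Longrightarrow> smooth_on D g \<Longrightarrow> X \<in> Uo \<Longrightarrow> ext l m g differentiable (at X)"
  using ext_has_derivative differentiable_def by blast

lemma pd_ext: "1 \<le> l \<Longrightarrow> 2 \<le> m \<Longrightarrow> smooth_on D g \<Longrightarrow> X \<in> Uo \<Longrightarrow>
   pd e (ext l m g) X = ext l m (pd e g) X + ext l (m - 1) (\<lambda>X. real m * g X * pd e H X) X"
  by (rule pd_eqI[OF ext_has_derivative])

lemma pd_ext_1: "1 \<le> l \<Longrightarrow> 2 \<le> m \<Longrightarrow> X \<in> Uo \<Longrightarrow>
   pd e (ext l m (\<lambda>_. 1)) X = ext l (m - 1) (\<lambda>X. real m * pd e H X) X"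
  by (subst pd_ext[OF _ _ smooth_on_const]) (auto simp: ext_def pd_def)

lemma pd_ext_continuous:
  assumes l: "1 \<le> l" and m: "2 \<le> m" and g: "smooth_on D g" and e: "e \<in> Basis"
  shows "continuous_on Uo (pd e (ext l m g))"
proof -
  have "continuous_on Uo (\<lambda>X. ext l m (pd e g) X + ext l (m - 1) (\<lambda>X. real m * g X * pd e H X) X)"
    by (intro continuous_intros ext_continuous l smooth_on_continuous smooth_on_pd g H_smooth e) (use m in auto)
  then show ?thesis
    by (subst continuous_on_cong[OF refl]) (auto simp: pd_ext[OF l m g])
qed

lemma slice_continuous:
  assumes "continuous_on Uo g" "t < t1 + io" shows "continuous_on UNIV (\<lambda>x. g (x, t))"
  by (rule continuous_on_compose2[OF assms(1)]) (use assms(2) in \<open>auto intro!: continuous_intros simp: Uo_def\<close>)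

lemma C_fst: "X \<in> C \<Longrightarrow> fst X \<in> cball x1 r" by (auto simp: C_def)

lemma ext_outside: "x \<notin> cball x1 r \<Longrightarrow> ext l m g (x, t) = 0"
  using C_fst[of "(x, t)"] by (auto simp: ext_def)

lemma slice_integral_pd_0:
  assumes l: "1 \<le> l" and m: "2 \<le> m" and g: "smooth_on D g" and t: "t < t1 + io"
  shows "(LBINT x. pd (ex i) (ext l m g) (x, t)) = 0" "integrable lborel (\<lambda>x. pd (ex i) (ext l m g) (x, t))"
proof -
  have d: "ext l m g differentiable (at (x, t))" for x
    by (rule ext_differentiable[OF l m g]) (use t in \<open>simp add: Uo_def\<close>)
  have eq: "pd (axis i 1) (\<lambda>x. ext l m g (x, t)) = (\<lambda>x. pd (ex i) (ext l m g) (x, t))"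
    by (rule ext) (rule pd_slice[OF d])
  have c: "continuous_on UNIV (\<lambda>x. pd (ex i) (ext l m g) (x, t))"
    by (rule slice_continuous[OF pd_ext_continuous[OF l m g] t]) simp
  have "(LBINT x. pd (axis i 1) (\<lambda>x. ext l m g (x, t)) x) = 0"
  proof (rule integral_pd_eq_0[OF compact_cball])
    show "(\<lambda>x. ext l m g (x, t)) differentiable at x" for x
      using slice_has_derivative[OF d] differentiable_def by blast
    show "continuous_on UNIV (pd (axis i 1) (\<lambda>x. ext l m g (x, t)))" unfolding eq by (rule c)
  qed (rule ext_outside)
  then show "(LBINT x. pd (ex i) (ext l m g) (x, t)) = 0" unfolding eq .
  show "integrable lborel (\<lambda>x. pd (ex i) (ext l m g) (x, t))"
  proof (rule integrable_lborel_compact_support[OF compact_cball continuous_on_subset[OF c]])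
    show "pd (ex i) (ext l m g) (x, t) = 0" if "x \<notin> cball x1 r" for x
      unfolding pd_ext[OF l m g, of "(x,t)", unfolded Uo_def, simplified, OF t] using ext_outside[OF that] by simp
  qed auto
qed

definition vflux :: "'n \<Rightarrow> (real^'n) \<times> real \<Rightarrow> real" where "vflux i X = eta X * flux i X"

lemma eta_smooth_D: "smooth_on D eta" by (rule smooth_on_subset[OF eta_smooth]) simp

lemma vflux_smooth: "smooth_on D (vflux i)"
  unfolding vflux_def[abs_def] by (intro smooth_on_mult D flux_smooth eta_smooth_D)

text \<open>Bounds for the two error terms of \<open>caccioppoli_pointwise\<close> when s and G are
  at most M2 and as \<le> a \<le> au on the level set: \<open>kap1\<close> inserts 1/r^2 and 4/r^2
  for the derivatives of the cut-off, \<open>kap2\<close> is the coefficient of f^2.\<close>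

definition kap1 :: "real \<Rightarrow> real \<Rightarrow> real" where "kap1 M2 au = M2^4 * (1 / (2 * r\<^sup>2) + (10 * L + 4) * au / r\<^sup>2)"
definition kap2 :: "real \<Rightarrow> real \<Rightarrow> real" where
  "kap2 M2 as = (CARD('n) / (4 * lam) + 9 / (2 * lam) + 1/4) * M2^3 / as"

definition Rh :: "real \<Rightarrow> real \<Rightarrow> real \<Rightarrow> real \<Rightarrow> (real^'n) \<times> real \<Rightarrow> real" where
  "Rh l M2 as au X = indicator (lev l) X * (kap1 M2 au + kap2 M2 as * (f X)\<^sup>2)"

text \<open>With w = (H - l)_+^2 this is |\<nabla>w|^2, and \<open>T\<close> is the time derivative
  of w^2: the two halves of a parabolic energy.\<close>

definition W :: "real \<Rightarrow> (real^'n) \<times> real \<Rightarrow> real" where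
  "W l X = (\<Sum>i\<in>UNIV. (pd (ex i) (ext l 2 (\<lambda>_. 1)) X)\<^sup>2)"

definition T :: "real \<Rightarrow> (real^'n) \<times> real \<Rightarrow> real" where "T l X = pd et (ext l 4 (\<lambda>_. 1)) X"

lemma pd_H: "X \<in> D \<Longrightarrow> pd e H X = eta X * pd e G X + pd e eta X * G X"
  unfolding H_def[abs_def]
  by (rule pd_mult) (auto intro: smooth_on_differentiable[OF G_smooth] smooth_on_differentiable[OF eta_smooth])

lemma div_vflux:
  assumes X: "X \<in> D"
  shows "(\<Sum>i\<in>UNIV. pd (ex i) (vflux i) X) = f X * (grad_x eta X \<bullet> grad_x u X)
     + grad_x eta X \<bullet> (hess E (grad_x u X) *v grad_x G X) / 2
     + eta X * (f X * (\<Sum>j\<in>UNIV. pd (ex j) (pd (ex j) u) X)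
    + (\<Sum>j\<in>UNIV. grad_x (pd (ex j) u) X \<bullet> (hess E (grad_x u X) *v grad_x (pd (ex j) u) X)) + pd et G X / 2)"
proof -
  have "pd (ex i) (vflux i) X = eta X * pd (ex i) (flux i) X + pd (ex i) eta X * flux i X" for i
    unfolding vflux_def[abs_def]
    by (rule pd_mult) (auto intro: smooth_on_differentiable[OF flux_smooth X] smooth_on_differentiable[OF eta_smooth])
  then have "(\<Sum>i\<in>UNIV. pd (ex i) (vflux i) X) = eta X * (\<Sum>i\<in>UNIV. pd (ex i) (flux i) X) + (\<Sum>i\<in>UNIV. pd (ex i) eta X * flux i X)"
    by (simp add: sum.distrib sum_distrib_left)
  moreover have "(\<Sum>i\<in>UNIV. pd (ex i) eta X * flux i X) = f X * (grad_x eta X \<bullet> grad_x u X)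
     + grad_x eta X \<bullet> (hess E (grad_x u X) *v grad_x G X) / 2"
    unfolding flux_eq[OF X] inner_vec_def grad_x_nth
    by (simp add: distrib_left sum.distrib sum_distrib_left sum_divide_distrib mult_ac)
  ultimately show ?thesis unfolding div_flux[OF X] by simp
qed

lemma vflux_H:
  assumes X: "X \<in> D"
  shows "(\<Sum>i\<in>UNIV. vflux i X * pd (ex i) H X) = eta X * (f X * (grad_x u X \<bullet> grad_x H X)
     + grad_x G X \<bullet> (hess E (grad_x u X) *v grad_x H X) / 2)"
proof -
  have "(\<Sum>i\<in>UNIV. vflux i X * pd (ex i) H X) = eta X * (f X * (grad_x u X \<bullet> grad_x H X)
     + grad_x H X \<bullet> (hess E (grad_x u X) *v grad_x G X) / 2)"
    unfolding vflux_def flux_eq[OF X] inner_vec_def grad_x_nth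
    by (simp add: distrib_left distrib_right sum.distrib sum_distrib_left sum_divide_distrib mult_ac)
  then show ?thesis using hess_bilinear_sym[of "grad_x H X"] by simp
qed

text \<open>On the level set this is \<open>caccioppoli_pointwise\<close> with s = H - l. Off it
  every term vanishes, since each carries a positive power of the truncation.\<close>

lemma pointwise_energy:
  assumes l: "1 \<le> l" and X: "snd X \<le> t1" and as: "0 < as"
    and bnd: "\<And>X. X \<in> lev l \<Longrightarrow> as \<le> G X powr (p/2 - 1) \<and> G X powr (p/2 - 1) \<le> au \<and> G X \<le> M2"
  shows "T l X / 8 + lam * as / 8 * W l X - Rh l M2 as au X \<le> (\<Sum>i\<in>UNIV. pd (ex i) (ext l 3 (vflux i)) X)"
proof -
  have U: "X \<in> Uo" using X io by (simp add: Uo_def)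
  have T: "T l X = ext l 3 (\<lambda>X. 4 * pd et H X) X" unfolding T_def by (subst pd_ext_1[OF l _ U]) auto
  have W: "W l X = (\<Sum>i\<in>UNIV. (ext l 1 (\<lambda>X. 2 * pd (ex i) H X) X)\<^sup>2)" unfolding W_def by (subst pd_ext_1[OF l _ U]) auto
  have P: "pd (ex i) (ext l 3 (vflux i)) X = ext l 3 (pd (ex i) (vflux i)) X + ext l 2 (\<lambda>X. 3 * vflux i X * pd (ex i) H X) X" for i
    by (subst pd_ext[OF l _ vflux_smooth U]) auto
  show ?thesis
  proof (cases "X \<in> lev l")
    case False
    then have "X \<notin> C \<or> H X - l \<le> 0" using X by (auto simp: lev_def)
    then have "ext l m g X = 0" if "1 \<le> m" for m g using that by (auto simp: ext_def zero_power)
    then show ?thesis using False by (simp add: T W P Rh_def)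
  next
    case True
    then have C: "X \<in> C" and HX: "l < H X" by (auto simp: lev_def)
    then have XD: "X \<in> D" using C_sub by blast
    define s where "s = H X - l"
    have s: "s > 0" using HX by (simp add: s_def)
    note eb = eta_bounds[OF C X]
    define a where "a = G X powr (p/2 - 1)"
    have a: "as \<le> a" "a \<le> au" "G X \<le> M2" using bnd[OF True] by (auto simp: a_def)
    have "eta X * G X \<le> 1 * G X" by (rule mult_right_mono) (use eb G_pos[of X] in auto)
    then have GH: "H X \<le> G X" by (simp add: H_def)
    \<comment> \<open>The level l \<ge> 1 puts \<nabla>u into the range where \<open>ell\<close>
      holds.\<close>
    then have G1: "1 \<le> G X" using HX l by linarith
    have sG: "s \<le> G X" "s \<le> M2" using GH l a by (auto simp: s_def)
    define c where "c = CARD('n) / (4 * lam) + 9 / (2 * lam) + 1/4"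
    have c: "c \<ge> 0" using lam by (simp add: c_def)
    have main: "s^3 * pd et H X / 2 + s\<^sup>2 * (lam * a * (norm (grad_x H X))\<^sup>2 / 2
        - (G X)\<^sup>2 * (\<bar>pd et eta X\<bar> / 2 + (5/2 * L + 1) * a * (norm (grad_x eta X))\<^sup>2)
        - c * ((f X)\<^sup>2 * G X / a))
      \<le> s^3 * (\<Sum>i\<in>UNIV. pd (ex i) (vflux i) X) + 3 * s\<^sup>2 * (\<Sum>i\<in>UNIV. vflux i X * pd (ex i) H X)"
      unfolding div_vflux[OF XD] vflux_H[OF XD] c_def
    proof (rule caccioppoli_pointwise[where M="\<lambda>j. grad_x (pd (ex j) u) X", unfolded grad_x_nth])
      show "v \<bullet> (hess E (grad_x u X) *v w) = w \<bullet> (hess E (grad_x u X) *v v)" for v w by (rule hess_bilinear_sym)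
      show "lam * a * (norm v)\<^sup>2 \<le> v \<bullet> (hess E (grad_x u X) *v v)" "v \<bullet> (hess E (grad_x u X) *v v) \<le> L * a * (norm v)\<^sup>2" for v
        using ell[of "grad_x u X" v] G1 unfolding hessq_def G_eq a_def by auto
      show "grad_x H X = eta X *\<^sub>R grad_x G X + G X *\<^sub>R grad_x eta X"
        by (simp add: vec_eq_iff grad_x_nth pd_H[OF XD] mult.commute)
      show "pd et H X = eta X * pd et G X + pd et eta X * G X" by (rule pd_H[OF XD])
      show "(norm (grad_x u X))\<^sup>2 \<le> G X" by (simp add: G_eq)
      show "s \<le> eta X * G X" using l by (simp add: s_def H_def)
    qed (use lam as a eb s in auto)
    have e1: "(\<Sum>i\<in>UNIV. pd (ex i) (ext l 3 (vflux i)) X) = s^3 * (\<Sum>i\<in>UNIV. pd (ex i) (vflux i) X) + 3 * s\<^sup>2 * (\<Sum>i\<in>UNIV. vflux i X * pd (ex i) H X)"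
      using C s by (simp add: P ext_def s_def sum.distrib sum_distrib_left mult_ac)
    \<comment> \<open>The time derivative of s^4 is 4 s^3 times that of H, and the squared gradient
      of s^2 is 4 s^2 |\<nabla>H|^2; this explains the factors 1/8.\<close>
    have e2: "T l X / 8 = s^3 * pd et H X / 2" using C s by (simp add: T ext_def s_def)
    have "(norm (grad_x H X))\<^sup>2 = (\<Sum>i\<in>UNIV. (pd (ex i) H X)\<^sup>2)"
      unfolding power2_norm_eq_inner inner_vec_def grad_x_nth by (simp add: power2_eq_square)
    then have e3: "W l X = 4 * s\<^sup>2 * (norm (grad_x H X))\<^sup>2"
      using C s by (simp add: W ext_def s_def[symmetric] sum_distrib_left power_mult_distrib mult_ac)
    have e4: "lam * as / 8 * W l X \<le> s\<^sup>2 * (lam * a * (norm (grad_x H X))\<^sup>2 / 2)"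
    proof -
      have "lam * as * (s\<^sup>2 * (norm (grad_x H X))\<^sup>2) \<le> lam * a * (s\<^sup>2 * (norm (grad_x H X))\<^sup>2)"
        using a lam by (intro mult_right_mono mult_left_mono) auto
      then show ?thesis unfolding e3 by (simp add: mult_ac)
    qed
    have M2: "0 < M2" using sG s by linarith
    have e5: "s\<^sup>2 * ((G X)\<^sup>2 * (\<bar>pd et eta X\<bar> / 2 + (5/2 * L + 1) * a * (norm (grad_x eta X))\<^sup>2)) \<le> kap1 M2 au"
    proof -
      have 1: "\<bar>pd et eta X\<bar> / 2 + (5/2 * L + 1) * a * (norm (grad_x eta X))\<^sup>2 \<le> (1 / r\<^sup>2) / 2 + (5/2 * L + 1) * au * (4 / r\<^sup>2)"
        using eb L a as by (intro add_mono divide_right_mono mult_mono) auto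
      have 2: "0 \<le> \<bar>pd et eta X\<bar> / 2 + (5/2 * L + 1) * a * (norm (grad_x eta X))\<^sup>2"
        using L a as by (intro add_nonneg_nonneg mult_nonneg_nonneg) auto
      have "s\<^sup>2 * ((G X)\<^sup>2 * (\<bar>pd et eta X\<bar> / 2 + (5/2 * L + 1) * a * (norm (grad_x eta X))\<^sup>2))
        \<le> M2\<^sup>2 * (M2\<^sup>2 * ((1 / r\<^sup>2) / 2 + (5/2 * L + 1) * au * (4 / r\<^sup>2)))"
        using s sG a G1 M2 2 by (intro mult_mono power_mono 1) auto
      also have "(1 / r\<^sup>2) / 2 + (5/2 * L + 1) * au * (4 / r\<^sup>2) = 1 / (2 * r\<^sup>2) + (10 * L + 4) * au / r\<^sup>2"
        by (simp add: algebra_simps add_divide_distrib)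
      also have "M2\<^sup>2 * (M2\<^sup>2 * (1 / (2 * r\<^sup>2) + (10 * L + 4) * au / r\<^sup>2)) = kap1 M2 au"
        unfolding kap1_def by (simp add: power2_eq_square power4_eq_xxxx mult.assoc)
      finally show ?thesis .
    qed
    have e6: "s\<^sup>2 * (c * ((f X)\<^sup>2 * G X / a)) \<le> kap2 M2 as * (f X)\<^sup>2"
    proof -
      have "s\<^sup>2 * (c * ((f X)\<^sup>2 * G X / a)) \<le> M2\<^sup>2 * (c * ((f X)\<^sup>2 * M2 / as))"
      proof (rule mult_mono[OF power_mono])
        have "(f X)\<^sup>2 * G X / a \<le> (f X)\<^sup>2 * M2 / as"
          by (rule frac_le) (use a as M2 in \<open>auto intro!: mult_left_mono\<close>)
        then show "c * ((f X)\<^sup>2 * G X / a) \<le> c * ((f X)\<^sup>2 * M2 / as)" by (rule mult_left_mono[OF _ c])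
        have "0 \<le> (f X)\<^sup>2 * G X / a" using G1 a as by auto
        then show "0 \<le> c * ((f X)\<^sup>2 * G X / a)" using c by (intro mult_nonneg_nonneg)
      qed (use s sG in auto)
      also have "\<dots> = kap2 M2 as * (f X)\<^sup>2" unfolding kap2_def c_def[symmetric] by (simp add: power2_eq_square power3_eq_cube)
      finally show ?thesis .
    qed
    have e7: "Rh l M2 as au X = kap1 M2 au + kap2 M2 as * (f X)\<^sup>2" using True by (simp add: Rh_def)
    have gen: "t + w - (k1 + k2) \<le> R" if "t + s2 * (A - B - C) \<le> R" "w \<le> s2 * A" "s2 * B \<le> k1" "s2 * C \<le> k2"
      for t w k1 k2 R s2 A B C :: real using that by (simp add: right_diff_distrib)
    show ?thesis unfolding e1 e2 e7 by (rule gen[OF main e4 e5 e6])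
  qed
qed

end

section \<open>The energy estimate\<close>

context parabolic_cyl
begin

lemma in_Uo: "t < t1 + io \<Longrightarrow> (x, t) \<in> Uo" by (simp add: Uo_def)

lemma T_continuous: "1 \<le> l \<Longrightarrow> continuous_on Uo (T l)"
  unfolding T_def[abs_def] by (rule pd_ext_continuous[OF _ _ smooth_on_const]) auto

lemma W_continuous: "1 \<le> l \<Longrightarrow> continuous_on Uo (W l)"
  unfolding W_def[abs_def] by (intro continuous_intros pd_ext_continuous smooth_on_const) auto

lemma T_outside: "1 \<le> l \<Longrightarrow> x \<notin> cball x1 r \<Longrightarrow> t < t1 + io \<Longrightarrow> T l (x, t) = 0"
  unfolding T_def by (subst pd_ext_1[OF _ _ in_Uo]) (auto simp: ext_outside)

lemma W_outside: "1 \<le> l \<Longrightarrow> x \<notin> cball x1 r \<Longrightarrow> t < t1 + io \<Longrightarrow> W l (x, t) = 0"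
  unfolding W_def by (subst pd_ext_1[OF _ _ in_Uo]) (auto simp: ext_outside)

lemma slice_integrable:
  assumes "continuous_on Uo F" "\<And>x. x \<notin> cball x1 r \<Longrightarrow> F (x, t) = (0::real)" "t < t1 + io"
  shows "integrable lborel (\<lambda>x. F (x, t))"
  by (rule integrable_lborel_compact_support[OF compact_cball continuous_on_subset[OF slice_continuous[OF assms(1,3)]] assms(2)]) auto

lemma pair_integrable:
  assumes F: "continuous_on Uo F" and F0: "\<And>x t. x \<notin> cball x1 r \<Longrightarrow> t < t1 + io \<Longrightarrow> F (x, t) = (0::real)" and \<tau>: "\<tau> \<le> t1"
  shows "integrable (lborel \<Otimes>\<^sub>M lborel) (\<lambda>(x, t). indicator {s..\<tau>} t * F (x, t))"
proof (rule integrable_lborel_pair_compact_support[of "cball x1 r \<times> {s..\<tau>}"])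
  have "cball x1 r \<times> {s..\<tau>} \<subseteq> Uo" using \<tau> io by (auto simp: Uo_def)
  then have "continuous_on (cball x1 r \<times> {s..\<tau>}) F" using F continuous_on_subset by blast
  then show "continuous_on (cball x1 r \<times> {s..\<tau>}) (\<lambda>(x, t). indicator {s..\<tau>} t * F (x, t))"
    by (subst continuous_on_cong[OF refl, of _ _ F]) auto
  show "indicator {s..\<tau>} t * F (x, t) = 0" if "(x, t) \<notin> cball x1 r \<times> {s..\<tau>}" for x t
    using that F0[of x t] \<tau> io by (cases "t \<in> {s..\<tau>}") auto
qed (intro compact_Times compact_cball compact_Icc)

lemma lev_borel [measurable]: "lev l \<in> sets borel"
proof -
  have "open (C \<inter> H -` {l<..})"
    by (rule continuous_open_preimage[OF continuous_on_subset[OF smooth_on_continuous[OF H_smooth] C_sub] open_C]) simp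
  moreover have "closed {X::(real^'n) \<times> real. snd X \<le> t1}" by (intro closed_Collect_le continuous_intros)
  moreover have "lev l = (C \<inter> H -` {l<..}) \<inter> {X. snd X \<le> t1}" by (auto simp: lev_def)
  ultimately show ?thesis by (metis borel_closed borel_open sets.Int)
qed

lemma lev_slice_borel: "{x. (x, t) \<in> lev l} \<in> sets borel"
proof -
  have "(\<lambda>x::real^'n. (x, t)) \<in> borel \<rightarrow>\<^sub>M borel" by (intro borel_measurable_continuous_onI continuous_intros)
  from measurable_sets[OF this lev_borel[of l]] show ?thesis by (simp add: vimage_def)
qed

abbreviation "K0 \<equiv> cball x1 r \<times> {t1 - r\<^sup>2..t1}"

lemma lev_K0: "lev l \<subseteq> K0" by (auto simp: lev_def C_def)

lemma K0_D: "K0 \<subseteq> D" using cyl_sub io by (auto simp: subset_iff)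

lemma compact_K0: "compact K0" by (intro compact_Times compact_cball compact_Icc)

lemma f2_integrable: "integrable lborel (\<lambda>X. indicator (lev l) X * (f X)\<^sup>2)"
proof -
  have "integrable lborel (\<lambda>X. indicator K0 X *\<^sub>R (f X)\<^sup>2)"
    by (intro borel_integrable_compact compact_K0 continuous_intros continuous_on_subset[OF smooth_on_continuous[OF f] K0_D])
  from integrable_mult_indicator[OF _ this, of "lev l"]
  have "integrable lborel (\<lambda>X. indicator (lev l) X *\<^sub>R (indicator K0 X *\<^sub>R (f X)\<^sup>2))" by simp
  moreover have "(\<lambda>X. indicator (lev l) X *\<^sub>R (indicator K0 X *\<^sub>R (f X)\<^sup>2)) = (\<lambda>X. indicator (lev l) X * (f X)\<^sup>2)"
  proof
    fix X show "indicator (lev l) X *\<^sub>R (indicator K0 X *\<^sub>R (f X)\<^sup>2) = indicator (lev l) X * (f X)\<^sup>2"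
    proof (cases "X \<in> lev l")
      case True
      then have "X \<in> K0" using lev_K0[of l] by blast
      then show ?thesis using True by simp
    qed simp
  qed
  ultimately show ?thesis by simp
qed

lemma lev_finite: "emeasure lborel (lev l) < \<infinity>"
proof -
  have "emeasure lborel (lev l) \<le> emeasure lborel K0"
    by (rule emeasure_mono[OF lev_K0]) (use compact_K0 in \<open>simp add: compact_imp_closed borel_closed\<close>)
  also have "\<dots> < \<infinity>" using emeasure_compact_finite[OF compact_K0] by simp
  finally show ?thesis .
qed

lemma Rh_integrable: "integrable lborel (Rh l M2 as au)"
  and Rh_integral: "(LBINT X. Rh l M2 as au X) = kap1 M2 au * measure lborel (lev l)
     + kap2 M2 as * (LBINT X. indicator (lev l) X * (f X)\<^sup>2)"
proof -
  have eq: "Rh l M2 as au = (\<lambda>X. kap1 M2 au * indicator (lev l) X + kap2 M2 as * (indicator (lev l) X * (f X)\<^sup>2))"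
    by (auto simp: Rh_def fun_eq_iff indicator_def)
  have i: "integrable lborel (indicator (lev l) :: _ \<Rightarrow> real)"
    using lev_finite by (intro integrable_real_indicator) auto
  show "integrable lborel (Rh l M2 as au)"
    unfolding eq by (intro Bochner_Integration.integrable_add integrable_mult_right i f2_integrable)
  show "(LBINT X. Rh l M2 as au X) = kap1 M2 au * measure lborel (lev l)
     + kap2 M2 as * (LBINT X. indicator (lev l) X * (f X)\<^sup>2)"
    unfolding eq using i f2_integrable by simp
qed

lemma Rh_slice_integrable:
  assumes t: "t \<in> {t1 - r\<^sup>2..t1}"
  shows "integrable lborel (\<lambda>x. Rh l M2 as au (x, t))"
proof -
  have "continuous_on (cball x1 r) (\<lambda>x. kap1 M2 au + kap2 M2 as * (f (x, t))\<^sup>2)"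
    by (intro continuous_intros continuous_on_compose2[OF smooth_on_continuous[OF f]])
      (use t K0_D in auto)
  from integrable_mult_indicator[OF _ borel_integrable_compact[OF compact_cball this], of "{x. (x, t) \<in> lev l}"]
  have "integrable lborel (\<lambda>x. indicator {x. (x, t) \<in> lev l} x *\<^sub>R (indicator (cball x1 r) x *\<^sub>R (kap1 M2 au + kap2 M2 as * (f (x, t))\<^sup>2)))"
    using lev_slice_borel by simp
  moreover have "(\<lambda>x. indicator {x. (x, t) \<in> lev l} x *\<^sub>R (indicator (cball x1 r) x *\<^sub>R (kap1 M2 au + kap2 M2 as * (f (x, t))\<^sup>2)))
     = (\<lambda>x. Rh l M2 as au (x, t))"
    using lev_K0 by (force simp: fun_eq_iff indicator_def Rh_def)
  ultimately show ?thesis by simp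
qed

text \<open>Integrate the pointwise inequality over a slice: the right-hand side is the divergence
  of a compactly supported C^1 field and drops out.\<close>

lemma slice_energy:
  assumes l: "1 \<le> l" and t: "t \<in> {t1 - r\<^sup>2..t1}" and as: "0 < as"
    and bnd: "\<And>X. X \<in> lev l \<Longrightarrow> as \<le> G X powr (p/2 - 1) \<and> G X powr (p/2 - 1) \<le> au \<and> G X \<le> M2"
  shows "(LBINT x. T l (x, t)) + lam * as * (LBINT x. W l (x, t)) \<le> 8 * (LBINT x. Rh l M2 as au (x, t))"
proof -
  have tt: "t < t1 + io" using t io by auto
  note i1 = slice_integrable[OF T_continuous[OF l] T_outside[OF l _ tt] tt]
  note i2 = slice_integrable[OF W_continuous[OF l] W_outside[OF l _ tt] tt]
  note i3 = Rh_slice_integrable[OF t, of l M2 as au]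
  have s: "(LBINT x. pd (ex i) (ext l 3 (vflux i)) (x, t)) = 0" "integrable lborel (\<lambda>x. pd (ex i) (ext l 3 (vflux i)) (x, t))" for i
    by (rule slice_integral_pd_0[OF l _ vflux_smooth tt]; simp)+
  have "(LBINT x. T l (x, t) / 8 + lam * as / 8 * W l (x, t) - Rh l M2 as au (x, t))
     \<le> (LBINT x. \<Sum>i\<in>UNIV. pd (ex i) (ext l 3 (vflux i)) (x, t))"
  proof (rule integral_mono)
    show "T l (x, t) / 8 + lam * as / 8 * W l (x, t) - Rh l M2 as au (x, t) \<le> (\<Sum>i\<in>UNIV. pd (ex i) (ext l 3 (vflux i)) (x, t))" for x
      by (rule pointwise_energy[OF l _ as bnd]) (use t in auto)
    show "integrable lborel (\<lambda>x. \<Sum>i\<in>UNIV. pd (ex i) (ext l 3 (vflux i)) (x, t))"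
      by (rule Bochner_Integration.integrable_sum) (rule s(2))
  qed (intro Bochner_Integration.integrable_add Bochner_Integration.integrable_diff integrable_divide integrable_mult_right
       i1 i2 i3)
  also have "\<dots> = 0" using s by simp
  also have "(LBINT x. T l (x, t) / 8 + lam * as / 8 * W l (x, t) - Rh l M2 as au (x, t))
    = (LBINT x. T l (x, t)) / 8 + lam * as / 8 * (LBINT x. W l (x, t)) - (LBINT x. Rh l M2 as au (x, t))"
    using i1 i2 i3 by simp
  finally show ?thesis by simp
qed

text \<open>Integrate the slice inequality up to time \<tau>. The time derivative leaves only the
  slice at \<tau>, and as both terms on the left are non-negative, each is bounded on its own. A
  variable \<tau> gives the first bound uniformly in time.\<close>

lemma energy:
  assumes l: "1 \<le> l" and as: "0 < as"
    and bnd: "\<And>X. X \<in> lev l \<Longrightarrow> as \<le> G X powr (p/2 - 1) \<and> G X powr (p/2 - 1) \<le> au \<and> G X \<le> M2"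
    and \<tau>: "\<tau> \<in> {t1 - r\<^sup>2..t1}"
  shows "(LBINT x. ext l 4 (\<lambda>_. 1) (x, \<tau>)) \<le> 8 * (LBINT X. Rh l M2 as au X)"
    and "lam * as * (LBINT t. indicator {t1 - r\<^sup>2..\<tau>} t * (LBINT x. W l (x, t))) \<le> 8 * (LBINT X. Rh l M2 as au X)"
proof -
  define J where "J = {t1 - r\<^sup>2..\<tau>}"
  have \<tau>1: "\<tau> \<le> t1" using \<tau> by simp
  \<comment> \<open>Non-negativity allows the time integral of \<open>Rh\<close> to be enlarged from
    \<open>J\<close> to the whole line.\<close>
  have k: "0 \<le> Rh l M2 as au X" for X
  proof (cases "X \<in> lev l")
    case True
    then have "0 < as" "as \<le> au" "0 < M2" using as bnd[OF True] G_pos[of X] by auto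
    then have "0 \<le> kap1 M2 au" "0 \<le> kap2 M2 as" unfolding kap1_def kap2_def using L lam r2 by simp_all
    then show ?thesis by (simp add: Rh_def)
  qed (simp add: Rh_def)
  have fT: "integrable (lborel \<Otimes>\<^sub>M lborel) (\<lambda>(x, t). indicator J t * T l (x, t))"
    unfolding J_def by (rule pair_integrable[OF T_continuous[OF l] T_outside[OF l] \<tau>1])
  have fW: "integrable (lborel \<Otimes>\<^sub>M lborel) (\<lambda>(x, t). indicator J t * W l (x, t))"
    unfolding J_def by (rule pair_integrable[OF W_continuous[OF l] W_outside[OF l] \<tau>1])
  have fR: "integrable (lborel \<Otimes>\<^sub>M lborel) (\<lambda>(x, t). Rh l M2 as au (x, t))"
    unfolding lborel_prod using Rh_integrable by simp
  have iT: "integrable lborel (\<lambda>t. indicator J t * (LBINT x. T l (x, t)))"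
    using lborel_pair.integrable_snd[OF fT] by simp
  have iW: "integrable lborel (\<lambda>t. indicator J t * (LBINT x. W l (x, t)))"
    using lborel_pair.integrable_snd[OF fW] by simp
  have iR: "integrable lborel (\<lambda>t. LBINT x. Rh l M2 as au (x, t))"
    using lborel_pair.integrable_snd[OF fR] by simp
  have "(LBINT t. indicator J t * (LBINT x. T l (x, t))) = (LBINT t. LBINT x. indicator J t * T l (x, t))" by simp
  also have "\<dots> = (LBINT x. LBINT t. indicator J t * T l (x, t))" by (rule lborel_pair.Fubini_integral[OF fT])
  also have "\<dots> = (LBINT x. ext l 4 (\<lambda>_. 1) (x, \<tau>))"
  proof (rule Bochner_Integration.integral_cong[OF refl])
    fix x
    have "(LBINT t. indicator J t *\<^sub>R T l (x, t)) = ext l 4 (\<lambda>_. 1) (x, \<tau>) - ext l 4 (\<lambda>_. 1) (x, t1 - r\<^sup>2)"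
      unfolding J_def
    proof (rule integral_FTC_atLeastAtMost)
      show "((\<lambda>t. ext l 4 (\<lambda>_. 1) (x, t)) has_vector_derivative T l (x, t)) (at t within {t1 - r\<^sup>2..\<tau>})"
        if "t1 - r\<^sup>2 \<le> t" "t \<le> \<tau>" for t
      proof -
        have "ext l 4 (\<lambda>_. 1) differentiable (at ((x, 0) + t *\<^sub>R et))"
          by (rule ext_differentiable[OF l _ smooth_on_const]) (use that \<tau>1 io in \<open>auto simp: Uo_def et_def\<close>)
        from has_derivative_along[OF this]
        have "((\<lambda>t. ext l 4 (\<lambda>_. 1) (x, t)) has_real_derivative T l (x, t)) (at t)" by (simp add: T_def et_def)
        then show ?thesis
          by (meson has_field_derivative_at_within has_real_derivative_iff_has_vector_derivative)
      qed
      show "continuous_on {t1 - r\<^sup>2..\<tau>} (\<lambda>t. T l (x, t))"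
        by (rule continuous_on_compose2[OF T_continuous[OF l]]) (use \<tau>1 io in \<open>auto intro!: continuous_intros simp: Uo_def\<close>)
    qed (use \<tau> in simp)
    \<comment> \<open>The bottom time is excluded from \<open>C\<close>, so there is no initial
      term.\<close>
    moreover have "ext l 4 (\<lambda>_. 1) (x, t1 - r\<^sup>2) = 0" by (simp add: ext_def C_def)
    ultimately show "(LBINT t. indicator J t * T l (x, t)) = ext l 4 (\<lambda>_. 1) (x, \<tau>)" by simp
  qed
  finally have y: "(LBINT t. indicator J t * (LBINT x. T l (x, t))) = (LBINT x. ext l 4 (\<lambda>_. 1) (x, \<tau>))" .
  have "(LBINT t. indicator J t * (LBINT x. T l (x, t)) + lam * as * (indicator J t * (LBINT x. W l (x, t))))
     \<le> (LBINT t. 8 * (LBINT x. Rh l M2 as au (x, t)))"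
  proof (rule integral_mono)
    show "indicator J t * (LBINT x. T l (x, t)) + lam * as * (indicator J t * (LBINT x. W l (x, t))) \<le> 8 * (LBINT x. Rh l M2 as au (x, t))" for t
    proof (cases "t \<in> J")
      case True
      then show ?thesis using slice_energy[OF l _ as bnd, of t] \<tau>1 by (simp add: J_def)
    next
      case False
      have "0 \<le> (LBINT x. Rh l M2 as au (x, t))" using k by (intro integral_nonneg_AE) auto
      then show ?thesis using False by simp
    qed
  qed (intro Bochner_Integration.integrable_add integrable_mult_right iT iW iR)+
  moreover have "(LBINT t. LBINT x. Rh l M2 as au (x, t)) = (LBINT X. Rh l M2 as au X)"
    using lborel_pair.integral_snd[OF fR] by (simp add: lborel_prod)
  ultimately have main: "(LBINT x. ext l 4 (\<lambda>_. 1) (x, \<tau>)) + lam * as * (LBINT t. indicator J t * (LBINT x. W l (x, t)))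
     \<le> 8 * (LBINT X. Rh l M2 as au X)"
    using iT iW y by simp
  have "0 \<le> (LBINT t. indicator J t * (LBINT x. W l (x, t)))"
    by (intro integral_nonneg_AE AE_I2 mult_nonneg_nonneg) (auto intro!: integral_nonneg_AE AE_I2 sum_nonneg simp: W_def)
  then have 1: "0 \<le> lam * as * (LBINT t. indicator J t * (LBINT x. W l (x, t)))" using lam as by simp
  have 2: "0 \<le> (LBINT x. ext l 4 (\<lambda>_. 1) (x, \<tau>))" by (intro integral_nonneg_AE AE_I2) (simp add: ext_def)
  show "(LBINT x. ext l 4 (\<lambda>_. 1) (x, \<tau>)) \<le> 8 * (LBINT X. Rh l M2 as au X)" using main 1 by linarith
  show "lam * as * (LBINT t. indicator {t1 - r\<^sup>2..\<tau>} t * (LBINT x. W l (x, t))) \<le> 8 * (LBINT X. Rh l M2 as au X)"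
    using main 2 unfolding J_def by linarith
qed

text \<open>On each slice apply \<open>weak_sobolev\<close> to w = (H - l)_+^2 at height (l' - l)^2,
  which w exceeds on the higher level set. The first energy bound controls the integral of w^2
  uniformly in time and contributes the power 2/n; the gradient term, integrated in time,
  contributes one more power.\<close>

lemma level_step:
  assumes l: "1 \<le> l" "l < l'" and as: "0 < as"
    and bnd: "\<And>X. X \<in> lev l \<Longrightarrow> as \<le> G X powr (p/2 - 1) \<and> G X powr (p/2 - 1) \<le> au \<and> G X \<le> M2"
  shows "((l' - l)\<^sup>2) powr (2 + 4 / CARD('n)) * measure lborel (lev l')
    \<le> 4 * (4 / unit_ball_vol (CARD('n))) powr (2 / CARD('n)) / (lam * as)
        * (8 * (kap1 M2 au * measure lborel (lev l) + kap2 M2 as * (LBINT X. indicator (lev l) X * (f X)\<^sup>2))) powr (1 + 2 / CARD('n))"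
proof -
  define n where "n = real CARD('n)"
  have n: "n > 0" by (simp add: n_def)
  define Y where "Y = 8 * (LBINT X. Rh l M2 as au X)"
  define cs where "cs = 4 * (4 / unit_ball_vol n) powr (2 / n)"
  have cs: "cs \<ge> 0" by (simp add: cs_def)
  define \<mu> where "\<mu> = (l' - l)\<^sup>2"
  have \<mu>: "\<mu> > 0" using l by (simp add: \<mu>_def)
  define J where "J = {t1 - r\<^sup>2..t1}"
  have en1: "(LBINT x. ext l 4 (\<lambda>_. 1) (x, \<tau>)) \<le> Y" if "\<tau> \<in> {t1 - r\<^sup>2..t1}" for \<tau>
    unfolding Y_def by (rule energy(1)[OF l(1) as bnd that])
  have en2: "lam * as * (LBINT t. indicator {t1 - r\<^sup>2..t1} t * (LBINT x. W l (x, t))) \<le> Y"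
    unfolding Y_def by (rule energy(2)[OF l(1) as bnd]) auto
  have t1J: "t1 \<in> {t1 - r\<^sup>2..t1}" by simp
  have fW: "integrable (lborel \<Otimes>\<^sub>M lborel) (\<lambda>(x, t). indicator J t * W l (x, t))"
    unfolding J_def by (rule pair_integrable[OF W_continuous[OF l(1)] W_outside[OF l(1)] order_refl])
  have iW: "integrable lborel (\<lambda>t. indicator J t * (LBINT x. W l (x, t)))"
    using lborel_pair.integrable_snd[OF fW] by simp
  have iL: "integrable (lborel \<Otimes>\<^sub>M lborel) (\<lambda>(x, t). indicator (lev l') (x, t) :: real)"
    unfolding lborel_prod using lev_finite[of l'] by (simp add: integrable_real_indicator)
  have sl: "(LBINT x. indicator (lev l') (x, t)) = measure lborel {x. (x, t) \<in> lev l'}" for t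
  proof -
    have "(\<lambda>x. indicator (lev l') (x, t) :: real) = indicator {x. (x, t) \<in> lev l'}" by (auto simp: fun_eq_iff indicator_def)
    then show ?thesis using lev_slice_borel[of t l'] by simp
  qed
  have Wnn: "0 \<le> (LBINT x. W l (x, t))" for t by (intro integral_nonneg_AE AE_I2) (simp add: W_def sum_nonneg)
  have ynn: "0 \<le> (LBINT x. ext l 4 (\<lambda>_. 1) (x, t))" for t by (intro integral_nonneg_AE AE_I2) (simp add: ext_def)
  have Y0: "0 \<le> Y" using en1[OF t1J] ynn[of t1] by linarith
  have slice: "\<mu> powr (2 + 4 / n) * measure lborel {x. (x, t) \<in> lev l'} \<le> cs * Y powr (2 / n) * (indicator J t * (LBINT x. W l (x, t)))" for t
  proof (cases "t \<in> J")
    case False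
    then have "{x. (x, t) \<in> lev l'} = {}" using lev_K0[of l'] by (auto simp: J_def)
    then show ?thesis using False by simp
  next
    case True
    then have tt: "t < t1 + io" using io by (simp add: J_def)
    define w where "w = (\<lambda>x. ext l 2 (\<lambda>_. 1) (x, t))"
    have d: "ext l 2 (\<lambda>_. 1) differentiable (at (x, t))" for x
      by (rule ext_differentiable[OF l(1) _ smooth_on_const in_Uo[OF tt]]) simp
    have pw: "pd (axis i 1) w = (\<lambda>x. pd (ex i) (ext l 2 (\<lambda>_. 1)) (x, t))" for i
      unfolding w_def by (rule ext) (rule pd_slice[OF d])
    have w2: "(w x)\<^sup>2 = ext l 4 (\<lambda>_. 1) (x, t)" for x
      by (simp add: w_def ext_def power_mult[symmetric])
    have sub: "{x. (x, t) \<in> lev l'} \<subseteq> {x. \<mu> < \<bar>w x\<bar>}"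
    proof
      fix x assume "x \<in> {x. (x, t) \<in> lev l'}"
      then have C: "(x, t) \<in> C" "l' < H (x, t)" by (auto simp: lev_def)
      have "(l' - l)\<^sup>2 < (H (x, t) - l)\<^sup>2" using C l by (intro power_strict_mono) auto
      then show "x \<in> {x. \<mu> < \<bar>w x\<bar>}" using C l by (simp add: w_def ext_def \<mu>_def)
    qed
    have cw: "continuous_on UNIV w" unfolding w_def
      by (rule slice_continuous[OF ext_continuous[OF l(1)] tt]) auto
    have fin: "emeasure lborel {x. \<mu> < \<bar>w x\<bar>} < \<infinity>"
    proof -
      have "{x. \<mu> < \<bar>w x\<bar>} \<subseteq> cball x1 r" using ext_outside \<mu> unfolding w_def by force
      then have "emeasure lborel {x. \<mu> < \<bar>w x\<bar>} \<le> emeasure lborel (cball x1 r)" by (rule emeasure_mono) simp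
      also have "\<dots> < \<infinity>" using emeasure_compact_finite[OF compact_cball] by simp
      finally show ?thesis .
    qed
    have mm: "{x. \<mu> < \<bar>w x\<bar>} \<in> sets lborel"
    proof -
      have "open {x. \<mu> < \<bar>w x\<bar>}" by (intro open_Collect_less continuous_intros cw)
      then show ?thesis by simp
    qed
    have "measure lborel {x. (x, t) \<in> lev l'} \<le> measure lborel {x. \<mu> < \<bar>w x\<bar>}"
      by (rule measure_mono_fmeasurable[OF sub]) (use lev_slice_borel mm fin in \<open>auto simp: fmeasurable_def\<close>)
    then have "\<mu> powr (2 + 4 / n) * measure lborel {x. (x, t) \<in> lev l'} \<le> \<mu> powr (2 + 4 / n) * measure lborel {x. \<mu> < \<bar>w x\<bar>}"
      by (intro mult_left_mono) auto
    also have "\<dots> \<le> cs * (LBINT x. (w x)\<^sup>2) powr (2 / n) * (LBINT x. \<Sum>b\<in>Basis. (pd b w x)\<^sup>2)"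
    proof -
      have "\<mu> powr (2 + 4 / DIM(real^'n)) * measure lborel {x. \<mu> < \<bar>w x\<bar>}
        \<le> 4 * (4 / unit_ball_vol (DIM(real^'n))) powr (2 / DIM(real^'n)) * (LBINT x. (w x)\<^sup>2) powr (2 / DIM(real^'n))
        * (LBINT x. \<Sum>b\<in>Basis. (pd b w x)\<^sup>2)"
      proof (rule weak_sobolev[OF compact_cball[of x1 r] _ _ _ \<mu>])
        show "w x = 0" if "x \<notin> cball x1 r" for x using that by (simp add: w_def ext_outside)
        show "w differentiable at x" for x
          using slice_has_derivative[OF d] differentiable_def w_def by blast
        show "continuous_on UNIV (pd b w)" if "b \<in> Basis" for b
        proof -
          obtain i where b: "b = axis i 1" using \<open>b \<in> Basis\<close> by (auto simp: Basis_vec_def)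
          show ?thesis unfolding b pw
            by (rule slice_continuous[OF pd_ext_continuous[OF l(1) _ smooth_on_const] tt]) auto
        qed
      qed
      then show ?thesis by (simp add: cs_def n_def)
    qed
    also have "(LBINT x. \<Sum>b\<in>Basis. (pd b w x)\<^sup>2) = (LBINT x. W l (x, t))"
      unfolding sum_Basis_vec pw W_def ..
    also have "cs * (LBINT x. (w x)\<^sup>2) powr (2 / n) * (LBINT x. W l (x, t)) \<le> cs * Y powr (2 / n) * (LBINT x. W l (x, t))"
      unfolding w2 using en1[of t] True ynn[of t] n cs Wnn[of t]
      by (intro mult_right_mono mult_left_mono powr_mono2) (auto simp: J_def)
    finally show ?thesis using True by simp
  qed
  have "\<mu> powr (2 + 4 / n) * measure lborel (lev l') = \<mu> powr (2 + 4 / n) * (LBINT X. indicator (lev l') X)"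
    by simp
  also have "(LBINT X. indicator (lev l') X) = (LBINT t. LBINT x. indicator (lev l') (x, t) :: real)"
    using lborel_pair.integral_snd[OF iL] by (simp add: lborel_prod)
  also have "\<mu> powr (2 + 4 / n) * \<dots> = (LBINT t. \<mu> powr (2 + 4 / n) * measure lborel {x. (x, t) \<in> lev l'})"
    unfolding sl by simp
  also have "\<dots> \<le> (LBINT t. cs * Y powr (2 / n) * (indicator J t * (LBINT x. W l (x, t))))"
  proof (rule integral_mono[OF _ _ slice])
    show "integrable lborel (\<lambda>t. \<mu> powr (2 + 4 / n) * measure lborel {x. (x, t) \<in> lev l'})"
      using lborel_pair.integrable_snd[OF iL] unfolding sl by (rule integrable_mult_right)
    show "integrable lborel (\<lambda>t. cs * Y powr (2 / n) * (indicator J t * (LBINT x. W l (x, t))))"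
      by (rule integrable_mult_right[OF iW])
  qed
  also have "\<dots> = cs * Y powr (2 / n) * (LBINT t. indicator J t * (LBINT x. W l (x, t)))" by simp
  also have "\<dots> \<le> cs * Y powr (2 / n) * (Y / (lam * as))"
    using en2 lam as cs unfolding J_def
    by (intro mult_left_mono) (auto simp: field_simps)
  also have "\<dots> = cs / (lam * as) * Y powr (1 + 2 / n)"
    using Y0 by (cases "Y = 0") (auto simp: powr_add)
  finally show ?thesis unfolding Y_def Rh_integral cs_def \<mu>_def n_def .
qed

end

section \<open>De Giorgi iteration\<close>

text \<open>The recursion is available only while y j \<le> 1, so the induction proves a geometric
  bound whose initial value \<nu> is at most 1 and thereby keeps the recursion available.\<close>

lemma fast_geometric_convergence:
  fixes y :: "nat \<Rightarrow> real"
  assumes d: "0 < \<delta>" and b: "1 < b" and c: "1 \<le> c" and y: "\<And>j. 0 \<le> y j"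
    and step: "\<And>j. y j \<le> 1 \<Longrightarrow> y (Suc j) \<le> c * b ^ j * y j powr (1 + \<delta>)"
    and y0: "y 0 \<le> c powr (- 1 / \<delta>) * b powr (- 1 / \<delta>\<^sup>2)"
  shows "y \<longlonglongrightarrow> 0"
proof -
  define \<nu> where "\<nu> = c powr (- 1 / \<delta>) * b powr (- 1 / \<delta>\<^sup>2)"
  have \<nu>: "0 < \<nu>" using b c by (simp add: \<nu>_def)
  have "c powr (- 1 / \<delta>) \<le> 1" "b powr (- 1 / \<delta>\<^sup>2) \<le> 1"
    using powr_mono[of "- 1 / \<delta>" 0 c] powr_mono[of "- 1 / \<delta>\<^sup>2" 0 b] b c d by auto
  then have \<nu>1: "\<nu> \<le> 1" unfolding \<nu>_def using b c by (intro mult_le_one) auto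
  \<comment> \<open>\<nu> is chosen for this identity: one step then gains exactly the ratio
    b^(-1/\<delta>) of the geometric bound.\<close>
  have \<nu>d: "c * \<nu> powr \<delta> = b powr (- 1 / \<delta>)"
  proof -
    have "\<nu> powr \<delta> = c powr (-1) * b powr (- 1 / \<delta>)"
      unfolding \<nu>_def using b c d by (simp add: powr_mult powr_powr power2_eq_square)
    then show ?thesis using c by (simp add: powr_minus field_simps)
  qed
  have bound: "y j \<le> \<nu> * b powr (- real j / \<delta>)" for j
  proof (induction j)
    case 0
    then show ?case using y0 b by (simp add: \<nu>_def)
  next
    case (Suc j)
    have "b powr (- real j / \<delta>) \<le> 1" using powr_mono[of "- real j / \<delta>" 0 b] b d by simp
    then have "\<nu> * b powr (- real j / \<delta>) \<le> 1" using \<nu> \<nu>1 by (intro mult_le_one) auto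
    then have "y (Suc j) \<le> c * b ^ j * y j powr (1 + \<delta>)" using Suc step by force
    also have "\<dots> \<le> c * b ^ j * (\<nu> * b powr (- real j / \<delta>)) powr (1 + \<delta>)"
      using Suc y d b c by (intro mult_left_mono powr_mono2) auto
    also have "(\<nu> * b powr (- real j / \<delta>)) powr (1 + \<delta>) = \<nu> * \<nu> powr \<delta> * b powr (- real j / \<delta> - real j)"
    proof -
      have ee: "(- real j / \<delta>) * (1 + \<delta>) = - real j / \<delta> - real j" using d by (simp add: field_simps)
      have "(\<nu> * b powr (- real j / \<delta>)) powr (1 + \<delta>) = \<nu> powr (1 + \<delta>) * b powr ((- real j / \<delta>) * (1 + \<delta>))"
        using \<nu> b by (simp only: powr_mult powr_powr)
      then show ?thesis unfolding ee using \<nu> by (simp add: powr_add)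
    qed
    also have "c * b ^ j * (\<nu> * \<nu> powr \<delta> * b powr (- real j / \<delta> - real j))
      = \<nu> * (c * \<nu> powr \<delta>) * (b powr real j * b powr (- real j / \<delta> - real j))"
      using b by (simp add: powr_realpow)
    also have "\<dots> = \<nu> * (b powr (- 1 / \<delta>) * b powr (- real j / \<delta>))"
      unfolding \<nu>d using b by (simp add: powr_add[symmetric])
    also have "b powr (- 1 / \<delta>) * b powr (- real j / \<delta>) = b powr (- real (Suc j) / \<delta>)"
    proof -
      have "- 1 / \<delta> + - real j / \<delta> = - real (Suc j) / \<delta>" using d by (simp add: field_simps)
      then show ?thesis by (simp only: powr_add[symmetric])
    qed
    finally show ?case .
  qed
  have "(\<lambda>j. \<nu> * (b powr (- 1 / \<delta>)) ^ j) \<longlonglongrightarrow> \<nu> * 0"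
  proof (intro tendsto_mult tendsto_const LIMSEQ_realpow_zero)
    show "b powr (- 1 / \<delta>) < 1" using powr_less_mono[of "- 1 / \<delta>" 0 b] b d by simp
  qed (use b in auto)
  moreover have "(\<lambda>j. \<nu> * (b powr (- 1 / \<delta>)) ^ j) = (\<lambda>j. \<nu> * b powr (- real j / \<delta>))"
  proof
    fix j :: nat
    have "(b powr (- 1 / \<delta>)) ^ j = (b powr (- 1 / \<delta>)) powr real j" using b by (simp add: powr_realpow)
    also have "\<dots> = b powr (- real j / \<delta>)" unfolding powr_powr by simp
    finally show "\<nu> * (b powr (- 1 / \<delta>)) ^ j = \<nu> * b powr (- real j / \<delta>)" by simp
  qed
  ultimately have "(\<lambda>j. \<nu> * b powr (- real j / \<delta>)) \<longlonglongrightarrow> 0" by simp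
  then show ?thesis
    using tendsto_sandwich[of "\<lambda>_. 0" y sequentially "\<lambda>j. \<nu> * b powr (- real j / \<delta>)" 0] y bound by auto
qed

text \<open>Bookkeeping of powers in one step. \<open>z\<close> is the measure of the level set in
  units of r^(n + 2) k^(-m), and \<open>e0\<close> stands for k^(p - 2). The auxiliary factor
  \<open>h\<close> is a common scale: by \<open>h1\<close> and \<open>h2\<close> both error terms
  are at most a constant times k^8 r^n h z^(1 - \<theta>). The power k^(8 \<kappa>) then cancels
  against the left side, and \<open>h3\<close> disposes of what remains.\<close>

lemma degiorgi_step:
  fixes k r z A A' n \<kappa> \<theta> e0 h cs lam c1 q1 q2 K1 K2 I F m :: real
  assumes n: "n > 0" and \<kappa>: "\<kappa> = 1 + 2 / n" and k: "1 \<le> k" and r: "0 < r" "r \<le> 1"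
    and \<theta>: "0 \<le> \<theta>" "\<theta> < 1" "\<theta> * (n + 2) \<le> 2" and e0: "0 < e0" and h: "0 < h" and cs: "0 \<le> cs"
    and lam: "0 < lam" and c1: "0 < c1" and q: "0 \<le> q1" "0 \<le> q2"
    and A: "A = r powr (n + 2) * k powr (- m) * z" and z: "0 \<le> z" "z \<le> 1"
    and h1: "1 + e0 \<le> 2 * h * k powr m" and h2: "F\<^sup>2 \<le> h * k powr m * k powr (2 - m * \<theta>) * e0"
    and h3: "k powr m * h powr \<kappa> \<le> e0"
    and step: "((k\<^sup>2 * (1/2) ^ Suc j)\<^sup>2) powr (2 + 4 / n) * A' \<le> cs / (lam * (c1 * e0)) * (8 * (K1 * A + K2 * I)) powr (1 + 2 / n)"
    and K: "0 \<le> K1" "K1 \<le> q1 * k^8 / r\<^sup>2 * (1 + e0)" "0 \<le> K2" "K2 \<le> q2 * k^6 / e0"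
    and I: "0 \<le> I" "I \<le> F\<^sup>2 * A powr (1 - \<theta>)"
  shows "A' * k powr m / r powr (n + 2) \<le> (16 powr \<kappa> * cs / (lam * c1) * (24 * (q1 + q2)) powr \<kappa>) * (16 powr \<kappa>) ^ j * z powr ((1 - \<theta>) * \<kappa>)"
proof -
  have \<kappa>0: "\<kappa> > 0" unfolding \<kappa> using n by (intro add_pos_pos) auto
  have k0: "k > 0" using k by simp
  define Z where "Z = z powr (1 - \<theta>)"
  \<comment> \<open>Because z \<le> 1, the smaller exponent dominates, and both error terms can be
    given the exponent 1 - \<theta> of the term with f.\<close>
  have zZ: "z \<le> Z"
    using z \<theta> powr_mono'[of "1 - \<theta>" 1 z] by (cases "z = 0") (auto simp: Z_def)
  have Z0: "0 \<le> Z" by (simp add: Z_def)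
  have A0: "0 \<le> A" using A z by simp
  have b1: "K1 * A \<le> q1 * k^8 * (2 * h * r powr n * Z)"
  proof -
    have "K1 * A \<le> (q1 * k^8 / r\<^sup>2 * (1 + e0)) * A" using K A0 by (intro mult_right_mono)
    also have "\<dots> \<le> (q1 * k^8 / r\<^sup>2 * (2 * h * k powr m)) * A" using h1 q k A0 by (intro mult_right_mono mult_left_mono) auto
    also have "\<dots> = q1 * k^8 * (2 * h) * (r powr (n + 2) / r\<^sup>2) * (k powr m * k powr (- m)) * z" unfolding A by simp
    also have "k powr m * k powr (- m) = 1" using k0 by (simp add: powr_add[symmetric])
    also have "r powr (n + 2) / r\<^sup>2 = r powr n" using r by (simp add: powr_add)
    also have "q1 * k^8 * (2 * h) * r powr n * 1 * z \<le> q1 * k^8 * (2 * h) * r powr n * 1 * Z"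
      using zZ q k h by (intro mult_left_mono) auto
    finally show ?thesis by simp
  qed
  have b2: "K2 * I \<le> q2 * k^8 * (h * r powr n * Z)"
  proof -
    have "K2 * I \<le> (q2 * k^6 / e0) * (F\<^sup>2 * A powr (1 - \<theta>))" using K I q k e0 by (intro mult_mono) auto
    also have "\<dots> \<le> (q2 * k^6 / e0) * ((h * k powr m * k powr (2 - m * \<theta>) * e0) * A powr (1 - \<theta>))"
      using h2 q k e0 by (intro mult_left_mono mult_right_mono) auto
    also have "A powr (1 - \<theta>) = r powr ((n + 2) * (1 - \<theta>)) * k powr (- m * (1 - \<theta>)) * Z"
      unfolding A Z_def using r k z by (simp add: powr_mult powr_powr)
    also have "(q2 * k^6 / e0) * ((h * k powr m * k powr (2 - m * \<theta>) * e0) * (r powr ((n + 2) * (1 - \<theta>)) * k powr (- m * (1 - \<theta>)) * Z))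
       = q2 * h * Z * k^6 * (k powr m * k powr (2 - m * \<theta>) * k powr (- m * (1 - \<theta>))) * r powr ((n + 2) * (1 - \<theta>))"
      using e0 by simp
    also have "k powr m * k powr (2 - m * \<theta>) * k powr (- m * (1 - \<theta>)) = k powr 2"
      using k0 by (simp add: powr_add[symmetric] algebra_simps)
    also have "k powr 2 = k\<^sup>2" using k0 by simp
    also have "q2 * h * Z * k^6 * k\<^sup>2 * r powr ((n + 2) * (1 - \<theta>)) \<le> q2 * h * Z * k^6 * k\<^sup>2 * r powr n"
    proof (rule mult_left_mono)
      \<comment> \<open>Equivalent to \<theta> (n + 2) \<le> 2. As r \<le> 1, the term with f scales
        in r at least as well as the cut-off term.\<close>
      have "n \<le> (n + 2) * (1 - \<theta>)" using \<theta> by (simp add: algebra_simps)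
      then show "r powr ((n + 2) * (1 - \<theta>)) \<le> r powr n" using powr_mono'[of n "(n + 2) * (1 - \<theta>)" r] r by simp
    qed (use q h Z0 k in auto)
    finally show ?thesis by (simp add: power_add[symmetric] mult_ac)
  qed
  define Q where "Q = 24 * (q1 + q2)"
  have Q0: "Q \<ge> 0" using q by (simp add: Q_def)
  have Y: "8 * (K1 * A + K2 * I) \<le> Q * k^8 * r powr n * h * Z"
  proof -
    have g: "0 \<le> q2 * k^8 * (h * r powr n * Z)" "0 \<le> q1 * k^8 * (h * r powr n * Z)"
      "Q * k^8 * r powr n * h * Z = 24 * (q1 * k^8 * (h * r powr n * Z)) + 24 * (q2 * k^8 * (h * r powr n * Z))"
      "q1 * k^8 * (2 * h * r powr n * Z) = 2 * (q1 * k^8 * (h * r powr n * Z))"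
      using q h Z0 by (auto simp: Q_def algebra_simps)
    have gen: "8 * (x + y) \<le> w" if "0 \<le> c2" "0 \<le> c1" "w = 24 * c1 + 24 * c2" "d = 2 * c1" "x \<le> d" "y \<le> c2"
      for x y w c1 c2 d :: real using that by argo
    show ?thesis by (rule gen[OF g b1 b2])
  qed
  have k8: "(k^8) powr \<kappa> = k powr (8 * \<kappa>)" using powr_powr[of k 8 \<kappa>] k0 by simp
  have Y0: "0 \<le> 8 * (K1 * A + K2 * I)" using K I A0 by simp
  have "(8 * (K1 * A + K2 * I)) powr (1 + 2 / n) \<le> (Q * k^8 * r powr n * h * Z) powr \<kappa>"
    unfolding \<kappa>[symmetric] using Y Y0 \<kappa>0 by (intro powr_mono2) auto
  also have "\<dots> = Q powr \<kappa> * k powr (8 * \<kappa>) * r powr (n * \<kappa>) * h powr \<kappa> * z powr ((1 - \<theta>) * \<kappa>)"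
    using Q0 k0 r h Z0 z k8 by (simp add: powr_mult powr_powr Z_def)
  \<comment> \<open>The power 1 + 2/n restores the scale r^(n + 2) of the cylinder, so r drops out
    of the recursion for z.\<close>
  also have "n * \<kappa> = n + 2" using n by (simp add: \<kappa> field_simps)
  finally have Yk: "(8 * (K1 * A + K2 * I)) powr (1 + 2 / n) \<le> Q powr \<kappa> * k powr (8 * \<kappa>) * r powr (n + 2) * h powr \<kappa> * z powr ((1 - \<theta>) * \<kappa>)" .
  have "((k\<^sup>2 * (1/2) ^ Suc j)\<^sup>2) powr (2 + 4 / n) = (k powr 4 * (1/4) ^ Suc j) powr (2 * \<kappa>)"
  proof -
    have "((1/2::real) ^ Suc j)\<^sup>2 = (1/4) ^ Suc j"
      by (simp add: power2_eq_square power_mult_distrib[symmetric] del: power_Suc)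
    then have "(k\<^sup>2 * (1/2) ^ Suc j)\<^sup>2 = k powr 4 * (1/4) ^ Suc j" using k0 by (simp only: power_mult_distrib) (simp add: power_mult[symmetric])
    moreover have "2 + 4 / n = 2 * \<kappa>" by (simp add: \<kappa>)
    ultimately show ?thesis by (simp only:)
  qed
  also have "\<dots> = k powr (8 * \<kappa>) * ((1/16) powr \<kappa>) ^ Suc j"
  proof -
    have "((1/4::real) ^ Suc j) powr (2 * \<kappa>) = ((1/4) powr real (Suc j)) powr (2 * \<kappa>)"
      by (simp add: powr_realpow del: power_Suc of_nat_Suc)
    also have "\<dots> = ((1/4) powr 2) powr (real (Suc j) * \<kappa>)"
      unfolding powr_powr by (rule arg_cong[where f="\<lambda>x. (1/4) powr x"]) simp
    also have "(1/4::real) powr 2 = 1/16" by (simp add: power2_eq_square)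
    also have "(1/16::real) powr (real (Suc j) * \<kappa>) = ((1/16) powr \<kappa>) powr real (Suc j)"
      unfolding powr_powr by (rule arg_cong[where f="\<lambda>x. (1/16) powr x"]) simp
    also have "\<dots> = ((1/16) powr \<kappa>) ^ Suc j"
      by (simp add: powr_realpow del: power_Suc of_nat_Suc)
    finally have q: "((1/4::real) ^ Suc j) powr (2 * \<kappa>) = ((1/16) powr \<kappa>) ^ Suc j" .
    have "(k powr 4) powr (2 * \<kappa>) = k powr (8 * \<kappa>)" unfolding powr_powr by simp
    moreover have "(k powr 4 * (1/4) ^ Suc j) powr (2 * \<kappa>) = (k powr 4) powr (2 * \<kappa>) * ((1/4) ^ Suc j) powr (2 * \<kappa>)"
      by (rule powr_mult)
    ultimately show ?thesis unfolding q by simp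
  qed
  finally have "k powr (8 * \<kappa>) * ((1/16) powr \<kappa>) ^ Suc j * A'
    \<le> cs / (lam * (c1 * e0)) * (Q powr \<kappa> * k powr (8 * \<kappa>) * r powr (n + 2) * h powr \<kappa> * z powr ((1 - \<theta>) * \<kappa>))"
    using step mult_left_mono[OF Yk, of "cs / (lam * (c1 * e0))"] cs lam c1 e0 by simp
  then have "k powr (8 * \<kappa>) * (((1/16) powr \<kappa>) ^ Suc j * A')
    \<le> k powr (8 * \<kappa>) * (cs / (lam * (c1 * e0)) * (Q powr \<kappa> * r powr (n + 2) * h powr \<kappa> * z powr ((1 - \<theta>) * \<kappa>)))"
    by (simp only: mult_ac)
  then have "((1/16) powr \<kappa>) ^ Suc j * A'
    \<le> cs / (lam * (c1 * e0)) * (Q powr \<kappa> * r powr (n + 2) * h powr \<kappa> * z powr ((1 - \<theta>) * \<kappa>))"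
    by (rule mult_left_le_imp_le) (use k0 in simp)
  then have "(16 powr \<kappa>) ^ Suc j * (((1/16) powr \<kappa>) ^ Suc j * A')
    \<le> (16 powr \<kappa>) ^ Suc j * (cs / (lam * (c1 * e0)) * (Q powr \<kappa> * r powr (n + 2) * h powr \<kappa> * z powr ((1 - \<theta>) * \<kappa>)))"
    by (intro mult_left_mono) auto
  moreover have "(16 powr \<kappa>) ^ Suc j * (((1/16) powr \<kappa>) ^ Suc j * A') = A'"
    by (simp add: mult.assoc[symmetric] power_mult_distrib[symmetric] powr_mult[symmetric] del: power_Suc)
  ultimately have A': "A' \<le> (16 powr \<kappa>) ^ Suc j * (cs / (lam * (c1 * e0)) * (Q powr \<kappa> * r powr (n + 2) * h powr \<kappa> * z powr ((1 - \<theta>) * \<kappa>)))"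
    by (simp only:)
  have "A' * k powr m / r powr (n + 2)
     \<le> ((16 powr \<kappa>) ^ Suc j * (cs / (lam * (c1 * e0)) * (Q powr \<kappa> * r powr (n + 2) * h powr \<kappa> * z powr ((1 - \<theta>) * \<kappa>)))) * k powr m / r powr (n + 2)"
    using A' by (intro divide_right_mono mult_right_mono) auto
  also have "\<dots> = (16 powr \<kappa>) ^ Suc j * (cs / (lam * c1)) * Q powr \<kappa> * z powr ((1 - \<theta>) * \<kappa>) * ((k powr m * h powr \<kappa>) / e0)"
    using r by (simp add: field_simps)
  also have "\<dots> \<le> (16 powr \<kappa>) ^ Suc j * (cs / (lam * c1)) * Q powr \<kappa> * z powr ((1 - \<theta>) * \<kappa>) * 1"
    using h3 e0 cs lam c1 by (intro mult_left_mono) auto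
  finally show ?thesis by (simp add: Q_def mult_ac)
qed

text \<open>The sign of p - 2 decides which end of the range of G is extremal; the absolute value in
  the exponent of D0 covers both cases.\<close>

lemma powr_between:
  fixes k D0 G p :: real
  assumes k: "1 \<le> k" and D0: "1 \<le> D0" and G: "k\<^sup>2 \<le> G" "G \<le> (D0 * k)\<^sup>2"
  shows "D0 powr (- \<bar>p - 2\<bar>) * k powr (p - 2) \<le> G powr (p / 2 - 1)"
    and "G powr (p / 2 - 1) \<le> D0 powr \<bar>p - 2\<bar> * k powr (p - 2)"
proof -
  have pos: "0 < k" "0 < D0" "0 < G" using k D0 G by (auto intro: order_less_le_trans[of 0 "k\<^sup>2"])
  have e1: "(k\<^sup>2) powr (p / 2 - 1) = k powr (p - 2)"
    using pos powr_powr[of k 2 "p / 2 - 1"] by (simp add: algebra_simps)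
  have e2: "((D0 * k)\<^sup>2) powr (p / 2 - 1) = D0 powr (p - 2) * k powr (p - 2)"
  proof -
    have "((D0 * k)\<^sup>2) powr (p / 2 - 1) = (D0 * k) powr (p - 2)"
      using pos powr_powr[of "D0 * k" 2 "p / 2 - 1"] by (simp add: algebra_simps)
    then show ?thesis using pos by (simp add: powr_mult)
  qed
  have dd: "D0 powr (- \<bar>p - 2\<bar>) \<le> 1" "1 \<le> D0 powr \<bar>p - 2\<bar>"
    using powr_mono[of "- \<bar>p - 2\<bar>" 0 D0] powr_mono[of 0 "\<bar>p - 2\<bar>" D0] D0 by auto
  have kk: "D0 powr (- \<bar>p - 2\<bar>) * k powr (p - 2) \<le> k powr (p - 2)" "k powr (p - 2) \<le> D0 powr \<bar>p - 2\<bar> * k powr (p - 2)"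
    using mult_right_mono[OF dd(1), of "k powr (p - 2)"] mult_right_mono[OF dd(2), of "k powr (p - 2)"] by auto
  show "D0 powr (- \<bar>p - 2\<bar>) * k powr (p - 2) \<le> G powr (p / 2 - 1)"
  proof (cases "p \<ge> 2")
    case True
    then have "(k\<^sup>2) powr (p / 2 - 1) \<le> G powr (p / 2 - 1)" using G by (intro powr_mono2) auto
    then show ?thesis using kk e1 by linarith
  next
    case False
    then have "((D0 * k)\<^sup>2) powr (p / 2 - 1) \<le> G powr (p / 2 - 1)" using G pos by (intro powr_mono2') auto
    then show ?thesis using e2 False by simp
  qed
  show "G powr (p / 2 - 1) \<le> D0 powr \<bar>p - 2\<bar> * k powr (p - 2)"
  proof (cases "p \<ge> 2")
    case True
    then have "G powr (p / 2 - 1) \<le> ((D0 * k)\<^sup>2) powr (p / 2 - 1)" using G pos by (intro powr_mono2) auto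
    then show ?thesis using e2 True by simp
  next
    case False
    then have "G powr (p / 2 - 1) \<le> (k\<^sup>2) powr (p / 2 - 1)" using G pos by (intro powr_mono2') auto
    then show ?thesis using kk e1 by linarith
  qed
qed

text \<open>\<open>dg_q1\<close> and \<open>dg_q2\<close> are what remains of \<open>kap1\<close>
  and \<open>kap2\<close> for M2 = (D0 k)^2 once k, r and k^(p - 2) are taken out.
  \<open>dg_C\<close> is the factor of one iteration step, and \<open>dg_nu\<close> the threshold of
  \<open>fast_geometric_convergence\<close> for the ratio 16^(1 + 2/n). None of them depends on eps,
  k or r.\<close>

definition dg_q1 :: "real \<Rightarrow> real \<Rightarrow> real \<Rightarrow> real" where
  "dg_q1 L p D0 = D0^8 * (1/2 + (10 * L + 4) * D0 powr \<bar>p - 2\<bar>)"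
definition dg_q2 :: "real \<Rightarrow> real \<Rightarrow> real \<Rightarrow> real \<Rightarrow> real" where
  "dg_q2 n lam p D0 = (n / (4 * lam) + 9 / (2 * lam) + 1/4) * D0^6 / D0 powr (- \<bar>p - 2\<bar>)"
definition dg_C :: "real \<Rightarrow> real \<Rightarrow> real \<Rightarrow> real \<Rightarrow> real \<Rightarrow> real" where
  "dg_C n lam L p D0 = max 1 (16 powr (1 + 2 / n) * (4 * (4 / unit_ball_vol n) powr (2 / n)) / (lam * D0 powr (- \<bar>p - 2\<bar>))
     * (24 * (dg_q1 L p D0 + dg_q2 n lam p D0)) powr (1 + 2 / n))"
definition dg_nu :: "real \<Rightarrow> real \<Rightarrow> real \<Rightarrow> real \<Rightarrow> real \<Rightarrow> real \<Rightarrow> real" where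
  "dg_nu n lam L p D0 \<theta> = (let \<delta> = (1 - \<theta>) * (1 + 2 / n) - 1 in
     dg_C n lam L p D0 powr (- 1 / \<delta>) * (16 powr (1 + 2 / n)) powr (- 1 / \<delta>\<^sup>2))"

lemma dg_nu_pos: "0 < dg_nu n lam L p D0 \<theta>"
  by (auto simp: dg_nu_def dg_C_def Let_def)

text \<open>The iteration makes the set where H exceeds 2 k^2 a null set. At the centre of the top
  the cut-off equals 1, so a larger value of G there would give that set an open part.\<close>

lemma (in parabolic_cyl) degiorgi:
  fixes k D0 F \<theta> h m :: real
  defines "n \<equiv> real CARD('n)"
  assumes k: "1 \<le> k" and D0: "1 \<le> D0" and r1: "r \<le> 1"
    and GM: "\<And>X. X \<in> K0 \<Longrightarrow> G X \<le> (D0 * k)\<^sup>2"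
    and \<theta>: "0 \<le> \<theta>" "\<theta> * (n + 2) < 2"
    and holder: "\<And>A. A \<in> sets borel \<Longrightarrow> A \<subseteq> K0 \<Longrightarrow> (LBINT X. indicator A X * (f X)\<^sup>2) \<le> F\<^sup>2 * measure lborel A powr (1 - \<theta>)"
    and h: "0 < h"
    and h1: "1 + k powr (p - 2) \<le> 2 * h * k powr m"
    and h2: "F\<^sup>2 \<le> h * k powr m * k powr (2 - m * \<theta>) * k powr (p - 2)"
    and h3: "k powr m * h powr (1 + 2 / n) \<le> k powr (p - 2)"
    and small: "measure lborel (lev (k\<^sup>2)) * k powr m / r powr (n + 2) \<le> dg_nu n lam L p D0 \<theta>"
  shows "G (x1, t1) \<le> 2 * k\<^sup>2"
proof (rule ccontr)
  assume neg: "\<not> ?thesis"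
  have n: "n > 0" by (simp add: n_def)
  define \<kappa> where "\<kappa> = 1 + 2 / n"
  define \<delta> where "\<delta> = (1 - \<theta>) * \<kappa> - 1"
  have \<delta>: "\<delta> > 0"
  proof -
    have "\<delta> = (2 - \<theta> * (n + 2)) / n" using n by (simp add: \<delta>_def \<kappa>_def field_simps)
    then show ?thesis using \<theta> n by simp
  qed
  have \<theta>1: "\<theta> < 1"
  proof (rule ccontr)
    assume "\<not> \<theta> < 1"
    then have "1 * (n + 2) \<le> \<theta> * (n + 2)" using n by (intro mult_right_mono) auto
    then show False using \<theta>(2) n by argo
  qed
  define e0 where "e0 = k powr (p - 2)"
  have e0: "e0 > 0" using k by (simp add: e0_def)
  define c1 where "c1 = D0 powr (- \<bar>p - 2\<bar>)"
  define c2 where "c2 = D0 powr \<bar>p - 2\<bar>"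
  have c12: "c1 > 0" "c2 > 0" using D0 by (auto simp: c1_def c2_def)
  define as where "as = c1 * e0"
  define au where "au = c2 * e0"
  define M2 where "M2 = (D0 * k)\<^sup>2"
  have as: "as > 0" using c12 e0 by (simp add: as_def)
  have bnd: "as \<le> G X powr (p/2 - 1) \<and> G X powr (p/2 - 1) \<le> au \<and> G X \<le> M2" if "X \<in> lev l" "k\<^sup>2 \<le> l" for X l
  proof -
    have X: "X \<in> C" "snd X \<le> t1" "l < H X" using that by (auto simp: lev_def)
    have "eta X * G X \<le> 1 * G X" by (rule mult_right_mono) (use eta_bounds[OF X(1,2)] G_pos[of X] in auto)
    then have "k\<^sup>2 \<le> G X" using X that by (simp add: H_def)
    moreover have "G X \<le> (D0 * k)\<^sup>2" using GM lev_K0[of l] that by blast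
    ultimately show ?thesis
      using powr_between[OF k D0, of "G X" p] by (simp add: as_def au_def M2_def c1_def c2_def e0_def)
  qed
  \<comment> \<open>The levels rise from k^2 towards 2 k^2 with increments k^2 / 2^(j + 1). They
    never fall below k^2, so the coefficient bounds \<open>bnd\<close> hold at every step.\<close>
  define lj where "lj = (\<lambda>j. k\<^sup>2 * (2 - (1/2) ^ j))"
  have lj1: "k\<^sup>2 \<le> lj j" "lj j \<le> 2 * k\<^sup>2" for j
  proof -
    have "(1/2::real) ^ j \<le> 1" by (simp add: power_le_one)
    then show "k\<^sup>2 \<le> lj j" using mult_left_mono[of 1 "2 - (1/2) ^ j" "k\<^sup>2"] by (simp add: lj_def)
    show "lj j \<le> 2 * k\<^sup>2" by (simp add: lj_def algebra_simps)
  qed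
  have k2: "1 \<le> k\<^sup>2" using k by simp
  define z where "z = (\<lambda>j. measure lborel (lev (lj j)) * k powr m / r powr (n + 2))"
  have z0: "0 \<le> z j" for j by (simp add: z_def)
  have L0: "0 \<le> dg_q1 L p D0" "0 \<le> dg_q2 n lam p D0" using L lam D0 n by (auto simp: dg_q1_def dg_q2_def)
  have kap: "0 \<le> kap1 M2 au" "kap1 M2 au \<le> dg_q1 L p D0 * k^8 / r\<^sup>2 * (1 + e0)" "0 \<le> kap2 M2 as" "kap2 M2 as \<le> dg_q2 n lam p D0 * k^6 / e0"
  proof -
    show "0 \<le> kap1 M2 au" unfolding kap1_def using L c12 e0 by (simp add: M2_def au_def)
    show "0 \<le> kap2 M2 as" unfolding kap2_def using lam as by (simp add: M2_def)
    have "M2^4 = D0^8 * k^8" by (simp add: M2_def power_mult[symmetric] power_mult_distrib)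
    then have "kap1 M2 au = D0^8 * (1/2 + (10 * L + 4) * c2 * e0) * (k^8 / r\<^sup>2)"
    proof -
      have "1 / (2 * r\<^sup>2) + (10 * L + 4) * au / r\<^sup>2 = (1/2 + (10 * L + 4) * c2 * e0) * (1 / r\<^sup>2)"
        by (simp add: au_def algebra_simps add_divide_distrib)
      then show ?thesis using \<open>M2^4 = D0^8 * k^8\<close> unfolding kap1_def by simp
    qed
    also have "\<dots> \<le> D0^8 * ((1/2 + (10 * L + 4) * c2) * (1 + e0)) * (k^8 / r\<^sup>2)"
    proof (intro mult_right_mono mult_left_mono)
      have "0 \<le> (10 * L + 4) * c2" using L c12 by simp
      then show "1/2 + (10 * L + 4) * c2 * e0 \<le> (1/2 + (10 * L + 4) * c2) * (1 + e0)"
        using e0 by (simp add: distrib_left distrib_right)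
    qed (use D0 k in auto)
    finally show "kap1 M2 au \<le> dg_q1 L p D0 * k^8 / r\<^sup>2 * (1 + e0)" by (simp add: dg_q1_def c2_def mult_ac)
    have "M2^3 = D0^6 * k^6" by (simp add: M2_def power_mult[symmetric] power_mult_distrib)
    then show "kap2 M2 as \<le> dg_q2 n lam p D0 * k^6 / e0"
      by (simp add: kap2_def dg_q2_def as_def c1_def n_def)
  qed
  have step: "z (Suc j) \<le> dg_C n lam L p D0 * (16 powr \<kappa>) ^ j * z j powr (1 + \<delta>)" if z1: "z j \<le> 1" for j
  proof -
    define A where "A = measure lborel (lev (lj j))"
    define I where "I = (LBINT X. indicator (lev (lj j)) X * (f X)\<^sup>2)"
    have dl: "lj (Suc j) - lj j = k\<^sup>2 * (1/2) ^ Suc j" by (simp add: lj_def algebra_simps)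
    have "0 < k\<^sup>2 * (1/2) ^ Suc j" using k by (intro mult_pos_pos) auto
    then have lt: "lj j < lj (Suc j)" unfolding dl[symmetric] by simp
    have l1: "1 \<le> lj j" using lj1(1)[of j] k2 by linarith
    have st: "((k\<^sup>2 * (1/2) ^ Suc j)\<^sup>2) powr (2 + 4 / n) * measure lborel (lev (lj (Suc j)))
      \<le> 4 * (4 / unit_ball_vol n) powr (2 / n) / (lam * (c1 * e0)) * (8 * (kap1 M2 au * A + kap2 M2 as * I)) powr (1 + 2 / n)"
      using level_step[OF l1 lt as bnd[OF _ lj1(1)]] unfolding dl A_def I_def n_def as_def by simp
    have "measure lborel (lev (lj (Suc j))) * k powr m / r powr (n + 2)
       \<le> (16 powr \<kappa> * (4 * (4 / unit_ball_vol n) powr (2 / n)) / (lam * c1) * (24 * (dg_q1 L p D0 + dg_q2 n lam p D0)) powr \<kappa>)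
          * (16 powr \<kappa>) ^ j * z j powr ((1 - \<theta>) * \<kappa>)"
    proof (rule degiorgi_step[OF n \<kappa>_def k r r1 \<theta>(1) \<theta>1 _ e0 h _ lam c12(1) L0 _ z0 z1 h1[folded e0_def] h2[folded e0_def] _ st kap])
      show "\<theta> * (n + 2) \<le> 2" using \<theta> by simp
      show "A = r powr (n + 2) * k powr (- m) * z j" using r k by (simp add: z_def A_def powr_minus field_simps)
      show "k powr m * h powr \<kappa> \<le> e0" using h3 by (simp add: \<kappa>_def e0_def)
      show "0 \<le> I" unfolding I_def by (intro integral_nonneg_AE AE_I2) auto
      show "I \<le> F\<^sup>2 * A powr (1 - \<theta>)" unfolding I_def A_def by (rule holder[OF lev_borel lev_K0])
    qed simp
    also have "\<dots> \<le> dg_C n lam L p D0 * (16 powr \<kappa>) ^ j * z j powr ((1 - \<theta>) * \<kappa>)"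
      by (intro mult_right_mono) (auto simp: dg_C_def \<kappa>_def c1_def)
    finally show ?thesis by (simp add: z_def \<delta>_def)
  qed
  have zlim: "z \<longlonglongrightarrow> 0"
  proof (rule fast_geometric_convergence[OF \<delta> _ _ z0 step])
    have "0 < \<kappa>" unfolding \<kappa>_def using n by (intro add_pos_pos) auto
    then show "1 < 16 powr \<kappa>" using powr_less_mono[of 0 \<kappa> 16] by simp
    show "1 \<le> dg_C n lam L p D0" by (simp add: dg_C_def)
    show "z 0 \<le> dg_C n lam L p D0 powr (- 1 / \<delta>) * (16 powr \<kappa>) powr (- 1 / \<delta>\<^sup>2)"
      using small by (simp add: z_def lj_def dg_nu_def Let_def \<delta>_def \<kappa>_def)
  qed auto
  define c where "c = k powr m / r powr (n + 2)"
  have c: "c > 0" using k r by (simp add: c_def)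
  have le: "measure lborel (lev (2 * k\<^sup>2)) * c \<le> z j" for j
  proof -
    have "measure lborel (lev (2 * k\<^sup>2)) \<le> measure lborel (lev (lj j))"
    proof (rule measure_mono_fmeasurable)
      show "lev (2 * k\<^sup>2) \<subseteq> lev (lj j)" using lj1(2)[of j] by (auto simp: lev_def)
    qed (use lev_finite lev_borel in \<open>auto simp: fmeasurable_def\<close>)
    then show ?thesis using c mult_right_mono[of _ _ c] by (fastforce simp: z_def c_def)
  qed
  have "measure lborel (lev (2 * k\<^sup>2)) * c \<le> 0"
    by (rule LIMSEQ_le_const[OF zlim]) (use le in auto)
  then have "measure lborel (lev (2 * k\<^sup>2)) = 0" using c measure_nonneg[of lborel "lev (2 * k\<^sup>2)"] by (simp add: mult_le_0_iff)
  then have null: "emeasure lborel (lev (2 * k\<^sup>2)) = 0"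
    using lev_finite[of "2 * k\<^sup>2"] emeasure_eq_ennreal_measure[of lborel "lev (2 * k\<^sup>2)"] by simp
  define U where "U = C \<inter> H -` {2 * k\<^sup>2<..}"
  have U: "open U" unfolding U_def
    by (rule continuous_open_preimage[OF continuous_on_subset[OF smooth_on_continuous[OF H_smooth] C_sub] open_C]) simp
  have "H (x1, t1) = G (x1, t1)" by (simp add: H_def eta_def)
  then have XU: "(x1, t1) \<in> U" using neg r io by (simp add: U_def C_def)
  then obtain d where d: "d > 0" "ball (x1, t1) d \<subseteq> U" using U open_contains_ball by blast
  \<comment> \<open>Level sets contain only times up to t1, whereas the neighbourhood
    \<open>U\<close> reaches beyond; its part strictly before t1 is open and non-empty.\<close>
  define V where "V = U \<inter> {X. snd X < t1}"
  have "(x1, t1 - d / 2) \<in> ball (x1, t1) d" using d by (simp add: dist_Pair_Pair dist_real_def)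
  then have "(x1, t1 - d / 2) \<in> V" using d by (auto simp: V_def)
  moreover have V: "open V" unfolding V_def by (intro open_Int U open_Collect_less continuous_intros)
  ultimately have "\<not> negligible V" using open_not_negligible by blast
  have "V \<subseteq> lev (2 * k\<^sup>2)" by (auto simp: V_def U_def lev_def)
  then have "emeasure lborel V \<le> emeasure lborel (lev (2 * k\<^sup>2))" by (rule emeasure_mono) (use lev_borel in simp)
  then have "emeasure lborel V = 0" using null by simp
  then have "V \<in> null_sets lborel" using V by (auto simp: null_sets_def)
  then have "negligible V" using negligible_iff_null_sets null_sets_completionI by blast
  then show False using \<open>\<not> negligible V\<close> by simp
qed

section \<open>The local bound\<close>

text \<open>Passes from the restricted Lebesgue measure of the statement to \<open>lborel\<close>,
  in which the estimates are carried out.\<close>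

lemma integrable_indicator_compact:
  fixes g :: "'a::euclidean_space \<Rightarrow> real"
  assumes K: "compact K" "continuous_on K g" and A: "A \<in> sets borel" "A \<subseteq> K"
  shows "integrable lborel (\<lambda>X. indicator A X * g X)"
    and "integrable (lebesgue_on A) g"
    and "integral\<^sup>L (lebesgue_on A) g = (LBINT X. indicator A X * g X)"
proof -
  have "integrable lborel (\<lambda>X. indicator A X *\<^sub>R (indicator K X *\<^sub>R g X))"
    using integrable_mult_indicator[OF _ borel_integrable_compact[OF K], of A] A by simp
  moreover have "(\<lambda>X. indicator A X *\<^sub>R (indicator K X *\<^sub>R g X)) = (\<lambda>X. indicator A X * g X)"
  proof
    fix X show "indicator A X *\<^sub>R (indicator K X *\<^sub>R g X) = indicator A X * g X"
      using A(2) by (cases "X \<in> A") (auto simp: subset_iff)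
  qed
  ultimately show i: "integrable lborel (\<lambda>X. indicator A X * g X)" by simp
  then have m: "(\<lambda>X. indicator A X * g X) \<in> borel_measurable lborel" by simp
  have i2: "integrable lebesgue (\<lambda>X. indicator A X * g X)" using i integrable_completion[OF m] by simp
  then show "integrable (lebesgue_on A) g" using A by (subst integrable_restrict_space) auto
  show "integral\<^sup>L (lebesgue_on A) g = (LBINT X. indicator A X * g X)"
    using A by (subst integral_restrict_space) (auto simp: integral_completion[OF m])
qed

text \<open>The number 2/q, read as 0 for q = \<infinity>: the loss in Hoelder's inequality for f^2
  in L^(q/2). The condition q > n + 2 says precisely that (1 - 2/q)(1 + 2/n) > 1, so the recursion
  is superlinear.\<close>

definition hexp :: "ereal \<Rightarrow> real" where "hexp q = (if q = \<infinity> then 0 else 2 / real_of_ereal q)"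

text \<open>For finite q, Hoelder's inequality is obtained by integrating Young's inequality for f^2
  / \<mu> with the optimal scale \<mu>; for q = \<infinity> the essential bound is inserted.\<close>

lemma Lq_holder:
  fixes f :: "'a::euclidean_space \<Rightarrow> real"
  assumes K: "compact K" "continuous_on K f" and S: "S \<in> sets borel" "S \<subseteq> K" and A: "A \<in> sets borel" "A \<subseteq> S"
    and q: "ereal 2 < q" and F: "1 \<le> F" "Lq_norm q S f \<le> F"
  shows "(LBINT X. indicator A X * (f X)\<^sup>2) \<le> F\<^sup>2 * measure lborel A powr (1 - hexp q)"
proof -
  have AK: "A \<subseteq> K" using A S by blast
  have finA: "emeasure lborel A < \<infinity>"
    using emeasure_mono[OF AK, of lborel] emeasure_compact_finite[OF K(1)] K(1)
    by (simp add: compact_imp_closed borel_closed)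
  have i1: "integrable lborel (\<lambda>X. indicator A X * (f X)\<^sup>2)"
    by (rule integrable_indicator_compact(1)[OF K(1) _ A(1) AK]) (intro continuous_intros K)
  have i0: "integrable lborel (indicator A :: _ \<Rightarrow> real)" using A finA by (intro integrable_real_indicator) auto
  show ?thesis
  proof (cases "q = \<infinity>")
    case True
    define M where "M = lebesgue_on S"
    have fm: "f \<in> borel_measurable M" unfolding M_def
      using borel_measurable_integrable[OF integrable_indicator_compact(2)[OF K S]] .
    have "compact (f ` K)" by (rule compact_continuous_image[OF K(2,1)])
    then obtain B where "\<forall>y \<in> f ` K. norm y \<le> B" using compact_imp_bounded bounded_iff by metis
    then have B: "\<bar>f X\<bar> \<le> B" if "X \<in> K" for X using that by auto
    \<comment> \<open>\<open>real_of_ereal\<close> sends infinity to 0, so the essential supremum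
      must be known to be finite before the norm says anything; f is bounded on the compact
      set.\<close>
    have "esssup M (\<lambda>X. ereal \<bar>f X\<bar>) \<le> ereal B"
    proof (rule esssup_I)
      show "(\<lambda>X. ereal \<bar>f X\<bar>) \<in> borel_measurable M" using fm by measurable
      show "AE X in M. ereal \<bar>f X\<bar> \<le> ereal B"
        by (rule AE_I2) (use B S in \<open>auto simp: M_def space_restrict_space\<close>)
    qed
    then have ni: "esssup M (\<lambda>X. ereal \<bar>f X\<bar>) \<noteq> \<infinity>" by auto
    have "AE X in M. ereal \<bar>f X\<bar> \<le> esssup M (\<lambda>X. ereal \<bar>f X\<bar>)" by (rule esssup_AE)
    then have "AE X in M. \<bar>f X\<bar> \<le> F"
    proof (rule AE_mp, intro AE_I2 impI)
      fix X assume "ereal \<bar>f X\<bar> \<le> esssup M (\<lambda>X. ereal \<bar>f X\<bar>)"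
      then have "\<bar>f X\<bar> \<le> Lq_norm q S f"
        using ni True by (cases "esssup M (\<lambda>X. ereal \<bar>f X\<bar>)") (auto simp: Lq_norm_def M_def)
      then show "\<bar>f X\<bar> \<le> F" using F by linarith
    qed
    then have ae: "AE X in lebesgue. X \<in> S \<longrightarrow> \<bar>f X\<bar> \<le> F"
      unfolding M_def using S by (subst (asm) AE_restrict_space_iff) auto
    have m1: "(\<lambda>X. indicator A X * (f X)\<^sup>2) \<in> borel_measurable lborel" using i1 by simp
    have "(LBINT X. indicator A X * (f X)\<^sup>2) = integral\<^sup>L lebesgue (\<lambda>X. indicator A X * (f X)\<^sup>2)"
      by (rule integral_completion[OF m1, symmetric])
    also have "\<dots> \<le> integral\<^sup>L lebesgue (\<lambda>X. F\<^sup>2 * indicator A X)"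
    proof (rule integral_mono_AE)
      show "integrable lebesgue (\<lambda>X. indicator A X * (f X)\<^sup>2)" using i1 integrable_completion[OF m1] by simp
      show "integrable lebesgue (\<lambda>X. F\<^sup>2 * indicator A X)" using i0 by (intro integrable_mult_right) (simp add: integrable_completion)
      show "AE X in lebesgue. indicator A X * (f X)\<^sup>2 \<le> F\<^sup>2 * indicator A X"
        using ae
      proof (rule AE_mp, intro AE_I2 impI)
        fix X assume X: "X \<in> S \<longrightarrow> \<bar>f X\<bar> \<le> F"
        show "indicator A X * (f X)\<^sup>2 \<le> F\<^sup>2 * indicator A X"
        proof (cases "X \<in> A")
          case True
          then have "\<bar>f X\<bar> \<le> \<bar>F\<bar>" using X A F by auto
          then show ?thesis using True by (simp add: abs_le_square_iff)
        qed simp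
      qed
    qed
    also have "\<dots> = F\<^sup>2 * measure lborel A" using A by simp
    finally show ?thesis using True by (simp add: hexp_def)
  next
    case False
    then obtain q0 where q0: "q = ereal q0" "q0 > 2" using q by (cases q) auto
    define a where "a = measure lborel A"
    have ai: "a = (LBINT X. indicator A X)" by (simp add: a_def)
    show ?thesis
    proof (cases "a = 0")
      case True
      then have "emeasure lborel A = 0" using finA emeasure_eq_ennreal_measure[of lborel A] by (simp add: a_def)
      then have "A \<in> null_sets lborel" using A by (auto simp: null_sets_def)
      then have "AE X in lborel. indicator A X * (f X)\<^sup>2 = 0"
        by (rule AE_I'[where N=A]) (auto simp: indicator_def)
      then have "(LBINT X. indicator A X * (f X)\<^sup>2) = 0" by (rule integral_eq_zero_AE)
      then show ?thesis by simp
    next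
      case False
      then have a: "a > 0" by (simp add: a_def zero_less_measure_iff)
      have cp: "continuous_on K (\<lambda>X. \<bar>f X\<bar> powr q0)"
        by (rule continuous_on_powr') (use K q0 in \<open>auto intro!: continuous_intros\<close>)
      define N where "N = (LBINT X. indicator S X * \<bar>f X\<bar> powr q0)"
      have N0: "N \<ge> 0" unfolding N_def by (intro integral_nonneg_AE AE_I2) auto
      have "Lq_norm q S f = N powr (1 / q0)"
        unfolding Lq_norm_def N_def using q0 integrable_indicator_compact(3)[OF K(1) cp S] by simp
      then have "(N powr (1 / q0)) powr q0 \<le> F powr q0" using F q0 by (intro powr_mono2) auto
      then have NF: "N \<le> F powr q0" using N0 q0 by (simp add: powr_powr)
      have i2: "integrable lborel (\<lambda>X. indicator A X * \<bar>f X\<bar> powr q0)"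
        by (rule integrable_indicator_compact(1)[OF K(1) cp A(1) AK])
      have AN: "(LBINT X. indicator A X * \<bar>f X\<bar> powr q0) \<le> N" unfolding N_def
        by (rule integral_mono[OF i2 integrable_indicator_compact(1)[OF K(1) cp S]]) (use A in \<open>auto simp: indicator_def\<close>)
      \<comment> \<open>With this scale the two terms of Young's inequality integrate to at most
        2/q0 and 1 - 2/q0 times the measure a, which add up to a.\<close>
      define \<mu> where "\<mu> = F\<^sup>2 * a powr (- 2 / q0)"
      have \<mu>: "\<mu> > 0" using F a by (simp add: \<mu>_def)
      have \<mu>q: "\<mu> powr (q0 / 2) = F powr q0 / a"
      proof -
        have "(F\<^sup>2) powr (q0 / 2) = F powr q0" using powr_powr[of F 2 "q0 / 2"] F by simp
        moreover have "(a powr (- 2 / q0)) powr (q0 / 2) = a powr (-1)" using q0 by (simp add: powr_powr)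
        moreover have "\<mu> powr (q0 / 2) = (F\<^sup>2) powr (q0 / 2) * (a powr (- 2 / q0)) powr (q0 / 2)"
          unfolding \<mu>_def by (rule powr_mult)
        ultimately show ?thesis using a by (simp add: powr_minus_divide)
      qed
      have young: "(f X)\<^sup>2 / \<mu> \<le> (2 / q0) * (\<bar>f X\<bar> powr q0 * (a / F powr q0)) + (1 - 2 / q0)" for X
      proof (cases "f X = 0")
        case True
        then show ?thesis using q0 by simp
      next
        case False
        define w where "w = (f X)\<^sup>2 / \<mu>"
        have w: "w > 0" using False \<mu> by (simp add: w_def)
        have "w powr (q0 / 2) = \<bar>f X\<bar> powr q0 * (a / F powr q0)"
        proof -
          have "((f X)\<^sup>2) powr (q0 / 2) = \<bar>f X\<bar> powr q0"
            using powr_powr[of "\<bar>f X\<bar>" 2 "q0 / 2"] False by simp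
          then show ?thesis using \<mu> \<mu>q by (simp add: w_def powr_divide)
        qed
        moreover have "(w powr (q0 / 2)) powr (2 / q0) * 1 powr (1 - 2 / q0) \<le> (2 / q0) * w powr (q0 / 2) + (1 - 2 / q0) * 1"
          by (rule Youngs_inequality_0) (use w q0 in auto)
        moreover have "(w powr (q0 / 2)) powr (2 / q0) = w" using w q0 by (simp add: powr_powr)
        ultimately show ?thesis unfolding w_def[symmetric] by simp
      qed
      have "(LBINT X. indicator A X * (f X)\<^sup>2) / \<mu> = (LBINT X. indicator A X * (f X)\<^sup>2 / \<mu>)" by simp
      also have "\<dots> \<le> (LBINT X. (2 / q0) * (a / F powr q0) * (indicator A X * \<bar>f X\<bar> powr q0) + (1 - 2 / q0) * indicator A X)"
      proof (rule integral_mono)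
        show "indicator A X * (f X)\<^sup>2 / \<mu> \<le> (2 / q0) * (a / F powr q0) * (indicator A X * \<bar>f X\<bar> powr q0) + (1 - 2 / q0) * indicator A X" for X
          using young[of X] by (cases "X \<in> A") (auto simp: mult_ac)
      qed (intro integrable_divide Bochner_Integration.integrable_add integrable_mult_right i0 i1 i2)+
      also have "\<dots> = (2 / q0) * (a / F powr q0) * (LBINT X. indicator A X * \<bar>f X\<bar> powr q0) + (1 - 2 / q0) * a"
        using i0 i2 ai by simp
      also have "\<dots> \<le> (2 / q0) * (a / F powr q0) * F powr q0 + (1 - 2 / q0) * a"
        using AN NF a q0 F by (intro add_mono mult_left_mono) auto
      also have "\<dots> = a" using F q0 by (simp add: field_simps)
      finally have "(LBINT X. indicator A X * (f X)\<^sup>2) \<le> a * \<mu>" using \<mu> by (simp add: field_simps)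
      also have "a * \<mu> = F\<^sup>2 * (a powr 1 * a powr (- 2 / q0))" using a by (simp add: \<mu>_def)
      also have "a powr 1 * a powr (- 2 / q0) = a powr (1 - hexp q)" unfolding powr_add[symmetric] by (simp add: hexp_def q0)
      finally show ?thesis by (simp add: a_def)
    qed
  qed
qed

section \<open>The exponents, and the bound at one point in terms of the data\<close>

definition dexp :: "real \<Rightarrow> real \<Rightarrow> real" where
  "dexp n p = (if p \<ge> 2 then p / 2 else 2 * p / (p * (n + 2) - 2 * n))"
definition d1exp :: "real \<Rightarrow> real" where "d1exp p = (if p \<ge> 2 then 2 else p / (p - 1))"

text \<open>Measuring the superlevel sets at height \<open>k\<^sup>2\<close> in units of \<open>k powr (- m)\<close> with this \<open>m\<close>
  removes \<open>k\<close> from the recursion of the iteration.\<close>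

definition mexp :: "real \<Rightarrow> real \<Rightarrow> real" where "mexp n p = (if p \<ge> 2 then p - 2 else (2 - p) * n / 2)"

text \<open>This is the origin of the exponent d. The superlevel set at k^2 has measure at most
  k^(-p) times the integral of V^p, so in units of k^(-m) smallness means that k^(p - m) dominates
  the integral. For p < 2 the condition p - m > 0 is the lower bound 2n/(n + 2) on p, and d/p is the
  reciprocal of p - m.\<close>

lemma mexp_dexp:
  assumes n: "2 \<le> n" and p: "2 * n / (n + 2) < p"
  shows "1 < p" "0 < dexp n p" "dexp n p / p = 1 / (p - mexp n p)" "0 < p - mexp n p" "0 \<le> mexp n p"
proof -
  have "1 \<le> 2 * n / (n + 2)" using n by (simp add: field_simps)
  then show p1: "1 < p" using p by linarith
  have pos: "0 < p * (n + 2) - 2 * n" using p n by (simp add: field_simps)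
  show "0 < dexp n p" using p1 pos by (simp add: dexp_def)
  have e: "p - (2 - p) * n / 2 = (p * (n + 2) - 2 * n) / 2" by (simp add: field_simps)
  show pm: "0 < p - mexp n p" using pos e by (auto simp: mexp_def)
  show "dexp n p / p = 1 / (p - mexp n p)"
  proof (cases "p \<ge> 2")
    case True
    then show ?thesis using p1 by (simp add: mexp_def dexp_def)
  next
    case False
    then have pe: "p - mexp n p = (p * (n + 2) - 2 * n) / 2" using e by (simp only: mexp_def if_False)
    show ?thesis unfolding pe using False p1 by (simp add: dexp_def)
  qed
  show "0 \<le> mexp n p" using n by (simp add: mexp_def)
qed

context parabolic_eq
begin

definition V :: "(real^'n) \<times> real \<Rightarrow> real" where "V X = sqrt (G X)"

lemma V_pos: "0 < V X" using G_pos by (simp add: V_def)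

lemma V_continuous: "continuous_on D V"
  unfolding V_def[abs_def] by (intro continuous_intros smooth_on_continuous G_smooth)

lemma Vp_continuous: "continuous_on D (\<lambda>X. V X powr p)"
  by (intro continuous_on_powr V_continuous continuous_on_const) (use V_pos in \<open>auto simp: less_imp_neq[symmetric]\<close>)

text \<open>Reduces the hypotheses of \<open>degiorgi\<close> to two conditions that say how large k
  must be: one against F, one against the integral of V^p.\<close>

lemma local_bound:
  fixes k D0 F \<theta> r t1 :: real and x1 :: "real^'n"
  defines "n \<equiv> real CARD('n)"
  defines "K \<equiv> cball x1 r \<times> {t1 - r\<^sup>2..t1}"
  assumes n2: "2 \<le> n" and p: "2 * n / (n + 2) < p" and L: "0 \<le> L"
    and r01: "0 < r" "r \<le> 1" and KD: "K \<subseteq> D" and k: "1 \<le> k" and D0: "1 \<le> D0"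
    and VM: "\<And>X. X \<in> K \<Longrightarrow> V X \<le> D0 * k"
    and \<theta>: "0 \<le> \<theta>" "\<theta> * (n + 2) < 2"
    and holder: "\<And>A. A \<in> sets borel \<Longrightarrow> A \<subseteq> K \<Longrightarrow> (LBINT X. indicator A X * (f X)\<^sup>2) \<le> F\<^sup>2 * measure lborel A powr (1 - \<theta>)"
    and F: "1 \<le> F" "F powr (d1exp p * (dexp n p / p)) \<le> k"
    and small: "(LBINT X. indicator K X * V X powr p) \<le> dg_nu n lam L p D0 \<theta> * r powr (n + 2) * k powr (p / dexp n p)"
  shows "G (x1, t1) \<le> 2 * k\<^sup>2"
proof -
  note me = mexp_dexp[OF n2 p]
  define m where "m = mexp n p"
  \<comment> \<open>For p \<ge> 2 the power k^(p - 2) dominates 1, and h = 1 works with m = p - 2.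
    For p < 2 it is at most 1, so h k^m = 1 suffices for \<open>h1\<close>; then \<open>h3\<close>
    reads k^(-2 m / n) \<le> k^(p - 2), and m is the value that gives equality.\<close>
  define h where "h = (if p \<ge> 2 then 1 else k powr (- m))"
  have k0: "0 < k" using k by simp
  have \<theta>1: "\<theta> < 1"
  proof (rule ccontr)
    assume "\<not> \<theta> < 1"
    then have "1 * (n + 2) \<le> \<theta> * (n + 2)" using n2 by (intro mult_right_mono) auto
    then show False using \<theta>(2) n2 by argo
  qed
  have cK: "compact K" unfolding K_def by (intro compact_Times compact_cball compact_Icc)
  \<comment> \<open>The compact cylinder has positive distance to the complement of
    \<open>D\<close>; half of it provides the margin beyond the top time.\<close>
  have "\<exists>\<delta>>0. \<forall>X\<in>K. \<forall>Y\<in>- D. \<delta> \<le> dist X Y"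
    by (rule separate_compact_closed[OF cK]) (use D KD in auto)
  then obtain \<delta> where \<delta>: "\<delta> > 0" "\<And>X Y. X \<in> K \<Longrightarrow> Y \<in> - D \<Longrightarrow> \<delta> \<le> dist X Y"
    by blast
  define io where "io = \<delta> / 2"
  have sub: "cball x1 r \<times> {t1 - r\<^sup>2..t1 + io} \<subseteq> D"
  proof
    fix X assume "X \<in> cball x1 r \<times> {t1 - r\<^sup>2..t1 + io}"
    then obtain x t where X: "X = (x, t)" "x \<in> cball x1 r" "t1 - r\<^sup>2 \<le> t" "t \<le> t1 + io" by auto
    show "X \<in> D"
    proof (cases "t \<le> t1")
      case True
      then show ?thesis using X KD by (auto simp: K_def)
    next
      case False
      have "(x, t1) \<in> K" using X by (simp add: K_def)
      moreover have "dist (x, t1) (x, t) < \<delta>" using False X \<delta>(1) by (simp add: dist_Pair_Pair dist_real_def io_def)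
      ultimately show ?thesis using \<delta>(2)[of "(x, t1)" "(x, t)"] X by force
    qed
  qed
  interpret parabolic_cyl D E u f p lam L eps x1 t1 r io
    by unfold_locales (use r01 \<delta> sub L in \<open>auto simp: io_def\<close>)
  have h: "0 < h" using k0 by (simp add: h_def)
  have m0: "0 \<le> m" using me by (simp add: m_def)
  show ?thesis
  proof (rule degiorgi[OF k D0 r01(2), folded n_def K_def, where \<theta>=\<theta> and F=F and h=h and m=m])
    show "G X \<le> (D0 * k)\<^sup>2" if "X \<in> K" for X
    proof -
      have "(V X)\<^sup>2 \<le> (D0 * k)\<^sup>2" using VM[OF that] V_pos[of X] by (intro power_mono) auto
      then show ?thesis using G_pos[of X] by (simp add: V_def)
    qed
    show "1 + k powr (p - 2) \<le> 2 * h * k powr m"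
    proof (cases "p \<ge> 2")
      case True
      then show ?thesis using powr_mono[of 0 "p - 2" k] k by (simp add: h_def m_def mexp_def)
    next
      case False
      then have "k powr (p - 2) \<le> 1" using powr_mono[of "p - 2" 0 k] k by simp
      moreover have "k powr (- m) * k powr m = 1" using k0 by (simp add: powr_add[symmetric])
      ultimately show ?thesis using False by (simp add: h_def mult.assoc)
    qed
    show "F\<^sup>2 \<le> h * k powr m * k powr (2 - m * \<theta>) * k powr (p - 2)"
    proof (cases "p \<ge> 2")
      case True
      then have "F \<le> k" using F me by (simp add: d1exp_def dexp_def)
      then have "F\<^sup>2 \<le> k\<^sup>2" using F by (intro power_mono) auto
      also have "\<dots> = k powr 2" using k0 by simp
      also have "\<dots> \<le> k powr (m + (2 - m * \<theta>) + (p - 2))"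
      proof (rule powr_mono)
        have "m * \<theta> \<le> m * 1" using m0 \<theta>1 by (intro mult_left_mono) auto
        then show "2 \<le> m + (2 - m * \<theta>) + (p - 2)" using True by simp
      qed (use k in simp)
      also have "\<dots> = h * k powr m * k powr (2 - m * \<theta>) * k powr (p - 2)"
        using True by (simp only: powr_add h_def if_True mult_1_left)
      finally show ?thesis .
    next
      case False
      \<comment> \<open>Needed is F^2 \<le> k^(p - m \<theta>), given is F^s \<le> k. Since d/p =
        1/(p - m) and \<theta> < 1, the product s (p - m \<theta>) is at least d1, which for p < 2
        is the conjugate exponent and hence at least 2.\<close>
      define s where "s = d1exp p * (dexp n p / p)"
      have d1: "d1exp p \<ge> 2" using False me(1) by (simp add: d1exp_def field_simps)
      have pm: "p - m * \<theta> \<ge> p - m" using m0 \<theta>1 mult_left_mono[of \<theta> 1 m] by simp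
      have s: "s * (p - m * \<theta>) \<ge> 2"
      proof -
        have "2 * 1 \<le> d1exp p * ((p - m * \<theta>) / (p - m))"
          using d1 pm me(4) by (intro mult_mono) (auto simp: m_def)
        also have "\<dots> = s * (p - m * \<theta>)" by (simp add: s_def me(3) m_def)
        finally show ?thesis by simp
      qed
      have "F\<^sup>2 = F powr 2" using F by simp
      also have "\<dots> \<le> F powr (s * (p - m * \<theta>))" using s F by (intro powr_mono) auto
      also have "\<dots> = (F powr s) powr (p - m * \<theta>)" by (simp add: powr_powr)
      also have "\<dots> \<le> k powr (p - m * \<theta>)" using F(2) pm me(4) by (intro powr_mono2) (auto simp: s_def m_def)
      also have "p - m * \<theta> = - m + m + (2 - m * \<theta>) + (p - 2)" by simp
      also have "k powr \<dots> = h * k powr m * k powr (2 - m * \<theta>) * k powr (p - 2)"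
        using False by (simp only: powr_add h_def if_False)
      finally show ?thesis .
    qed
    show "k powr m * h powr (1 + 2 / n) \<le> k powr (p - 2)"
    proof (cases "p \<ge> 2")
      case True
      then show ?thesis by (simp add: h_def m_def mexp_def)
    next
      case False
      have "k powr m * h powr (1 + 2 / n) = k powr (m + (- m) * (1 + 2 / n))"
        unfolding powr_add[of k m] using False by (simp only: h_def if_False powr_powr)
      also have "m + (- m) * (1 + 2 / n) = p - 2" using False n2 by (simp add: m_def mexp_def field_simps)
      finally show ?thesis by simp
    qed
    \<comment> \<open>Chebyshev's inequality: H \<le> G on the cylinder, so V \<ge> k on the level
      set at height k^2.\<close>
    have lk: "measure lborel (lev (k\<^sup>2)) * k powr p \<le> (LBINT X. indicator K X * V X powr p)"
    proof -
      have "measure lborel (lev (k\<^sup>2)) * k powr p = (LBINT X. indicator (lev (k\<^sup>2)) X * k powr p)" by simp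
      also have "\<dots> \<le> (LBINT X. indicator K X * V X powr p)"
      proof (rule integral_mono)
        show "integrable lborel (\<lambda>X. indicator (lev (k\<^sup>2)) X * k powr p)"
          using lev_finite by (intro integrable_mult_left integrable_real_indicator) auto
        show "integrable lborel (\<lambda>X. indicator K X * V X powr p)"
          using integrable_indicator_compact(1)[OF cK continuous_on_subset[OF Vp_continuous KD], of K] cK
          by (simp add: compact_imp_closed borel_closed)
        show "indicator (lev (k\<^sup>2)) X * k powr p \<le> indicator K X * V X powr p" for X
        proof (cases "X \<in> lev (k\<^sup>2)")
          case True
          then have X: "X \<in> C" "snd X \<le> t1" "k\<^sup>2 < H X" by (auto simp: lev_def)
          have XK: "X \<in> K" using lev_K0 True unfolding K_def by blast
          have "eta X * G X \<le> 1 * G X" by (rule mult_right_mono) (use eta_bounds[OF X(1,2)] G_pos[of X] in auto)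
          then have "k\<^sup>2 \<le> G X" using X by (simp add: H_def)
          then have "k \<le> V X" unfolding V_def by (rule real_le_rsqrt)
          then have "k powr p \<le> V X powr p" using k0 me(1) by (intro powr_mono2) auto
          then show ?thesis using True XK by simp
        qed simp
      qed
      finally show ?thesis .
    qed
    show "measure lborel (lev (k\<^sup>2)) * k powr m / r powr (n + 2) \<le> dg_nu n lam L p D0 \<theta>"
    proof -
      have pd: "p / dexp n p = p - m" using me by (simp add: m_def field_simps)
      have "measure lborel (lev (k\<^sup>2)) * k powr m * k powr (p - m) = measure lborel (lev (k\<^sup>2)) * k powr p"
        by (simp add: powr_add[symmetric] mult.assoc)
      also have "\<dots> \<le> dg_nu n lam L p D0 \<theta> * r powr (n + 2) * k powr (p - m)"
        using lk small unfolding pd by linarith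
      finally have "measure lborel (lev (k\<^sup>2)) * k powr m \<le> dg_nu n lam L p D0 \<theta> * r powr (n + 2)"
        by (rule mult_right_le_imp_le) (use k0 in simp)
      then show ?thesis using r by (simp add: field_simps)
    qed
  qed (use \<theta> holder h in auto)
qed

end

section \<open>The supremum estimate\<close>

lemma cyl_facts:
  fixes x0 :: "real^'n" and t0 R :: real
  assumes R: "0 < R"
  shows "cyl x0 t0 R \<in> sets borel" "closure (cyl x0 t0 R) = cball x0 R \<times> {t0 - R\<^sup>2..t0}"
    "measure lborel (cyl x0 t0 R) = unit_ball_vol (real CARD('n)) * R powr (real CARD('n) + 2)"
    "measure lebesgue (cyl x0 t0 R) = unit_ball_vol (real CARD('n)) * R powr (real CARD('n) + 2)"
proof -
  show b: "cyl x0 t0 R \<in> sets borel"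
    unfolding cyl_def borel_prod[symmetric] by (intro pair_measureI) auto
  show "closure (cyl x0 t0 R) = cball x0 R \<times> {t0 - R\<^sup>2..t0}"
    unfolding cyl_def closure_Times using R by (simp add: closure_ball)
  have "emeasure lborel (cyl x0 t0 R) = emeasure lborel (ball x0 R) * emeasure lborel {t0 - R\<^sup>2<..t0}"
    unfolding cyl_def lborel_prod[symmetric] by (rule lborel.emeasure_pair_measure_Times) auto
  also have "\<dots> = ennreal (unit_ball_vol (real CARD('n)) * R ^ CARD('n)) * ennreal (R\<^sup>2)"
    using R by (simp add: emeasure_ball)
  also have "\<dots> = ennreal (unit_ball_vol (real CARD('n)) * R ^ CARD('n) * R\<^sup>2)"
    using R by (simp add: ennreal_mult[symmetric])
  finally have "measure lborel (cyl x0 t0 R) = unit_ball_vol (real CARD('n)) * R ^ CARD('n) * R\<^sup>2"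
    using R by (simp add: measure_def)
  also have "\<dots> = unit_ball_vol (real CARD('n)) * R powr (real CARD('n) + 2)"
    using R by (simp add: powr_add powr_realpow)
  finally show m: "measure lborel (cyl x0 t0 R) = unit_ball_vol (real CARD('n)) * R powr (real CARD('n) + 2)" .
  then show "measure lebesgue (cyl x0 t0 R) = unit_ball_vol (real CARD('n)) * R powr (real CARD('n) + 2)"
    using b by simp
qed

text \<open>On a cylinder of radius r the smallness condition asks k^(p/d) to dominate r^(-(n + 2))
  times an integral, so k has to grow like r^(-(n + 2) d/p). This is the weight exponent, and
  \<open>bound_const\<close> is the matching constant.\<close>

definition bound_exp :: "real \<Rightarrow> real \<Rightarrow> real" where "bound_exp n p = (n + 2) * (dexp n p / p)"
definition bound_const :: "real \<Rightarrow> real \<Rightarrow> real \<Rightarrow> real \<Rightarrow> real \<Rightarrow> real" where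
  "bound_const n lam L p \<theta> = max 1 ((unit_ball_vol n / dg_nu n lam L p (2 powr (bound_exp n p + 1)) \<theta>) powr (dexp n p / p))"

text \<open>The local bound is applied on a cylinder centred at a maximum point of \<open>\<rho>\<^sup>\<alpha> V\<close>, where \<open>\<rho>\<close> is the
  parabolic distance to the lateral and bottom boundary: on the cylinder of half the size
  \<open>V\<close> is then at most \<open>2\<^sup>\<alpha>\<close> times its value at the centre, so no absorption argument
  over nested cylinders is needed.\<close>

lemma (in parabolic_eq) sup_estimate:
  fixes x0 :: "real^'n" and t0 R th :: real and q :: ereal
  defines "n \<equiv> real CARD('n)"
  defines "\<alpha> \<equiv> bound_exp n p" and "S \<equiv> cyl x0 t0 R"
  defines "A \<equiv> 1 + Lq_norm q S f powr d1exp p + integral\<^sup>L (lebesgue_on S) (\<lambda>X. V X powr p) / measure lebesgue S"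
  assumes n2: "2 \<le> n" and p: "2 * n / (n + 2) < p" and L: "0 \<le> L" and q: "ereal (n + 2) < q"
    and R: "0 < R" "R < 1" and SD: "closure S \<subseteq> D" and th: "0 < th" "th < 1" and Y: "Y \<in> cyl x0 t0 (th * R)"
  shows "V Y \<le> 2 powr (\<alpha> + 1) * bound_const n lam L p (hexp q) / (1 - th) powr \<alpha> * A powr (dexp n p / p)"
proof -
  note me = mexp_dexp[OF n2 p]
  define e where "e = dexp n p / p"
  have e: "e > 0" using me by (simp add: e_def)
  define \<theta> where "\<theta> = hexp q"
  \<comment> \<open>A factor 2^\<alpha> comes from comparing the weight on the half-size cylinder
    with that at its centre, another 2 from V X \<le> 2 k.\<close>
  define D0 where "D0 = 2 powr (\<alpha> + 1)"
  define \<nu> where "\<nu> = dg_nu n lam L p D0 \<theta>"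
  define B where "B = bound_const n lam L p \<theta>"
  have \<alpha>: "\<alpha> = (n + 2) * e" by (simp add: \<alpha>_def bound_exp_def e_def)
  have \<alpha>0: "\<alpha> > 0" unfolding \<alpha> using e n2 by (intro mult_pos_pos) auto
  have \<nu>: "\<nu> > 0" unfolding \<nu>_def by (rule dg_nu_pos)
  have B: "B \<ge> 1" "B \<ge> (unit_ball_vol n / \<nu>) powr e"
    by (simp_all add: B_def bound_const_def \<nu>_def D0_def \<alpha>_def e_def)
  have D0: "D0 \<ge> 1" unfolding D0_def using \<alpha>0 by (intro ge_one_powr_ge_zero) auto
  have v: "unit_ball_vol n > 0" using n2 by simp
  have \<theta>: "0 \<le> \<theta>" "\<theta> * (n + 2) < 2"
  proof (atomize (full), cases "q = \<infinity>")
    case True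
    then show "0 \<le> \<theta> \<and> \<theta> * (n + 2) < 2" by (simp add: \<theta>_def hexp_def)
  next
    case False
    then obtain q0 where q0: "q = ereal q0" "n + 2 < q0" using q by (cases q) auto
    then show "0 \<le> \<theta> \<and> \<theta> * (n + 2) < 2" using n2 by (simp add: \<theta>_def hexp_def field_simps)
  qed
  have q2: "ereal 2 < q" using q n2 by (cases q) auto
  note cf = cyl_facts[OF R(1), of x0 t0, folded S_def n_def]
  define Kc where "Kc = cball x0 R \<times> {t0 - R\<^sup>2..t0}"
  have cK: "compact Kc" unfolding Kc_def by (intro compact_Times compact_cball compact_Icc)
  have KD: "Kc \<subseteq> D" using SD cf(2) by (simp add: Kc_def)
  have SK: "S \<subseteq> Kc" using closure_subset[of S] cf(2) by (simp add: Kc_def)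
  define Iv where "Iv = (LBINT X. indicator S X * V X powr p)"
  have Iv0: "Iv \<ge> 0" unfolding Iv_def by (intro integral_nonneg_AE AE_I2) auto
  have A_eq: "A = 1 + Lq_norm q S f powr d1exp p + Iv / (unit_ball_vol n * R powr (n + 2))"
    unfolding A_def cf(4) Iv_def
    using integrable_indicator_compact(3)[OF cK continuous_on_subset[OF Vp_continuous KD] cf(1) SK] by simp
  have A1: "A \<ge> 1" "Iv / (unit_ball_vol n * R powr (n + 2)) \<le> A" "Lq_norm q S f powr d1exp p \<le> A"
    using Iv0 v by (simp_all add: A_eq)
  \<comment> \<open>F \<ge> 1 lets powers of F be compared through their exponents; the summand 1 in
    \<open>A\<close> pays for it.\<close>
  define F where "F = max 1 (Lq_norm q S f)"
  have F: "F \<ge> 1" "Lq_norm q S f \<le> F" by (auto simp: F_def)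
  have FA: "F powr d1exp p \<le> A"
    using A1 by (cases "Lq_norm q S f \<le> 1") (auto simp: F_def max_def)
  define \<rho> where "\<rho> = (\<lambda>X :: (real^'n) \<times> real. min (R - dist x0 (fst X)) (sqrt (R\<^sup>2 - (t0 - snd X))))"
  have c\<rho>: "continuous_on Kc \<rho>" unfolding \<rho>_def by (intro continuous_intros)
  have \<rho>0: "0 \<le> \<rho> X" if "X \<in> Kc" for X using that by (auto simp: \<rho>_def Kc_def)
  have "continuous_on Kc (\<lambda>X. \<rho> X powr \<alpha> * V X)"
  proof (rule continuous_on_mult)
    show "continuous_on Kc (\<lambda>X. \<rho> X powr \<alpha>)"
      by (rule continuous_on_powr'[OF c\<rho> continuous_on_const]) (use \<rho>0 \<alpha>0 in auto)
    show "continuous_on Kc V" by (rule continuous_on_subset[OF V_continuous KD])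
  qed
  moreover have "Kc \<noteq> {}" using R by (auto simp: Kc_def)
  ultimately obtain X where X: "X \<in> Kc" "\<And>Z. Z \<in> Kc \<Longrightarrow> \<rho> Z powr \<alpha> * V Z \<le> \<rho> X powr \<alpha> * V X"
    using continuous_attains_sup[OF cK, of "\<lambda>X. \<rho> X powr \<alpha> * V X"] by blast
  obtain y s where Yeq: "Y = (y, s)" by (cases Y)
  have Yb: "dist x0 y < th * R" "t0 - (th * R)\<^sup>2 < s" "s \<le> t0" using Y by (auto simp: cyl_def Yeq)
  have thR: "th * R < R" "0 < th * R" using th R by auto
  then have thR2: "(th * R)\<^sup>2 < R\<^sup>2" by (intro power_strict_mono) auto
  have YK: "Y \<in> Kc" using Yb thR thR2 by (auto simp: Kc_def Yeq)
  \<comment> \<open>The two distances in \<open>\<rho>\<close> are bounded separately. In time the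
    gap R^2 - (th R)^2 is at least the square of (1 - th) R, because th^2 \<le> th.\<close>
  have \<rho>Y: "(1 - th) * R \<le> \<rho> Y"
  proof -
    have 1: "(1 - th) * R \<le> R - dist x0 y" using Yb by (simp add: algebra_simps)
    have "((1 - th) * R)\<^sup>2 \<le> R\<^sup>2 - (th * R)\<^sup>2"
    proof -
      have "th\<^sup>2 \<le> th" using th by (simp add: power2_eq_square mult_left_le)
      then have "(1 - th)\<^sup>2 \<le> 1 - th\<^sup>2" by (simp add: power2_eq_square algebra_simps)
      then have "(1 - th)\<^sup>2 * R\<^sup>2 \<le> (1 - th\<^sup>2) * R\<^sup>2" by (rule mult_right_mono) simp
      also have "(1 - th\<^sup>2) * R\<^sup>2 = R\<^sup>2 - (th * R)\<^sup>2" by (simp add: left_diff_distrib power_mult_distrib)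
      finally show ?thesis unfolding power_mult_distrib[of "1 - th"] .
    qed
    also have "\<dots> \<le> R\<^sup>2 - (t0 - s)" using Yb by simp
    finally have 2: "(1 - th) * R \<le> sqrt (R\<^sup>2 - (t0 - s))" by (rule real_le_rsqrt)
    show ?thesis using 1 2 by (simp add: \<rho>_def Yeq)
  qed
  have rY: "0 < (1 - th) * R" using th R by simp
  have "0 < \<rho> Y powr \<alpha> * V Y" using rY \<rho>Y V_pos[of Y] by simp
  then have "0 < \<rho> X powr \<alpha> * V X" using X(2)[OF YK] by linarith
  then have \<rho>X: "0 < \<rho> X" using \<rho>0[OF X(1)] by (cases "\<rho> X = 0") auto
  obtain x1 t1 where Xeq: "X = (x1, t1)" by (cases X)
  define r where "r = \<rho> X / 2"
  have r: "0 < r" "\<rho> X = 2 * r" using \<rho>X by (auto simp: r_def)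
  have rx: "2 * r \<le> R - dist x0 x1" "2 * r \<le> sqrt (R\<^sup>2 - (t0 - t1))"
    using r(2) by (auto simp: \<rho>_def Xeq min_def split: if_splits)
  have rt: "4 * r\<^sup>2 \<le> R\<^sup>2 - (t0 - t1)"
  proof -
    have "(2 * r)\<^sup>2 \<le> (sqrt (R\<^sup>2 - (t0 - t1)))\<^sup>2" using rx(2) r(1) by (intro power_mono) auto
    also have "\<dots> = R\<^sup>2 - (t0 - t1)" using X(1) by (simp add: Kc_def Xeq)
    finally show ?thesis by (simp add: power_mult_distrib)
  qed
  have t1: "t1 \<le> t0" using X(1) by (simp add: Kc_def Xeq)
  have rR: "2 * r \<le> R" using rx(1) zero_le_dist[of x0 x1] by linarith
  define K where "K = cball x1 r \<times> {t1 - r\<^sup>2..t1}"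
  have r2: "r\<^sup>2 > 0" using r by simp
  have K: "Z \<in> S" "r \<le> \<rho> Z" if "Z \<in> K" for Z
  proof -
    obtain z w where Z: "Z = (z, w)" by (cases Z)
    have zw: "dist x1 z \<le> r" "t1 - r\<^sup>2 \<le> w" "w \<le> t1" using that by (auto simp: K_def Z)
    have dz: "dist x0 z \<le> R - r" using dist_triangle[of x0 z x1] zw(1) rx(1) by linarith
    have wz: "r\<^sup>2 \<le> R\<^sup>2 - (t0 - w)" "0 < R\<^sup>2 - (t0 - w)" using zw(2) rt r2 by linarith+
    show "Z \<in> S" using dz r(1) wz zw t1 by (simp add: S_def cyl_def Z)
    have "r \<le> sqrt (R\<^sup>2 - (t0 - w))" using wz(1) by (rule real_le_rsqrt)
    then show "r \<le> \<rho> Z" using dz by (simp add: \<rho>_def Z)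
  qed
  have KS: "K \<subseteq> S" using K by blast
  have KB: "K \<in> sets borel" unfolding K_def by (intro borel_closed closed_Times) auto
  have VK: "V Z \<le> 2 powr \<alpha> * V X" if Z: "Z \<in> K" for Z
  proof -
    have "r powr \<alpha> * V Z \<le> \<rho> Z powr \<alpha> * V Z"
      using K(2)[OF Z] r(1) \<alpha>0 V_pos[of Z] by (intro mult_right_mono powr_mono2) auto
    also have "\<dots> \<le> \<rho> X powr \<alpha> * V X" by (rule X(2)) (use K(1)[OF Z] SK in blast)
    also have "\<dots> = r powr \<alpha> * (2 powr \<alpha> * V X)" using r by (simp add: powr_mult)
    finally show ?thesis by (rule mult_left_le_imp_le) (use r in simp)
  qed
  \<comment> \<open>The data enter through A^e; (R / r)^\<alpha> compensates for averaging over a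
    large cylinder while working in a small one, and \<open>B\<close> absorbs the smallness
    threshold.\<close>
  define k0 where "k0 = B * (R / r) powr \<alpha> * A powr e"
  \<comment> \<open>Taking k \<ge> V X / 2 supplies the required bound V \<le> D0 k on the cylinder.
    If this term were the strict maximum, the local bound would read (V X)^2 \<le> (V X)^2 / 2,
    which is impossible; so V X \<le> 2 k0 in every case.\<close>
  define k where "k = max (V X / 2) k0"
  have Rr: "1 \<le> R / r" using rR r(1) by (simp add: field_simps)
  have Ra: "1 \<le> (R / r) powr \<alpha>" using Rr \<alpha>0 by (intro ge_one_powr_ge_zero) auto
  have Ae: "1 \<le> A powr e" using A1(1) e by (intro ge_one_powr_ge_zero) auto
  have BR: "1 \<le> B * (R / r) powr \<alpha>" using mult_mono[OF B(1) Ra] B(1) by simp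
  have k0A: "A powr e \<le> k0" unfolding k0_def using mult_right_mono[OF BR, of "A powr e"] by simp
  have kk: "k0 \<le> k" "V X / 2 \<le> k" by (auto simp: k_def)
  have k1: "1 \<le> k" using Ae k0A kk by linarith
  have k00: "0 < k0" using Ae k0A by linarith
  have "G (x1, t1) \<le> 2 * k\<^sup>2"
  proof (rule local_bound[where F=F and \<theta>=\<theta> and r=r and ?D0.0=D0 and k=k and ?x1.0=x1 and ?t1.0=t1, folded n_def K_def])
    show "K \<subseteq> D" using KS SK KD by blast
    show "V Z \<le> D0 * k" if "Z \<in> K" for Z
    proof -
      have "V Z \<le> 2 powr \<alpha> * V X" by (rule VK[OF that])
      also have "\<dots> = D0 * (V X / 2)" by (simp add: D0_def powr_add)
      also have "\<dots> \<le> D0 * k" using kk D0 by (intro mult_left_mono) auto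
      finally show ?thesis .
    qed
    show "(LBINT X. indicator A X * (f X)\<^sup>2) \<le> F\<^sup>2 * measure lborel A powr (1 - \<theta>)" if "A \<in> sets borel" "A \<subseteq> K" for A
      unfolding \<theta>_def
      by (rule Lq_holder[OF cK continuous_on_subset[OF smooth_on_continuous[OF f] KD] cf(1) SK that(1) _ q2 F])
        (use that KS in blast)
    show "F powr (d1exp p * (dexp n p / p)) \<le> k"
    proof -
      have "F powr (d1exp p * e) = (F powr d1exp p) powr e" by (simp add: powr_powr)
      also have "\<dots> \<le> A powr e" using FA e by (intro powr_mono2) auto
      finally show ?thesis using k0A kk unfolding e_def by linarith
    qed
    show "(LBINT X. indicator K X * V X powr p) \<le> dg_nu n lam L p D0 \<theta> * r powr (n + 2) * k powr (p / dexp n p)"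
    proof -
      have pe: "p / dexp n p = 1 / e" by (simp add: e_def)
      have "(LBINT X. indicator K X * V X powr p) \<le> Iv" unfolding Iv_def
      proof (rule integral_mono)
        note ii = integrable_indicator_compact(1)[OF cK continuous_on_subset[OF Vp_continuous KD]]
        show "integrable lborel (\<lambda>X. indicator K X * V X powr p)" by (rule ii[OF KB]) (use KS SK in blast)
        show "integrable lborel (\<lambda>X. indicator S X * V X powr p)" by (rule ii[OF cf(1) SK])
        show "indicator K X * V X powr p \<le> indicator S X * V X powr p" for X
          using KS by (auto simp: indicator_def)
      qed
      also have "Iv \<le> unit_ball_vol n * R powr (n + 2) * A"
        using A1(2) v R by (simp add: field_simps)
      also have "\<dots> \<le> \<nu> * r powr (n + 2) * k powr (1 / e)"
      proof -
        have "k0 powr (1 / e) = B powr (1 / e) * ((R / r) powr \<alpha>) powr (1 / e) * (A powr e) powr (1 / e)"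
          unfolding k0_def by (simp only: powr_mult)
        also have "((R / r) powr \<alpha>) powr (1 / e) = (R / r) powr (n + 2)" using e by (simp add: powr_powr \<alpha>)
        also have "(A powr e) powr (1 / e) = A" using e A1 by (simp add: powr_powr)
        finally have k0e: "k0 powr (1 / e) = B powr (1 / e) * (R / r) powr (n + 2) * A" .
        have "unit_ball_vol n / \<nu> = ((unit_ball_vol n / \<nu>) powr e) powr (1 / e)" using e v \<nu> by (simp add: powr_powr)
        also have "\<dots> \<le> B powr (1 / e)" using B e by (intro powr_mono2) auto
        finally have "unit_ball_vol n \<le> \<nu> * B powr (1 / e)" using \<nu> by (simp add: field_simps)
        then have "unit_ball_vol n * (R powr (n + 2) * A) \<le> \<nu> * B powr (1 / e) * (R powr (n + 2) * A)"
          using A1 by (intro mult_right_mono) auto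
        also have "\<dots> = \<nu> * r powr (n + 2) * k0 powr (1 / e)"
          unfolding k0e using r R by (simp add: powr_divide)
        also have "\<dots> \<le> \<nu> * r powr (n + 2) * k powr (1 / e)"
          using kk k00 e \<nu> by (intro mult_left_mono powr_mono2) auto
        finally show ?thesis by (simp add: mult.assoc)
      qed
      finally show ?thesis unfolding pe \<nu>_def .
    qed
  qed (use n2 p L r rR R k1 D0 \<theta> F in auto)
  then have "(V X)\<^sup>2 \<le> 2 * k\<^sup>2" using G_pos[of X] by (simp add: V_def Xeq)
  have VX: "V X \<le> 2 * k0"
  proof (cases "V X / 2 \<le> k0")
    case False
    then have "k = V X / 2" by (simp add: k_def)
    then have "(V X)\<^sup>2 \<le> 2 * (V X / 2)\<^sup>2" using \<open>(V X)\<^sup>2 \<le> 2 * k\<^sup>2\<close> by (simp only:)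
    then have "(V X)\<^sup>2 \<le> 0" by (simp add: power_divide)
    then show ?thesis using V_pos[of X] by simp
  qed simp
  have "((1 - th) * R) powr \<alpha> * V Y \<le> \<rho> Y powr \<alpha> * V Y"
    using \<rho>Y rY \<alpha>0 V_pos[of Y] by (intro mult_right_mono powr_mono2) auto
  also have "\<dots> \<le> \<rho> X powr \<alpha> * V X" by (rule X(2)[OF YK])
  also have "\<dots> \<le> (2 * r) powr \<alpha> * (2 * k0)" unfolding r(2) by (rule mult_left_mono[OF VX]) simp
  also have "\<dots> = R powr \<alpha> * (2 powr (\<alpha> + 1) * B * A powr e)"
    using r R by (simp add: k0_def powr_mult powr_divide powr_add)
  finally have "R powr \<alpha> * ((1 - th) powr \<alpha> * V Y) \<le> R powr \<alpha> * (2 powr (\<alpha> + 1) * B * A powr e)"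
    by (simp add: powr_mult mult_ac)
  then have "(1 - th) powr \<alpha> * V Y \<le> 2 powr (\<alpha> + 1) * B * A powr e"
    by (rule mult_left_le_imp_le) (use R in simp)
  then show ?thesis using th unfolding B_def \<theta>_def e_def by (simp add: field_simps)
qed

section \<open>The approximate problem as an instance, and the conclusion\<close>

lemma hessq_add:
  assumes "smooth_on UNIV E" "smooth_on UNIV F"
  shows "hessq (\<lambda>z. E z + F z) z v = hessq E z v + hessq F z v"
proof -
  have b: "axis i (1::real) \<in> Basis" for i :: 'a by (simp add: axis_in_Basis_iff)
  have 1: "pd (axis k 1) (\<lambda>z. E z + F z) = (\<lambda>z. pd (axis k 1) E z + pd (axis k 1) F z)" for k
    by (rule ext) (intro pd_add smooth_on_differentiable[OF assms(1)] smooth_on_differentiable[OF assms(2)]; simp)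
  have "pd (axis i 1) (\<lambda>z. pd (axis k 1) E z + pd (axis k 1) F z) z = pd (axis i 1) (pd (axis k 1) E) z + pd (axis i 1) (pd (axis k 1) F) z" for i k
    by (intro pd_add smooth_on_differentiable[OF smooth_on_pd[OF assms(1) b]] smooth_on_differentiable[OF smooth_on_pd[OF assms(2) b]]; simp)
  then have "hess (\<lambda>z. E z + F z) z = hess E z + hess F z"
    by (simp add: vec_eq_iff hess_nth 1)
  then show ?thesis by (simp add: hessq_def matrix_vector_mult_add_rdistrib inner_add_right)
qed

lemma parabolic_eq_Eeps:
  fixes u f :: "(real^'n) \<times> real \<Rightarrow> real"
  assumes D: "open D" and j: "mollifier j" and E1: "struct_E1 K0 E1" and Ep: "struct_Ep p lam0 Lam0 Ep"
    and mb: "moll_bounds p lam Lam K j E1 Ep" and eps: "\<epsilon> \<in> {0<..<1}"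
    and f: "smooth_on D f" and u: "smooth_on D u" and weak: "weak_solution (Eeps j \<epsilon> E1 Ep) D u f"
    and p: "1 < p" and lam: "0 < lam" and K: "0 < K"
  shows "parabolic_eq D (Eeps j \<epsilon> E1 Ep) u f p lam (K + \<bar>Lam\<bar>) \<epsilon>"
proof
  have cE: "continuous_on UNIV E1" "continuous_on UNIV Ep"
    using E1 Ep Ck_on_continuous unfolding struct_E1_def struct_Ep_def by blast+
  have s: "smooth_on UNIV (moll j \<epsilon> E1)" "smooth_on UNIV (moll j \<epsilon> Ep)"
    using eps by (auto intro!: smooth_on_moll[OF j] cE)
  have Ee: "Eeps j \<epsilon> E1 Ep = (\<lambda>z. moll j \<epsilon> E1 z + moll j \<epsilon> Ep z)" by (auto simp: Eeps_def)
  show sE: "smooth_on UNIV (Eeps j \<epsilon> E1 Ep)" unfolding Ee by (rule smooth_on_add[OF open_UNIV s])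
  show "pd et u X - (\<Sum>i\<in>UNIV. pd (ex i) (\<lambda>X. pd (axis i 1) (Eeps j \<epsilon> E1 Ep) (grad_x u X)) X) = f X" if "X \<in> D" for X
    by (rule classical_solution[OF D sE u f j weak that])
  show "lam * (\<epsilon>\<^sup>2 + (norm z)\<^sup>2) powr (p/2 - 1) * (norm v)\<^sup>2 \<le> hessq (Eeps j \<epsilon> E1 Ep) z v \<and>
       hessq (Eeps j \<epsilon> E1 Ep) z v \<le> (K + \<bar>Lam\<bar>) * (\<epsilon>\<^sup>2 + (norm z)\<^sup>2) powr (p/2 - 1) * (norm v)\<^sup>2"
    if g1: "1 \<le> \<epsilon>\<^sup>2 + (norm z)\<^sup>2" for z v
  proof -
    define g where "g = \<epsilon>\<^sup>2 + (norm z)\<^sup>2"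
    have b: "0 \<le> hessq (moll j \<epsilon> E1) z v" "hessq (moll j \<epsilon> E1) z v \<le> K * g powr (-1/2) * (norm v)\<^sup>2"
      "lam * g powr (p/2 - 1) * (norm v)\<^sup>2 \<le> hessq (moll j \<epsilon> Ep) z v"
      "hessq (moll j \<epsilon> Ep) z v \<le> Lam * g powr (p/2 - 1) * (norm v)\<^sup>2"
      using mb eps unfolding moll_bounds_def g_def by blast+
    \<comment> \<open>As p > 1, the exponent -1/2 lies below p/2 - 1, and for g \<ge> 1 the larger
      exponent dominates.\<close>
    have "K * g powr (-1/2) * (norm v)\<^sup>2 \<le> K * g powr (p/2 - 1) * (norm v)\<^sup>2"
      using g1 p K by (intro mult_right_mono mult_left_mono powr_mono) (auto simp: g_def)
    moreover have "Lam * g powr (p/2 - 1) * (norm v)\<^sup>2 \<le> \<bar>Lam\<bar> * g powr (p/2 - 1) * (norm v)\<^sup>2"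
      by (intro mult_right_mono) auto
    ultimately show ?thesis unfolding Ee hessq_add[OF s] g_def[symmetric] using b by (simp add: algebra_simps)
  qed
qed (use D u f lam eps in auto)

theorem theorem2p4:
  fixes p \<sigma> lam Lam K :: real and q :: ereal
  defines "n \<equiv> real CARD('n)"
  assumes n2: "CARD('n) \<ge> 2"
    and p_range: "2 * n / (n + 2) < p"
    and q_range: "ereal (n + 2) < q"
    and sigma_range: "2 < \<sigma>" "ereal (2 * \<sigma>) < q"
    and consts_pos: "0 < lam" "0 < K"
  defines "d \<equiv> (if p \<ge> 2 then p / 2 else 2 * p / (p * (n + 2) - 2 * n))"
    and "d1 \<equiv> (if p \<ge> 2 then 2 else p / (p - 1))"
  defines "d2 \<equiv> (if CARD('n) \<ge> 3 then d * (n + 2) / p else 2 * d * \<sigma> / p)"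
  shows "\<exists>C>1. \<forall>(\<Omega>::(real^'n) set) T j E1 Ep lam0 Lam0 K0 \<epsilon> u f x0 t0 R \<theta>.
      bounded_lipschitz_domain \<Omega> \<and> 0 < T \<and>
      mollifier j \<and> 0 < lam0 \<and> struct_E1 K0 E1 \<and> struct_Ep p lam0 Lam0 Ep \<and>
      moll_bounds p lam Lam K j E1 Ep \<and>
      \<epsilon> \<in> {0<..<1} \<and>
      smooth_on (\<Omega> \<times> {0<..<T}) f \<and> in_Lq q (\<Omega> \<times> {0<..<T}) f \<and>
      smooth_on (\<Omega> \<times> {0<..<T}) u \<and>
      weak_solution (Eeps j \<epsilon> E1 Ep) (\<Omega> \<times> {0<..<T}) u f \<and>
      R \<in> {0<..<1} \<and> closure (cyl x0 t0 R) \<subseteq> \<Omega> \<times> {0<..<T} \<and> \<theta> \<in> {0<..<1}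
      \<longrightarrow>
      (let V = (\<lambda>X. sqrt (\<epsilon>\<^sup>2 + (norm (grad_x u X))\<^sup>2)) in
        Sup (V ` cyl x0 t0 (\<theta> * R))
          \<le> C / (1 - \<theta>) powr d2 *
            (1 + Lq_norm q (cyl x0 t0 R) f powr d1
               + integral\<^sup>L (lebesgue_on (cyl x0 t0 R)) (\<lambda>X. V X powr p)
                   / measure lebesgue (cyl x0 t0 R)) powr (d / p))"
proof -
  have n2': "2 \<le> n" unfolding n_def using n2 by simp
  have d: "d = dexp n p" "d1 = d1exp p" by (simp_all add: d_def dexp_def d1_def d1exp_def)
  note me = mexp_dexp[OF n2' p_range]
  define L where "L = K + \<bar>Lam\<bar>"
  have L: "0 \<le> L" using consts_pos by (simp add: L_def)
  define \<alpha> where "\<alpha> = bound_exp n p"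
  \<comment> \<open>Formed from n, p, q, lam and K + |Lam| alone, before the domain, \<epsilon>, the
    solution and the cylinder are introduced.\<close>
  define C where "C = 2 powr (\<alpha> + 1) * bound_const n lam L p (hexp q)"
  have dp: "0 < d / p" using me d by simp
  have \<alpha>0: "0 < \<alpha>" unfolding \<alpha>_def bound_exp_def using dp n2' d by (intro mult_pos_pos) auto
  \<comment> \<open>For n \<ge> 3 the two exponents agree. For n = 2 the proof yields 4 d/p, which
    is below 2 d \<sigma>/p as \<sigma> > 2; since 1 - \<theta> < 1, a larger exponent only weakens
    the bound.\<close>
  have \<alpha>d2: "\<alpha> \<le> d2"
  proof (cases "CARD('n) \<ge> 3")
    case True
    then show ?thesis by (simp add: \<alpha>_def bound_exp_def d2_def d mult.commute)
  next
    case False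
    then have n: "n = 2" unfolding n_def using n2 by simp
    have "(d / p) * 4 \<le> (d / p) * (2 * \<sigma>)" using dp sigma_range by (intro mult_left_mono) auto
    moreover have "\<alpha> = (d / p) * 4" by (simp add: \<alpha>_def bound_exp_def n d)
    moreover have "d2 = (d / p) * (2 * \<sigma>)" using False by (simp add: d2_def)
    ultimately show ?thesis by simp
  qed
  have "1 < 2 powr (\<alpha> + 1)" using powr_less_mono[of 0 "\<alpha> + 1" 2] \<alpha>0 by simp
  moreover have "1 \<le> bound_const n lam L p (hexp q)" by (simp add: bound_const_def)
  ultimately have C1: "1 < C" unfolding C_def by (smt (verit) mult_le_cancel_left1)
  show ?thesis
  proof (intro exI[of _ C] conjI allI impI C1)
    fix \<Omega> :: "(real^'n) set" and j E1 Ep :: "real^'n \<Rightarrow> real" and u f :: "(real^'n) \<times> real \<Rightarrow> real"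
      and x0 :: "real^'n" and T lam0 Lam0 K0 \<epsilon> t0 R \<theta> :: real
    assume asm: "bounded_lipschitz_domain \<Omega> \<and> 0 < T \<and>
      mollifier j \<and> 0 < lam0 \<and> struct_E1 K0 E1 \<and> struct_Ep p lam0 Lam0 Ep \<and>
      moll_bounds p lam Lam K j E1 Ep \<and>
      \<epsilon> \<in> {0<..<1} \<and>
      smooth_on (\<Omega> \<times> {0<..<T}) f \<and> in_Lq q (\<Omega> \<times> {0<..<T}) f \<and>
      smooth_on (\<Omega> \<times> {0<..<T}) u \<and>
      weak_solution (Eeps j \<epsilon> E1 Ep) (\<Omega> \<times> {0<..<T}) u f \<and>
      R \<in> {0<..<1} \<and> closure (cyl x0 t0 R) \<subseteq> \<Omega> \<times> {0<..<T} \<and> \<theta> \<in> {0<..<1}"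
    define D where "D = \<Omega> \<times> {0<..<T}"
    have oD: "open D" using asm unfolding D_def bounded_lipschitz_domain_def by (blast intro: open_Times open_greaterThanLessThan)
    have R: "0 < R" "R < 1" and \<theta>: "0 < \<theta>" "\<theta> < 1" and SD: "closure (cyl x0 t0 R) \<subseteq> D"
      using asm unfolding D_def by auto
    have "parabolic_eq D (Eeps j \<epsilon> E1 Ep) u f p lam (K + \<bar>Lam\<bar>) \<epsilon>"
      by (rule parabolic_eq_Eeps[OF oD _ _ _ _ _ _ _ _ me(1) consts_pos]) (use asm in \<open>unfold D_def, blast+\<close>)
    then interpret P: parabolic_eq D "Eeps j \<epsilon> E1 Ep" u f p lam L \<epsilon> by (simp add: L_def)
    define V where "V = (\<lambda>X. sqrt (\<epsilon>\<^sup>2 + (norm (grad_x u X))\<^sup>2))"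
    have V: "P.V = V" by (simp add: fun_eq_iff P.V_def P.G_eq V_def)
    define A where "A = 1 + Lq_norm q (cyl x0 t0 R) f powr d1
       + integral\<^sup>L (lebesgue_on (cyl x0 t0 R)) (\<lambda>X. V X powr p) / measure lebesgue (cyl x0 t0 R)"
    have "Sup (V ` cyl x0 t0 (\<theta> * R)) \<le> C / (1 - \<theta>) powr d2 * A powr (d / p)"
    proof (rule cSUP_least)
      have "(x0, t0) \<in> cyl x0 t0 (\<theta> * R)" using R \<theta> by (simp add: cyl_def)
      then show "cyl x0 t0 (\<theta> * R) \<noteq> {}" by blast
      fix Y assume "Y \<in> cyl x0 t0 (\<theta> * R)"
      from P.sup_estimate[folded n_def, OF n2' p_range L q_range R SD \<theta> this]
      have "V Y \<le> C / (1 - \<theta>) powr \<alpha> * A powr (d / p)"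
        unfolding V d[symmetric] A_def[symmetric] \<alpha>_def[symmetric] C_def .
      also have "\<dots> \<le> C / (1 - \<theta>) powr d2 * A powr (d / p)"
        using \<theta> C1 powr_mono'[OF \<alpha>d2, of "1 - \<theta>"]
        by (intro mult_right_mono divide_left_mono mult_pos_pos) auto
      finally show "V Y \<le> C / (1 - \<theta>) powr d2 * A powr (d / p)" .
    qed
    then show "let V = (\<lambda>X. sqrt (\<epsilon>\<^sup>2 + (norm (grad_x u X))\<^sup>2)) in
        Sup (V ` cyl x0 t0 (\<theta> * R))
          \<le> C / (1 - \<theta>) powr d2 *
            (1 + Lq_norm q (cyl x0 t0 R) f powr d1
               + integral\<^sup>L (lebesgue_on (cyl x0 t0 R)) (\<lambda>X. V X powr p)
                   / measure lebesgue (cyl x0 t0 R)) powr (d / p)"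
      unfolding Let_def V_def[symmetric] A_def[symmetric] .
  qed
qed

end
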